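(* Let $\Phi$ be a tubular elliptic root system, $\Gamma=\Gamma(\Phi)$ an elliptic root basis of $\Phi$, $W=W_\Phi$ the elliptic Weyl group, and $c\in W$ a Coxeter transformation with respect to $\Gamma$. If $\Phi$ is not of type $D_4^{(1,1)}$, then the Hurwitz action is transitive on the set $\mathrm{Red}_T(c)^{\mathrm{gen}}$. If $\Phi$ is of type $D_4^{(1,1)}$, then the Hurwitz action has exactly two orbits on $\mathrm{Red}_T(c)^{\mathrm{gen}}$.
   Context: Let $V$ be a finite dimensional real vector space with a positive semidefinite symmetric bilinear form $(\cdot\mid\cdot)$ whose radical $R$ is 2-dimensional. A (simply-laced) elliptic root system in $V$ is a non-empty subset $\Phi\subset V$ with $(\alpha\mid\alpha)=2$ for all $\alpha\in\Phi$, $\mathrm{span}_{\mathbb R}(\Phi)=V$, $s_\alpha(\Phi)\subseteq\Phi$ for all $\alpha\in\Phi$ where $s_\alpha(v)=v-(\alpha\mid v)\alpha$, $(\alpha\mid\beta)\in\mathbb Z$ for all $\alpha,\beta\in\Phi$, and such that $L(\Phi)=\mathrm{span}_{\mathbb Z}(\Phi)$ is a full lattice in $V$. It is irreducible if it is not a union of two non-empty mutually orthogonal subsets. Let $\Phi_{\mathrm{fin}}$ be the image of $\Phi$ in $V/R$; it is a finite root system. An irreducible $\Phi$ is called tubular if $\Phi_{\mathrm{fin}}$ is of type $D_4,E_6,E_7$ or $E_8$; $\Phi$ is then said to be of type $D_4^{(1,1)},E_6^{(1,1)},E_7^{(1,1)},E_8^{(1,1)}$, respectively. $W=W_\Phi=\langle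 s_\alpha\mid\alpha\in\Phi\rangle$ and $T=\{s_\alpha\mid\alpha\in\Phi\}$ is its set of reflections. Elliptic root basis: let $n$ be the rank of $\Phi_{\mathrm{fin}}$ (so $\dim V=n+2$). Choose a one-dimensional subspace $U\subset R$ with $L(\Phi)\cap U\neq 0$ and $a\in U$ with $L(\Phi)\cap U=\mathbb Za$. The image of $\Phi$ in $V/U$ is an irreducible affine root system; choose a simple system $\{\beta_0,\dots,\beta_n\}$ of it, numbered so that for (unique) positive integers $m_1,\dots,m_n$ the element $\beta_0+\sum_{i=1}^n m_i\beta_i$ generates the intersection of $\mathrm{span}_{\mathbb Z}\{\beta_0,\dots,\beta_n\}$ with $R/U$. Choose preimages $\alpha_i\in\Phi$ of $\beta_i$, $0\le i\le n$. In the tubular cases there is a unique index $t\in\{1,\dots,n\}$ with $m_t=\max_{1\le i\le n} m_i$ (the branch vertex of the Dynkin diagram of $\Phi_{\mathrm{fin}}$, with $m_t=2,3,4,6$ for $D_4,E_6,E_7,E_8$). Put $\alpha_t^*=\alpha_t+a$. Then $\Gamma=\{\alpha_0,\dots,\alpha_n,\alpha_t^*\}$ is an elliptic root basis. A Coxeter transformation with respect to $\Gamma$ is $c=\Big(\prod_{0\le i\le n,\,i\ne t}s_{\alpha_i}\Big)s_{\alpha_t}s_{\alpha_t^*}$, the first product being taken in an arbitrary order. One has $\ell_T(c)=n+2$, where $\ell_T$ is word length with respect to $T$. $\mathrm{Red}_T(c)^{\mathrm{gen}}$ is the set of $(t_1,\dots,t_{n+2})\in T^{n+2}$ with $c=t_1\cdots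 t_{n+2}$ and $W=\langle t_1,\dots,t_{n+2}\rangle$. The Hurwitz action of the braid group $\mathcal B_{n+2}$ on it is given on standard generators by $\sigma_i(g_1,\dots,g_{n+2})=(g_1,\dots,g_{i-1},g_{i+1},g_{i+1}^{-1}g_ig_{i+1},g_{i+2},\dots,g_{n+2})$. *)

theory Defs
  imports
    "HOL-Analysis.Linear_Algebra"
    "HOL-Computational_Algebra.Group_Closure"
    "HOL-Algebra.Generated_Groups"
    "HOL-Algebra.Group_Action"
begin

section \<open>Elliptic root systems\<close>

text \<open>
  The ambient space $V$ is a whole type of class \<open>real_vector\<close>. The subgroup generated by a set,
  i.e. its span over the integers, is the library's \<open>group_closure\<close>.
\<close>

definition radical :: "('v::real_vector \<Rightarrow> 'v \<Rightarrow> real) \<Rightarrow> 'v set" where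
  "radical B = {v. \<forall>w. B v w = 0}"

definition reflection :: "('v::real_vector \<Rightarrow> 'v \<Rightarrow> real) \<Rightarrow> 'v \<Rightarrow> 'v \<Rightarrow> 'v" where
  "reflection B \<alpha> v = v - B \<alpha> v *\<^sub>R \<alpha>"

definition full_lattice :: "'v::real_vector set \<Rightarrow> bool" where
  "full_lattice L \<longleftrightarrow> (\<exists>X. independent X \<and> span X = UNIV \<and> L = group_closure X)"

definition elliptic_root_system :: "('v::real_vector \<Rightarrow> 'v \<Rightarrow> real) \<Rightarrow> 'v set \<Rightarrow> bool" where
  "elliptic_root_system B \<Phi> \<longleftrightarrow>
     (\<exists>X :: 'v set. finite X \<and> span X = UNIV) \<and>
     bilinear B \<and> (\<forall>v w. B v w = B w v) \<and> (\<forall>v. B v v \<ge> 0) \<and> dim (radical B) = 2 \<and>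
     \<Phi> \<noteq> {} \<and>
     (\<forall>\<alpha>\<in>\<Phi>. B \<alpha> \<alpha> = 2) \<and>
     span \<Phi> = UNIV \<and>
     (\<forall>\<alpha>\<in>\<Phi>. reflection B \<alpha> ` \<Phi> \<subseteq> \<Phi>) \<and>
     (\<forall>\<alpha>\<in>\<Phi>. \<forall>\<beta>\<in>\<Phi>. B \<alpha> \<beta> \<in> \<int>) \<and>
     full_lattice (group_closure \<Phi>)"

definition irreducible_roots :: "('v::real_vector \<Rightarrow> 'v \<Rightarrow> real) \<Rightarrow> 'v set \<Rightarrow> bool" where
  "irreducible_roots B \<Phi> \<longleftrightarrow>
     \<not> (\<exists>\<Phi>\<^sub>1 \<Phi>\<^sub>2. \<Phi>\<^sub>1 \<noteq> {} \<and> \<Phi>\<^sub>2 \<noteq> {} \<and> \<Phi> = \<Phi>\<^sub>1 \<union> \<Phi>\<^sub>2 \<and> (\<forall>\<alpha>\<in>\<Phi>\<^sub>1. \<forall>\<beta>\<in>\<Phi>\<^sub>2. B \<alpha> \<beta> = 0))"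

text \<open>
  The quotient of $V$ by a subspace $U$ is represented by a linear endomorphism \<open>p\<close> of $V$ with
  kernel $U$: the range of \<open>p\<close> is then a copy of $V/U$ with \<open>p\<close> as the canonical projection. Such a
  \<open>p\<close> exists for every $U$, and any two choices differ by an isomorphism of their ranges, so
  nothing below depends on which one is taken.
\<close>

definition quotient_map_of :: "'v::real_vector set \<Rightarrow> ('v \<Rightarrow> 'v) \<Rightarrow> bool" where
  "quotient_map_of U p \<longleftrightarrow> linear p \<and> {v. p v = 0} = U"

text \<open>
  Simple systems of finite and of affine root systems: a linearly independent family of roots such
  that every root is an integral combination with all coefficients nonnegative or all nonpositive.
\<close>

definition simple_system :: "'v::real_vector set \<Rightarrow> nat set \<Rightarrow> (nat \<Rightarrow> 'v) \<Rightarrow> bool" where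
  "simple_system \<Psi> I \<beta> \<longleftrightarrow>
     \<beta> ` I \<subseteq> \<Psi> \<and> inj_on \<beta> I \<and> independent (\<beta> ` I) \<and>
     (\<forall>\<psi>\<in>\<Psi>. \<exists>k :: nat \<Rightarrow> nat.
        \<psi> = (\<Sum>i\<in>I. real (k i) *\<^sub>R \<beta> i) \<or> \<psi> = - (\<Sum>i\<in>I. real (k i) *\<^sub>R \<beta> i))"

datatype tubular_type = D4 | E6 | E7 | E8

fun type_rank :: "tubular_type \<Rightarrow> nat" where
  "type_rank D4 = 4"
| "type_rank E6 = 6"
| "type_rank E7 = 7"
| "type_rank E8 = 8"

text \<open>
  Dynkin diagrams on the vertices $0, \dots, n-1$. For \<open>D4\<close> the branch vertex is 0; the others
  are a chain from 0 to $n-2$ with the vertex $n-1$ attached to the branch vertex 2.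
\<close>

fun dynkin_edges :: "tubular_type \<Rightarrow> (nat \<times> nat) set" where
  "dynkin_edges D4 = {(0,1), (0,2), (0,3)}"
| "dynkin_edges E6 = {(0,1), (1,2), (2,3), (3,4), (2,5)}"
| "dynkin_edges E7 = {(0,1), (1,2), (2,3), (3,4), (4,5), (2,6)}"
| "dynkin_edges E8 = {(0,1), (1,2), (2,3), (3,4), (4,5), (5,6), (2,7)}"

definition cartan_entry :: "tubular_type \<Rightarrow> nat \<Rightarrow> nat \<Rightarrow> real" where
  "cartan_entry X i j =
     (if i = j then 2
      else if (i, j) \<in> dynkin_edges X \<or> (j, i) \<in> dynkin_edges X then - 1
      else 0)"

text \<open>
  The image of \<open>\<Phi>\<close> modulo the radical is of type \<open>X\<close>. The form on the quotient by the radical is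
  evaluated on preimages.
\<close>

definition fin_type :: "('v::real_vector \<Rightarrow> 'v \<Rightarrow> real) \<Rightarrow> 'v set \<Rightarrow> tubular_type \<Rightarrow> bool" where
  "fin_type B \<Phi> X \<longleftrightarrow>
     (\<exists>q \<gamma>. quotient_map_of (radical B) q \<and>
        \<gamma> ` {..<type_rank X} \<subseteq> \<Phi> \<and>
        simple_system (q ` \<Phi>) {..<type_rank X} (q \<circ> \<gamma>) \<and>
        (\<forall>i<type_rank X. \<forall>j<type_rank X. B (\<gamma> i) (\<gamma> j) = cartan_entry X i j))"

definition tubular :: "('v::real_vector \<Rightarrow> 'v \<Rightarrow> real) \<Rightarrow> 'v set \<Rightarrow> bool" where
  "tubular B \<Phi> \<longleftrightarrow>
     elliptic_root_system B \<Phi> \<and> irreducible_roots B \<Phi> \<and> (\<exists>X. fin_type B \<Phi> X)"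


section \<open>Elliptic root bases and Coxeter transformations\<close>

text \<open>
  A root basis is given as the family \<open>\<alpha> 0, \<dots>, \<alpha> n\<close> with the distinguished index \<open>t\<close> and the
  additional root \<open>\<alpha>\<^sub>t\<close> starred, here \<open>\<alpha>'\<close>. With \<open>p\<close> the projection modulo \<open>U\<close>, the simple
  roots \<open>\<beta> i\<close> of the affine root system are the \<open>p (\<alpha> i)\<close>, and \<open>p ` radical B\<close> is the
  image of the radical in the quotient. The rank \<open>n\<close> of the finite root system is fixed by the
  dimension of $V$.
\<close>

definition elliptic_root_basis ::
  "('v::real_vector \<Rightarrow> 'v \<Rightarrow> real) \<Rightarrow> 'v set \<Rightarrow> nat \<Rightarrow> (nat \<Rightarrow> 'v) \<Rightarrow> nat \<Rightarrow> 'v \<Rightarrow> bool" where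
  "elliptic_root_basis B \<Phi> n \<alpha> t \<alpha>' \<longleftrightarrow>
     dim (UNIV :: 'v set) = n + 2 \<and>
     (\<exists>U a p (m :: nat \<Rightarrow> nat).
        subspace U \<and> dim U = 1 \<and> U \<subseteq> radical B \<and>
        group_closure \<Phi> \<inter> U \<noteq> {0} \<and> group_closure \<Phi> \<inter> U = group_closure {a} \<and>
        quotient_map_of U p \<and>
        \<alpha> ` {0..n} \<subseteq> \<Phi> \<and>
        simple_system (p ` \<Phi>) {0..n} (p \<circ> \<alpha>) \<and>
        (\<forall>i\<in>{1..n}. m i > 0) \<and>
        group_closure ((p \<circ> \<alpha>) ` {0..n}) \<inter> p ` radical B =
          group_closure {p (\<alpha> 0) + (\<Sum>i=1..n. real (m i) *\<^sub>R p (\<alpha> i))} \<and>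
        t \<in> {1..n} \<and> m t = Max (m ` {1..n}) \<and>
        \<alpha>' = \<alpha> t + a)"

text \<open>The isometries in question are taken in the group of all bijections of $V$.\<close>

abbreviation perm_group :: "('v \<Rightarrow> 'v) monoid" where
  "perm_group \<equiv> BijGroup UNIV"

definition reflections :: "('v::real_vector \<Rightarrow> 'v \<Rightarrow> real) \<Rightarrow> 'v set \<Rightarrow> ('v \<Rightarrow> 'v) set" where
  "reflections B \<Phi> = reflection B ` \<Phi>"

definition elliptic_weyl_group ::
  "('v::real_vector \<Rightarrow> 'v \<Rightarrow> real) \<Rightarrow> 'v set \<Rightarrow> ('v \<Rightarrow> 'v) set" where
  "elliptic_weyl_group B \<Phi> = generate perm_group (reflections B \<Phi>)"

definition list_prod :: "('g, 'b) monoid_scheme \<Rightarrow> 'g list \<Rightarrow> 'g" where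
  "list_prod G gs = foldr (mult G) gs (one G)"

definition coxeter_transformation ::
  "('v::real_vector \<Rightarrow> 'v \<Rightarrow> real) \<Rightarrow> nat \<Rightarrow> (nat \<Rightarrow> 'v) \<Rightarrow> nat \<Rightarrow> 'v \<Rightarrow> ('v \<Rightarrow> 'v) \<Rightarrow> bool" where
  "coxeter_transformation B n \<alpha> t \<alpha>' c \<longleftrightarrow>
     (\<exists>is. distinct is \<and> set is = {0..n} - {t} \<and>
        c = list_prod perm_group
              (map (\<lambda>i. reflection B (\<alpha> i)) is @ [reflection B (\<alpha> t), reflection B \<alpha>']))"

definition Red_gen ::
  "('v::real_vector \<Rightarrow> 'v \<Rightarrow> real) \<Rightarrow> 'v set \<Rightarrow> nat \<Rightarrow> ('v \<Rightarrow> 'v) \<Rightarrow> ('v \<Rightarrow> 'v) list set" where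
  "Red_gen B \<Phi> k c =
     {ts. length ts = k \<and> set ts \<subseteq> reflections B \<Phi> \<and> c = list_prod perm_group ts \<and>
          elliptic_weyl_group B \<Phi> = generate perm_group (set ts)}"


section \<open>The braid group and the Hurwitz action\<close>

text \<open>
  The braid group on \<open>k\<close> strands by Artin's presentation: words in the letters \<open>(i, True)\<close> and
  \<open>(i, False)\<close>, standing for $\sigma_{i+1}$ and its inverse where $i + 1 < k$, modulo the
  congruence generated by the braid relations.
\<close>

type_synonym braid_word = "(nat \<times> bool) list"

inductive braid_eq :: "nat \<Rightarrow> braid_word \<Rightarrow> braid_word \<Rightarrow> bool" for k where
  refl: "\<forall>l\<in>set u. Suc (fst l) < k \<Longrightarrow> braid_eq k u u"
| sym: "braid_eq k u v \<Longrightarrow> braid_eq k v u"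
| trans: "braid_eq k u v \<Longrightarrow> braid_eq k v w \<Longrightarrow> braid_eq k u w"
| append: "braid_eq k u u' \<Longrightarrow> braid_eq k v v' \<Longrightarrow> braid_eq k (u @ v) (u' @ v')"
| cancel: "Suc i < k \<Longrightarrow> braid_eq k [(i, b), (i, \<not> b)] []"
| commute: "i + 2 \<le> j \<Longrightarrow> Suc j < k \<Longrightarrow>
    braid_eq k [(i, True), (j, True)] [(j, True), (i, True)]"
| braid: "i + 2 < k \<Longrightarrow>
    braid_eq k [(i, True), (i + 1, True), (i, True)] [(i + 1, True), (i, True), (i + 1, True)]"

definition braid_class :: "nat \<Rightarrow> braid_word \<Rightarrow> braid_word set" where
  "braid_class k u = {v. braid_eq k u v}"

definition braid_group :: "nat \<Rightarrow> braid_word set monoid" where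
  "braid_group k =
     \<lparr>carrier = {braid_class k u | u. \<forall>l\<in>set u. Suc (fst l) < k},
      mult = (\<lambda>X Y. {w. \<exists>u\<in>X. \<exists>v\<in>Y. braid_eq k (u @ v) w}),
      one = braid_class k []\<rparr>"

text \<open>
  The second equation is the inverse of the first move. List positions count from 0.
\<close>

fun hurwitz_move :: "('g, 'b) monoid_scheme \<Rightarrow> nat \<times> bool \<Rightarrow> 'g list \<Rightarrow> 'g list" where
  "hurwitz_move G (i, True) gs =
     gs[i := gs ! Suc i,
        Suc i := inv\<^bsub>G\<^esub> (gs ! Suc i) \<otimes>\<^bsub>G\<^esub> (gs ! i) \<otimes>\<^bsub>G\<^esub> (gs ! Suc i)]"
| "hurwitz_move G (i, False) gs =
     gs[i := (gs ! i) \<otimes>\<^bsub>G\<^esub> (gs ! Suc i) \<otimes>\<^bsub>G\<^esub> inv\<^bsub>G\<^esub> (gs ! i),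
        Suc i := gs ! i]"

text \<open>
  A braid acts through any word representing it; the result does not depend on the word. The
  restriction to \<open>E\<close> is the convention of \<open>BijGroup E\<close>, in which the library's group actions live.
\<close>

definition hurwitz_action ::
  "('g, 'b) monoid_scheme \<Rightarrow> 'g list set \<Rightarrow> braid_word set \<Rightarrow> 'g list \<Rightarrow> 'g list" where
  "hurwitz_action G E X = (\<lambda>gs\<in>E. foldr (hurwitz_move G) (SOME u. u \<in> X) gs)"

end

theory Submission
  imports Defs
begin

text \<open>
  Modulo the line $U$ the Coxeter transformation becomes a product of $n$ distinct simple
  reflections of an affine Weyl group, so a generating factorisation of it into $n + 2$ reflections
  cannot ascend in the Bruhat order. Removing peaks of the associated path by Hurwitz moves inside
  dihedral subgroups therefore produces a repeated adjacent pair $(r, r)$, and then the factorisation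
  $(s_i)_{i \<noteq> t}$ followed by $(r, r)$. As a pair may be moved past, and conjugated by, the other
  entries, and the generating property forces the coefficient of $\alpha_t$ in $r$ to be $\pm 1$, one
  reaches $r = \alpha_t$. Lifting back to $V$ leaves the factorisations
  $(s_{\alpha_i + l_i a})_{i \<noteq> t}, s_{\alpha_t}, s_{\alpha_t + e a}$ with
  $e = \pm 1$, where the $l_i$ are determined by $e$.

  The sign $e = 1$ always occurs, and $e = -1$ occurs iff $2 \alpha_t$ lies in the
  span of the other $\alpha_i$ modulo the radical, i.e. iff the mark $m_t$ divides 2. This holds for
  $D_4^{(1,1)}$ and fails in the other cases. The two signs are separated by the antisymmetric part
  on the radical of a Seifert form attached to a factorisation, which is invariant under Hurwitz moves.
\<close>

section \<open>Braids and the Hurwitz action\<close>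

text \<open>Factorisations are written as lists of roots, with a change of sign as an additional
  move. Roots up to sign amount to reflections, but only roots can be projected modulo $U$, lifted
  back and tested with linear functionals. The descent needs the quotient: in $V$ all \<alpha>_i + k
  a with integral k are roots of the same height, so even a simple reflection has infinitely many
  inversions. Modulo $U$ inversion sets are finite and their sizes serve as lengths. What remains to
  be overcome there is that two distinct roots may have product 2 and then generate an infinite
  dihedral group. The type of \<Phi> enters through m_t alone, and neither bound on it rests on a
  classification of affine diagrams. In rank 4, twice a mark is the sum of the neighbouring marks,
  which gives m_t \<le> 2. In the other types \<Phi> contains a copy of a simple system of E6; once
  this is made positive, a root with coefficient 3 at its branch vertex forces m_t \<ge> 3.\<close>

definition valid_word :: "nat \<Rightarrow> braid_word \<Rightarrow> bool" where
  "valid_word k u \<longleftrightarrow> (\<forall>l\<in>set u. Suc (fst l) < k)"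

lemma valid_word_simps [simp]:
  "valid_word k []"
  "valid_word k (l # u) \<longleftrightarrow> Suc (fst l) < k \<and> valid_word k u"
  "valid_word k (u @ v) \<longleftrightarrow> valid_word k u \<and> valid_word k v"
  by (auto simp: valid_word_def)

lemma braid_eq_valid: "braid_eq k u v \<Longrightarrow> valid_word k u \<and> valid_word k v"
  by (induction rule: braid_eq.induct) (auto simp: valid_word_def)

lemma braid_eq_refl: "valid_word k u \<Longrightarrow> braid_eq k u u"
  by (simp add: braid_eq.refl valid_word_def)

lemma mem_braid_class: "v \<in> braid_class k u \<longleftrightarrow> braid_eq k u v"
  by (simp add: braid_class_def)

lemma braid_class_eq: "braid_eq k u v \<Longrightarrow> braid_class k u = braid_class k v"
  unfolding braid_class_def by (blast intro: braid_eq.sym braid_eq.trans)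

lemma carrier_braid_group: "carrier (braid_group k) = {braid_class k u | u. valid_word k u}"
  by (simp add: braid_group_def valid_word_def)

lemma one_braid_group: "\<one>\<^bsub>braid_group k\<^esub> = braid_class k []"
  by (simp add: braid_group_def)

lemma mult_braid_class:
  assumes "valid_word k u" "valid_word k v"
  shows "braid_class k u \<otimes>\<^bsub>braid_group k\<^esub> braid_class k v = braid_class k (u @ v)"
proof -
  have "braid_eq k (u' @ v') w \<longleftrightarrow> braid_eq k (u @ v) w"
    if "braid_eq k u u'" "braid_eq k v v'" for u' v' w
    using that by (meson braid_eq.append braid_eq.sym braid_eq.trans)
  then show ?thesis
    using assms by (auto simp: braid_group_def braid_class_def intro: braid_eq_refl)
qed

definition inverse_word :: "braid_word \<Rightarrow> braid_word" where
  "inverse_word u = rev (map (\<lambda>(i, b). (i, \<not> b)) u)"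

lemma valid_inverse_word [simp]: "valid_word k (inverse_word u) \<longleftrightarrow> valid_word k u"
  by (auto simp: valid_word_def inverse_word_def split_beta)

lemma inverse_word_cancel: "valid_word k u \<Longrightarrow> braid_eq k (inverse_word u @ u) []"
proof (induction u)
  case Nil
  show ?case by (simp add: inverse_word_def braid_eq_refl)
next
  case (Cons l u)
  obtain i b where l: "l = (i, b)" by (cases l)
  have "braid_eq k ([(i, \<not> b)] @ [(i, \<not> \<not> b)]) []"
    using Cons.prems l braid_eq.cancel [of i k "\<not> b"] by simp
  then have "braid_eq k (inverse_word u @ ([(i, \<not> b)] @ [(i, b)]) @ u) (inverse_word u @ [] @ u)"
    using Cons.prems by (intro braid_eq.append braid_eq_refl) auto
  with Cons l show ?case
    by (auto simp: inverse_word_def intro: braid_eq.trans)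
qed

lemma group_braid_group: "group (braid_group k)"
proof (rule groupI)
  fix x y z
  assume "x \<in> carrier (braid_group k)" "y \<in> carrier (braid_group k)" "z \<in> carrier (braid_group k)"
  then show "x \<otimes>\<^bsub>braid_group k\<^esub> y \<otimes>\<^bsub>braid_group k\<^esub> z =
      x \<otimes>\<^bsub>braid_group k\<^esub> (y \<otimes>\<^bsub>braid_group k\<^esub> z)"
    by (auto simp: carrier_braid_group mult_braid_class)
next
  fix x assume "x \<in> carrier (braid_group k)"
  then obtain u where u: "x = braid_class k u" "valid_word k u"
    by (auto simp: carrier_braid_group)
  show "\<exists>y\<in>carrier (braid_group k). y \<otimes>\<^bsub>braid_group k\<^esub> x = \<one>\<^bsub>braid_group k\<^esub>"
    using u inverse_word_cancel [of k u]
    by (intro bexI [of _ "braid_class k (inverse_word u)"])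
       (auto simp: one_braid_group mult_braid_class braid_class_eq carrier_braid_group)
qed (fastforce simp: carrier_braid_group mult_braid_class one_braid_group)+

section \<open>Hurwitz moves on tuples in an arbitrary group\<close>

context group
begin

lemma hurwitz_move_True:
  "length xs = i \<Longrightarrow>
    hurwitz_move G (i, True) (xs @ a # b # ys) = xs @ b # (inv b \<otimes> a \<otimes> b) # ys"
  by (auto simp: nth_append list_update_append)

lemma hurwitz_move_False:
  "length xs = i \<Longrightarrow>
    hurwitz_move G (i, False) (xs @ a # b # ys) = xs @ (a \<otimes> b \<otimes> inv a) # a # ys"
  by (auto simp: nth_append list_update_append)

definition tuples :: "nat \<Rightarrow> 'a list set" where
  "tuples k = {gs. length gs = k \<and> set gs \<subseteq> carrier G}"

lemma tuples_split:
  assumes "gs \<in> tuples k" "Suc i < k"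
  obtains xs a b ys where "gs = xs @ a # b # ys" "length xs = i"
    "set xs \<subseteq> carrier G" "a \<in> carrier G" "b \<in> carrier G" "set ys \<subseteq> carrier G"
proof -
  have *: "set gs \<subseteq> carrier G" "length gs = k"
    using assms by (auto simp: tuples_def)
  show ?thesis
  proof
    show "gs = take i gs @ gs ! i # gs ! Suc i # drop (Suc (Suc i)) gs"
      using assms * by (simp add: id_take_nth_drop Cons_nth_drop_Suc)
    show "gs ! i \<in> carrier G" "gs ! Suc i \<in> carrier G"
      using assms * nth_mem [of i gs] nth_mem [of "Suc i" gs] by auto
  qed (use assms * in \<open>auto dest: in_set_takeD in_set_dropD\<close>)
qed

lemma hurwitz_move_tuples:
  assumes "gs \<in> tuples k" "Suc (fst l) < k"
  shows "hurwitz_move G l gs \<in> tuples k"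
proof -
  obtain i b where l: "l = (i, b)" by (cases l)
  obtain xs g h ys where "gs = xs @ g # h # ys" "length xs = i"
    "set xs \<subseteq> carrier G" "g \<in> carrier G" "h \<in> carrier G" "set ys \<subseteq> carrier G"
    using tuples_split assms l by (metis fst_conv)
  then show ?thesis
    using assms l hurwitz_move_True [of xs i g h ys] hurwitz_move_False [of xs i g h ys]
    by (cases b) (auto simp: tuples_def)
qed

lemma foldr_hurwitz_tuples:
  "valid_word k u \<Longrightarrow> gs \<in> tuples k \<Longrightarrow> foldr (hurwitz_move G) u gs \<in> tuples k"
  by (induction u) (auto simp: hurwitz_move_tuples)

lemma hurwitz_move_cancel:
  assumes "gs \<in> tuples k" "Suc i < k"
  shows "hurwitz_move G (i, b) (hurwitz_move G (i, \<not> b) gs) = gs"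
proof -
  obtain xs g h ys where *: "gs = xs @ g # h # ys" "length xs = i"
    "g \<in> carrier G" "h \<in> carrier G"
    using tuples_split assms by metis
  have "g \<otimes> h \<otimes> inv g \<otimes> g = g \<otimes> h" "inv g \<otimes> (g \<otimes> h \<otimes> inv g) \<otimes> g = h"
    "h \<otimes> (inv h \<otimes> g \<otimes> h) \<otimes> inv h = g"
    using * by (simp_all add: m_assoc) (simp_all flip: m_assoc)
  with * show ?thesis
    using hurwitz_move_True [of xs i g h ys] hurwitz_move_False [of xs i g h ys]
      hurwitz_move_True [of xs i "g \<otimes> h \<otimes> inv g" g ys]
      hurwitz_move_False [of xs i h "inv h \<otimes> g \<otimes> h" ys]
    by (cases b) auto
qed

lemma hurwitz_move_commute:
  assumes "gs \<in> tuples k" "i + 2 \<le> j" "Suc j < k"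
  shows "hurwitz_move G (i, True) (hurwitz_move G (j, True) gs) =
    hurwitz_move G (j, True) (hurwitz_move G (i, True) gs)"
  using assms by (intro nth_equalityI) (auto simp: nth_list_update tuples_def)

lemma hurwitz_move_braid:
  assumes "gs \<in> tuples k" "i + 2 < k"
  shows "hurwitz_move G (i, True) (hurwitz_move G (Suc i, True) (hurwitz_move G (i, True) gs)) =
    hurwitz_move G (Suc i, True) (hurwitz_move G (i, True) (hurwitz_move G (Suc i, True) gs))"
proof -
  obtain xs a b ys where *: "gs = xs @ a # b # ys" "length xs = i"
    "a \<in> carrier G" "b \<in> carrier G" "set ys \<subseteq> carrier G"
    using tuples_split [OF assms(1), of i] assms by (metis Suc_lessD add_2_eq_Suc')
  moreover have "ys \<noteq> []"
    using * assms by (auto simp: tuples_def)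
  ultimately obtain c zs where **: "gs = xs @ a # b # c # zs" "c \<in> carrier G"
    by (cases ys) auto
  define b' where "b' = inv c \<otimes> b \<otimes> c"
  define a' where "a' = inv c \<otimes> a \<otimes> c"
  \<comment> \<open>Conjugation by \<open>c\<close> is a homomorphism; this makes the last entries
    of both sides agree.\<close>
  have "inv b' \<otimes> a' \<otimes> b' = inv c \<otimes> (inv b \<otimes> a \<otimes> b) \<otimes> c"
    using * ** by (simp add: a'_def b'_def m_assoc inv_mult_group) (simp flip: m_assoc)
  then show ?thesis
    using * ** hurwitz_move_True [of xs i a b "c # zs"]
      hurwitz_move_True [of "xs @ [b]" "Suc i" "inv b \<otimes> a \<otimes> b" c zs]
      hurwitz_move_True [of xs i b c "(inv c \<otimes> (inv b \<otimes> a \<otimes> b) \<otimes> c) # zs"]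
      hurwitz_move_True [of "xs @ [a]" "Suc i" b c zs]
      hurwitz_move_True [of xs i a c "b' # zs"]
      hurwitz_move_True [of "xs @ [c]" "Suc i" a' b' zs]
    by (simp add: a'_def b'_def del: hurwitz_move.simps)
qed

text \<open>Lets any representing word replace the one that \<open>SOME\<close> picks in
  \<open>hurwitz_action\<close>.\<close>

lemma foldr_hurwitz_cong:
  "braid_eq k u v \<Longrightarrow> gs \<in> tuples k \<Longrightarrow>
    foldr (hurwitz_move G) u gs = foldr (hurwitz_move G) v gs"
proof (induction arbitrary: gs rule: braid_eq.induct)
  case (append u u' v v')
  have "foldr (hurwitz_move G) v gs \<in> tuples k"
    using append foldr_hurwitz_tuples braid_eq_valid by blast
  then show ?case using append by simp
next
  case (cancel i b)
  then show ?case using hurwitz_move_cancel by simp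
next
  case (commute i j)
  then show ?case using hurwitz_move_commute by simp
next
  case (braid i)
  then show ?case using hurwitz_move_braid by simp
qed auto

section \<open>The braid group action on a set of tuples closed under the moves\<close>

context
  fixes E :: "'a list set" and k :: nat
  assumes E_tuples: "E \<subseteq> tuples k"
    and E_move: "\<And>gs i b. gs \<in> E \<Longrightarrow> Suc i < k \<Longrightarrow> hurwitz_move G (i, b) gs \<in> E"
begin

lemma foldr_hurwitz_closed:
  "valid_word k u \<Longrightarrow> gs \<in> E \<Longrightarrow> foldr (hurwitz_move G) u gs \<in> E"
  using E_move by (induction u) (auto split: prod.splits)

lemma hurwitz_action_class:
  assumes "valid_word k u"
  shows "hurwitz_action G E (braid_class k u) = (\<lambda>gs\<in>E. foldr (hurwitz_move G) u gs)"
proof -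
  have "braid_eq k u (SOME w. w \<in> braid_class k u)"
    using braid_eq_refl [OF assms] by (metis mem_braid_class someI_ex)
  then show ?thesis
    unfolding hurwitz_action_def
    using foldr_hurwitz_cong E_tuples by (intro restrict_ext) (metis subsetD)
qed

lemma foldr_hurwitz_inverse:
  assumes "valid_word k u" "gs \<in> E"
  shows "foldr (hurwitz_move G) (inverse_word u) (foldr (hurwitz_move G) u gs) = gs"
  using foldr_hurwitz_cong [OF inverse_word_cancel [OF assms(1)]] assms(2) E_tuples by auto

lemma inverse_word_inverse [simp]: "inverse_word (inverse_word u) = u"
  by (induction u) (auto simp: inverse_word_def)

lemma hurwitz_action_Bij:
  assumes "valid_word k u"
  shows "hurwitz_action G E (braid_class k u) \<in> Bij E"
proof -
  have "bij_betw (foldr (hurwitz_move G) u) E E"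
    using assms foldr_hurwitz_closed [of "inverse_word u"]
      foldr_hurwitz_inverse [of "inverse_word u"]
    by (intro bij_betwI [where g = "foldr (hurwitz_move G) (inverse_word u)"])
       (auto simp: foldr_hurwitz_closed foldr_hurwitz_inverse)
  then show ?thesis
    using assms by (auto simp: hurwitz_action_class Bij_def cong: bij_betw_cong)
qed

text \<open>\<open>foldr\<close> lets the last letter act first, so concatenation of words becomes
  composition of maps and the action is a left one.\<close>

lemma group_action_hurwitz: "group_action (braid_group k) E (hurwitz_action G E)"
proof -
  have "hurwitz_action G E (x \<otimes>\<^bsub>braid_group k\<^esub> y) =
      hurwitz_action G E x \<otimes>\<^bsub>BijGroup E\<^esub> hurwitz_action G E y"
    if xy: "x \<in> carrier (braid_group k)" "y \<in> carrier (braid_group k)" for x y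
  proof -
    obtain u v where *: "x = braid_class k u" "valid_word k u" "y = braid_class k v" "valid_word k v"
      using xy unfolding carrier_braid_group by blast
    then have "hurwitz_action G E x \<otimes>\<^bsub>BijGroup E\<^esub> hurwitz_action G E y =
      compose E (hurwitz_action G E x) (hurwitz_action G E y)"
      using hurwitz_action_Bij by (simp add: BijGroup_def)
    also have "\<dots> = hurwitz_action G E (x \<otimes>\<^bsub>braid_group k\<^esub> y)"
      using * by (auto simp: mult_braid_class hurwitz_action_class compose_def
          foldr_hurwitz_closed intro!: restrict_ext)
    finally show ?thesis by simp
  qed
  then have "hurwitz_action G E \<in> hom (braid_group k) (BijGroup E)"
    using hurwitz_action_Bij by (auto simp: hom_def carrier_braid_group BijGroup_def)
  then show ?thesis
    by (simp add: group_action_def group_hom_def group_hom_axioms_def group_BijGroup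
        group_braid_group)
qed

lemma mem_orbit_hurwitz:
  assumes "gs \<in> E"
  shows "hs \<in> orbit (braid_group k) (hurwitz_action G E) gs \<longleftrightarrow>
    (\<exists>u. valid_word k u \<and> foldr (hurwitz_move G) u gs = hs)"
proof -
  have "hurwitz_action G E (braid_class k u) gs = foldr (hurwitz_move G) u gs"
    if "valid_word k u" for u
    using assms that by (simp add: hurwitz_action_class)
  then show ?thesis
    unfolding orbit_def carrier_braid_group by force
qed

end

end

section \<open>Hurwitz moves on lists of roots\<close>

lemma group_closure_scaleR:
  fixes v :: "'v::real_vector"
  assumes v: "v \<in> group_closure X" and k: "k \<in> \<int>"
  shows "k *\<^sub>R v \<in> group_closure X"
proof -
  obtain z where z: "k = of_int z" using k by (elim Ints_cases)
  have nat: "real j *\<^sub>R v \<in> group_closure X" for j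
    using v by (induction j) (auto simp: scaleR_left.add group_closure_add)
  show ?thesis
    using nat [of "nat \<bar>z\<bar>"] z group_closure_minus_iff [of "\<bar>of_int z\<bar> *\<^sub>R v" X]
    by (cases "z \<ge> 0") auto
qed

section \<open>Reflections of a semidefinite form\<close>

locale semidefinite_form =
  fixes B :: "'v::real_vector \<Rightarrow> 'v \<Rightarrow> real"
  assumes bilinear_B: "bilinear B"
    and sym_B: "B v w = B w v"
    and semidefinite_B: "B v v \<ge> 0"
begin

sublocale perm: group "perm_group :: ('v \<Rightarrow> 'v) monoid"
  by (rule group_BijGroup)

abbreviation s :: "'v \<Rightarrow> 'v \<Rightarrow> 'v" where
  "s \<equiv> reflection B"

lemmas B_simps [simp] =
  bilinear_ladd [OF bilinear_B] bilinear_radd [OF bilinear_B]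
  bilinear_lsub [OF bilinear_B] bilinear_rsub [OF bilinear_B]
  bilinear_lmul [OF bilinear_B] bilinear_rmul [OF bilinear_B]
  bilinear_lneg [OF bilinear_B] bilinear_rneg [OF bilinear_B]
  bilinear_lzero [OF bilinear_B] bilinear_rzero [OF bilinear_B]

lemma B_sum_left: "B (sum f A) w = (\<Sum>i\<in>A. B (f i) w)"
  by (induction A rule: infinite_finite_induct) auto

lemma B_sum_right: "B w (sum f A) = (\<Sum>i\<in>A. B w (f i))"
  by (induction A rule: infinite_finite_induct) auto

lemma linear_s: "linear (s u)"
  by (rule linearI) (auto simp: reflection_def algebra_simps)

lemmas s_simps [simp] =
  linear_add [OF linear_s] linear_diff [OF linear_s] linear_scale [OF linear_s]
  linear_neg [OF linear_s] linear_0 [OF linear_s]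

lemma s_minus [simp]: "s (- u) = s u"
  by (auto simp: reflection_def)

lemma s_self: "B u u = 2 \<Longrightarrow> s u u = - u"
  by (simp add: reflection_def scaleR_2)

lemma s_s [simp]: "B u u = 2 \<Longrightarrow> s u (s u v) = v"
  by (simp add: reflection_def algebra_simps)

lemma B_s_s [simp]: "B u u = 2 \<Longrightarrow> B (s u v) (s u w) = B v w"
  by (simp add: reflection_def sym_B [of v u])

lemma s_conj: "B v v = 2 \<Longrightarrow> s (s v u) w = s v (s u (s v w))"
  by (simp add: reflection_def sym_B [of u v] algebra_simps flip: scaleR_add_left)

lemma null_imp_radical:
  assumes "B n n = 0"
  shows "B n w = 0"
proof -
  define q c where "q = B w w" and "c = B n w"
  \<comment> \<open>For \<open>q > 0\<close> the form on the line through \<open>n\<close> in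
    direction \<open>w\<close> is smallest at \<open>- c / q\<close>. The 1 in the denominator also
    covers \<open>q = 0\<close> and still gives a negative value unless
    \<open>c = 0\<close>.\<close>
  define t where "t = - c / (q + 1)"
  have q: "q \<ge> 0" by (simp add: q_def semidefinite_B)
  have "0 \<le> B (n + t *\<^sub>R w) (n + t *\<^sub>R w)" by (rule semidefinite_B)
  also have "\<dots> = 2 * t * c + t\<^sup>2 * q"
    using assms by (simp add: q_def c_def sym_B power2_eq_square algebra_simps)
  also have "\<dots> = - (c\<^sup>2 * (q + 2) / (q + 1)\<^sup>2)"
  proof -
    have "t * (q + 1) = - c" using q by (simp add: t_def)
    then have "(2 * t * c + t\<^sup>2 * q) * (q + 1)\<^sup>2 = - (c\<^sup>2 * (q + 2))" by algebra
    then show ?thesis using q by (simp add: field_simps)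
  qed
  finally have "c\<^sup>2 * (q + 2) / (q + 1)\<^sup>2 \<le> 0" by simp
  with q have "c = 0"
    by (simp add: divide_le_0_iff mult_le_0_iff)
  then show ?thesis by (simp add: c_def)
qed

lemma B_roots_bounds:
  assumes "B u u = 2" "B v v = 2"
  shows "B u v \<le> 2" "- 2 \<le> B u v"
  using semidefinite_B [of "u - v"] semidefinite_B [of "u + v"] assms
  by (simp_all add: sym_B [of v u])

text \<open>The difference has norm 2 - 4 + 2 = 0, and null vectors of a semidefinite form are
  radical.\<close>

lemma B_eq_2_radical:
  assumes "B u u = 2" "B v v = 2" "B u v = 2"
  shows "B (v - u) w = 0"
  by (rule null_imp_radical) (use assms in \<open>simp add: sym_B [of v u]\<close>)

lemma B_eq_neg_2_radical:
  assumes "B u u = 2" "B v v = 2" "B u v = - 2"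
  shows "B (v + u) w = 0"
  by (rule null_imp_radical) (use assms in \<open>simp add: sym_B [of v u]\<close>)

abbreviation rp :: "'v list \<Rightarrow> 'v \<Rightarrow> 'v" where
  "rp \<equiv> foldr s"

lemma linear_rp: "linear (rp xs)"
  by (induction xs) (auto simp: id_def linear_iff)

lemmas rp_simps [simp] =
  linear_add [OF linear_rp] linear_diff [OF linear_rp] linear_scale [OF linear_rp]
  linear_neg [OF linear_rp] linear_0 [OF linear_rp]

abbreviation norm2 :: "'v list \<Rightarrow> bool" where
  "norm2 xs \<equiv> \<forall>x\<in>set xs. B x x = 2"

lemma rp_rev [simp]: "norm2 xs \<Longrightarrow> rp (rev xs) (rp xs v) = v"
  by (induction xs arbitrary: v) auto

lemma rp_rev' [simp]: "norm2 xs \<Longrightarrow> rp xs (rp (rev xs) v) = v"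
  using rp_rev [of "rev xs"] by simp

lemma B_rp_rp [simp]: "norm2 xs \<Longrightarrow> B (rp xs v) (rp xs w) = B v w"
  by (induction xs) auto

lemma s_rp: "norm2 xs \<Longrightarrow> s (rp xs u) w = rp xs (s u (rp (rev xs) w))"
  by (induction xs arbitrary: w) (auto simp: s_conj)

lemma radical_s: "(\<And>w. B v w = 0) \<Longrightarrow> s u v = v"
  by (simp add: reflection_def sym_B)

lemma radical_rp: "(\<And>w. B v w = 0) \<Longrightarrow> rp xs v = v"
  by (induction xs) (auto simp: radical_s)

text \<open>\<open>right\<close> and \<open>left\<close> are the two mutually inverse Hurwitz moves
  read on roots: conjugating \<open>s u\<close> by \<open>s v\<close> gives the reflection in
  \<open>s v u\<close>. \<open>flip\<close> accounts for the two roots of a reflection.\<close>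

inductive hstep :: "'v list \<Rightarrow> 'v list \<Rightarrow> bool" where
  right: "B u u = 2 \<Longrightarrow> B v v = 2 \<Longrightarrow> hstep (xs @ u # v # ys) (xs @ v # s v u # ys)"
| left: "B u u = 2 \<Longrightarrow> B v v = 2 \<Longrightarrow> hstep (xs @ u # v # ys) (xs @ s u v # u # ys)"
| flip: "B u u = 2 \<Longrightarrow> hstep (xs @ u # ys) (xs @ - u # ys)"

definition hw :: "'v list \<Rightarrow> 'v list \<Rightarrow> bool" where
  "hw = hstep\<^sup>*\<^sup>*"

lemma hw_refl [simp]: "hw xs xs"
  by (simp add: hw_def)

lemma hw_trans [trans]: "hw xs ys \<Longrightarrow> hw ys zs \<Longrightarrow> hw xs zs"
  by (simp add: hw_def)

lemma hstep_hw: "hstep xs ys \<Longrightarrow> hw xs ys"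
  by (simp add: hw_def)

lemma hw_induct [consumes 1, case_names refl step]:
  assumes "hw xs ys" "\<And>xs. Q xs xs"
    and "\<And>xs ys zs. hw xs ys \<Longrightarrow> Q xs ys \<Longrightarrow> hstep ys zs \<Longrightarrow> Q xs zs"
  shows "Q xs ys"
  using assms(1) unfolding hw_def
  by (induction rule: rtranclp_induct) (use assms(2,3) in \<open>auto simp: hw_def\<close>)

lemma hstep_sym: "hstep xs ys \<Longrightarrow> hstep ys xs"
proof (induction rule: hstep.induct)
  case (right u v xs ys)
  then show ?case using hstep.left [of v "s v u" xs ys] by simp
next
  case (left u v xs ys)
  then show ?case using hstep.right [of "s u v" u xs ys] by simp
next
  case (flip u xs ys)
  then show ?case using hstep.flip [of "- u" xs ys] by simp
qed

lemma hw_sym: "hw xs ys \<Longrightarrow> hw ys xs"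
  by (induction rule: hw_induct) (auto intro: hw_trans hstep_hw [OF hstep_sym])

lemma hstep_append: "hstep xs ys \<Longrightarrow> hstep (zs @ xs @ ws) (zs @ ys @ ws)"
proof (induction rule: hstep.induct)
  case (right u v xs ys)
  then show ?case using hstep.right [of u v "zs @ xs" "ys @ ws"] by simp
next
  case (left u v xs ys)
  then show ?case using hstep.left [of u v "zs @ xs" "ys @ ws"] by simp
next
  case (flip u xs ys)
  then show ?case using hstep.flip [of u "zs @ xs" "ys @ ws"] by simp
qed

lemma hw_append: "hw xs ys \<Longrightarrow> hw (zs @ xs @ ws) (zs @ ys @ ws)"
  by (induction rule: hw_induct) (auto intro: hw_trans hstep_hw [OF hstep_append])

lemma hw_append_right: "hw xs ys \<Longrightarrow> hw (xs @ ws) (ys @ ws)"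
  using hw_append [of xs ys "[]" ws] by simp

lemma hw_append_left: "hw xs ys \<Longrightarrow> hw (zs @ xs) (zs @ ys)"
  using hw_append [of xs ys zs "[]"] by simp

lemma hw_Cons: "hw xs ys \<Longrightarrow> hw (z # xs) (z # ys)"
  using hw_append_left [of xs ys "[z]"] by simp

lemma hw_length: "hw xs ys \<Longrightarrow> length xs = length ys"
  by (induction rule: hw_induct) (auto elim!: hstep.cases)

lemma hstep_rp: "hstep xs ys \<Longrightarrow> rp xs v = rp ys v"
  by (induction rule: hstep.induct) (auto simp: s_conj)

lemma hw_rp: "hw xs ys \<Longrightarrow> rp xs v = rp ys v"
  by (induction rule: hw_induct) (auto dest: hstep_rp)

lemma hw_closed:
  assumes "hw xs ys" "set xs \<subseteq> D" "\<And>u v. u \<in> D \<Longrightarrow> v \<in> D \<Longrightarrow> s u v \<in> D"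
    and "\<And>u. u \<in> D \<Longrightarrow> - u \<in> D"
  shows "set ys \<subseteq> D"
  using assms(1,2)
  by (induction rule: hw_induct) (use assms(3,4) in \<open>auto elim!: hstep.cases\<close>)

lemma hw_norm2: "hw xs ys \<Longrightarrow> norm2 xs \<Longrightarrow> norm2 ys"
  using hw_closed [of xs ys "{v. B v v = 2}"] by (auto simp: subset_iff)

lemma hw_flips:
  assumes "norm2 xs" "length xs = length ys"
    "\<And>i. i < length xs \<Longrightarrow> ys ! i = xs ! i \<or> ys ! i = - xs ! i"
  shows "hw xs ys"
  using assms
proof (induction xs arbitrary: ys)
  case (Cons x xs)
  obtain y ys' where ys: "ys = y # ys'" using Cons.prems by (cases ys) auto
  have "hw xs ys'"
  proof (rule Cons.IH)
    fix i assume "i < length xs"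
    then show "ys' ! i = xs ! i \<or> ys' ! i = - xs ! i"
      using Cons.prems(3) [of "Suc i"] ys by simp
  qed (use Cons.prems ys in auto)
  moreover have "hw (x # ys') (y # ys')"
    using Cons.prems(3) [of 0] Cons.prems(1) hstep_hw [OF hstep.flip [of x "[]" ys']] ys by auto
  ultimately show ?case
    using ys hw_Cons hw_trans by blast
qed simp

lemma hw_Cons_Cons_right:
  "B u u = 2 \<Longrightarrow> B v v = 2 \<Longrightarrow> hw (u # v # ys) (v # s v u # ys)"
  using hstep.right [of u v "[]"] hstep_hw by fastforce

lemma hw_Cons_Cons_left:
  "B u u = 2 \<Longrightarrow> B v v = 2 \<Longrightarrow> hw (u # v # ys) (s u v # u # ys)"
  using hstep.left [of u v "[]"] hstep_hw by fastforce

section \<open>Transport and conjugation of repeated pairs\<close>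

lemma hw_move_front:
  assumes "norm2 us" "B g g = 2"
  shows "hw (us @ g # ws) (rp us g # us @ ws)"
  using assms
proof (induction us)
  case (Cons u us)
  then have "hw (u # us @ g # ws) (u # rp us g # us @ ws)"
    by (intro hw_Cons) auto
  also have "hw \<dots> (s u (rp us g) # u # us @ ws)"
    using Cons.prems by (intro hw_Cons_Cons_left) auto
  finally show ?case by simp
qed simp

text \<open>Passing both copies of \<open>r\<close> reflects \<open>g\<close> twice, so it comes out
  unchanged.\<close>

lemma hw_pair_swap:
  assumes "B g g = 2" "B r r = 2"
  shows "hw (g # r # r # ws) (r # r # g # ws)"
proof -
  have "hw (g # r # r # ws) (r # s r g # r # ws)"
    using assms by (rule hw_Cons_Cons_right)
  also have "hw \<dots> (r # r # s r (s r g) # ws)"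
    using assms by (intro hw_Cons hw_Cons_Cons_right) auto
  finally show ?thesis using assms by simp
qed

text \<open>Moving the pair left over \<open>g\<close> conjugates it; \<open>hw_pair_swap\<close>
  brings it back without a further change.\<close>

lemma hw_pair_conj:
  assumes "B g g = 2" "B r r = 2"
  shows "hw (g # r # r # ws) (g # s g r # s g r # ws)"
proof -
  have "hw (g # r # r # ws) (s g r # g # r # ws)"
    using assms by (rule hw_Cons_Cons_left)
  also have "hw \<dots> (s g r # s g r # g # ws)"
    using assms by (intro hw_Cons hw_Cons_Cons_left) auto
  also have "hw \<dots> (g # s g r # s g r # ws)"
    using assms by (intro hw_sym [OF hw_pair_swap]) auto
  finally show ?thesis .
qed

lemma hw_pair_through:
  assumes "norm2 us" "B r r = 2"
  shows "hw (us @ r # r # ws) (r # r # us @ ws)"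
  using assms
proof (induction us)
  case (Cons u us)
  then have "hw (u # us @ r # r # ws) (u # r # r # us @ ws)"
    by (intro hw_Cons) auto
  also have "hw \<dots> (r # r # u # us @ ws)"
    using Cons.prems by (intro hw_pair_swap) auto
  finally show ?case by simp
qed simp

lemma hw_pair_conj_at_end:
  assumes "norm2 us" "B r r = 2" "g \<in> set us"
  shows "hw (us @ [r, r]) (us @ [s g r, s g r])"
proof -
  obtain xs ys where us: "us = xs @ g # ys" using assms(3) split_list by metis
  have g: "B g g = 2" using assms by auto
  have "hw (us @ [r, r]) (xs @ g # r # r # ys)"
    unfolding us using assms us hw_append_left [OF hw_Cons [OF hw_pair_through [of ys r "[]"]], of xs g]
    by simp
  also have "hw \<dots> (xs @ g # s g r # s g r # ys)"
    using assms g by (intro hw_append_left hw_pair_conj)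
  also have "hw \<dots> (us @ [s g r, s g r])"
    unfolding us using assms us g
      hw_append_left [OF hw_Cons [OF hw_sym [OF hw_pair_through [of ys "s g r" "[]"]]], of xs g]
    by simp
  finally show ?thesis .
qed

lemma hw_pair_to_end:
  assumes "norm2 zs" "B r r = 2"
  shows "hw (ys @ r # r # zs) (ys @ zs @ [r, r])"
  using assms hw_append_left [OF hw_sym [OF hw_pair_through [of zs r "[]"]], of ys] by simp

text \<open>A linear isometry, even one with a kernel, carries reflections to reflections, so the
  same move can be made on the preimages. This brings factorisations back from the quotient by
  $U$.\<close>

lemma hstep_lift:
  assumes "linear P" "\<And>x y. B (P x) (P y) = B x y" "hstep (map P zs) ys"
  shows "\<exists>zs'. hstep zs zs' \<and> map P zs' = ys"
proof -
  have P: "P (s u v) = s (P u) (P v)" for u v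
    using assms(1,2) by (simp add: reflection_def linear_diff linear_scale)
  from assms(3) show ?thesis
  proof (cases rule: hstep.cases)
    case (right u v xs ws)
    then obtain xs' u' v' ws' where *: "zs = xs' @ u' # v' # ws'" "map P xs' = xs"
      "P u' = u" "P v' = v" "map P ws' = ws"
      by (auto simp: map_eq_append_conv map_eq_Cons_conv)
    then show ?thesis
      using right assms(2) P by (intro exI [of _ "xs' @ v' # s v' u' # ws'"]) (auto intro: hstep.right)
  next
    case (left u v xs ws)
    then obtain xs' u' v' ws' where *: "zs = xs' @ u' # v' # ws'" "map P xs' = xs"
      "P u' = u" "P v' = v" "map P ws' = ws"
      by (auto simp: map_eq_append_conv map_eq_Cons_conv)
    then show ?thesis
      using left assms(2) P by (intro exI [of _ "xs' @ s u' v' # u' # ws'"]) (auto intro: hstep.left)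
  next
    case (flip u xs ws)
    then obtain xs' u' ws' where *: "zs = xs' @ u' # ws'" "map P xs' = xs" "P u' = u" "map P ws' = ws"
      by (auto simp: map_eq_append_conv map_eq_Cons_conv)
    then show ?thesis
      using flip assms(1,2) by (intro exI [of _ "xs' @ - u' # ws'"]) (auto simp: linear_neg intro: hstep.flip)
  qed
qed

lemma hw_lift:
  assumes "linear P" "\<And>x y. B (P x) (P y) = B x y" "hw xs ys" "xs = map P zs"
  shows "\<exists>zs'. hw zs zs' \<and> map P zs' = ys"
  using assms(3,4)
proof (induction rule: hw_induct)
  case (step xs ys ws)
  then obtain zs' where "hw zs zs'" "map P zs' = ys" by auto
  moreover obtain zs'' where "hstep zs' zs''" "map P zs'' = ws"
    using hstep_lift [OF assms(1,2)] step.hyps calculation by blast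
  ultimately have "hw zs zs'' \<and> map P zs'' = ws" by (metis hstep_hw hw_trans)
  then show ?case ..
qed (auto intro: hw_refl)

lemma hw_span: "hw xs ys \<Longrightarrow> set ys \<subseteq> span (set xs)"
  by (induction rule: hw_induct)
    (auto elim!: hstep.cases simp: span_base reflection_def span_diff span_scale span_neg)

text \<open>Integrality of the form makes each move an integral change of the entries. The lattice
  spanned by the entries is thus preserved, which later turns generation into a condition on
  coordinates.\<close>

lemma hw_group_closure:
  assumes "hw xs ys" "\<And>u v. u \<in> D \<Longrightarrow> v \<in> D \<Longrightarrow> s u v \<in> D"
    and "\<And>u v. u \<in> D \<Longrightarrow> v \<in> D \<Longrightarrow> B u v \<in> \<int>" "\<And>u. u \<in> D \<Longrightarrow> - u \<in> D"
    and "set xs \<subseteq> D"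
  shows "set xs \<subseteq> group_closure (set ys)"
proof -
  \<comment> \<open>Read backwards, the claim is that moves starting from \<open>ys\<close> stay in
    the lattice spanned by \<open>ys\<close>.\<close>
  have "hw ys xs" "set ys \<subseteq> D"
    using assms hw_sym hw_closed by blast+
  then show ?thesis
  proof (induction rule: hw_induct)
    case (refl xs)
    then show ?case by (auto intro: group_closure.base)
  next
    case (step xs ys zs)
    then have ys: "set ys \<subseteq> group_closure (set xs)" by simp
    have D: "set ys \<subseteq> D" using step assms hw_closed by blast
    have *: "s u v \<in> group_closure (set xs)" if "u \<in> set ys" "v \<in> set ys" for u v
      unfolding reflection_def using that ys D assms(3)
      by (intro group_closure.diff group_closure_scaleR) (auto simp: subset_iff)
    show ?case
      using step.hyps(2) ys by (cases rule: hstep.cases) (use * in auto)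
  qed
qed

section \<open>Reflections inside the group of bijections, and braid words acting on them\<close>

lemma bij_s: "B u u = 2 \<Longrightarrow> bij (s u)"
  by (rule o_bij [of "s u"]) auto

lemma s_in_perm [simp]: "B u u = 2 \<Longrightarrow> s u \<in> carrier perm_group"
  by (simp add: BijGroup_def Bij_def bij_s)

lemma perm_mult: "f \<in> carrier perm_group \<Longrightarrow> g \<in> carrier perm_group \<Longrightarrow>
    f \<otimes>\<^bsub>perm_group\<^esub> g = f \<circ> g"
  by (auto simp: BijGroup_def compose_def)

lemma perm_one: "\<one>\<^bsub>perm_group\<^esub> = id"
  by (auto simp: BijGroup_def)

lemma perm_inv_s: "B u u = 2 \<Longrightarrow> inv\<^bsub>perm_group\<^esub> (s u) = s u"
  by (rule perm.inv_equality) (auto simp: perm_mult perm_one)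

lemma perm_conj:
  assumes "B u u = 2" "B v v = 2"
  shows "inv\<^bsub>perm_group\<^esub> (s v) \<otimes>\<^bsub>perm_group\<^esub> s u \<otimes>\<^bsub>perm_group\<^esub> s v = s (s v u)"
    and "s v \<otimes>\<^bsub>perm_group\<^esub> s u \<otimes>\<^bsub>perm_group\<^esub> inv\<^bsub>perm_group\<^esub> (s v) = s (s v u)"
proof -
  show "inv\<^bsub>perm_group\<^esub> (s v) \<otimes>\<^bsub>perm_group\<^esub> s u \<otimes>\<^bsub>perm_group\<^esub> s v = s (s v u)"
    and "s v \<otimes>\<^bsub>perm_group\<^esub> s u \<otimes>\<^bsub>perm_group\<^esub> inv\<^bsub>perm_group\<^esub> (s v) = s (s v u)"
    using assms perm.m_closed [of "s v" "s u"] by (auto simp: perm_inv_s perm_mult s_conj)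
qed

lemma generate_s_conj:
  assumes "B u u = 2" "B v v = 2" "s u \<in> generate perm_group X" "s v \<in> generate perm_group X"
  shows "s (s v u) \<in> generate perm_group X"
proof -
  have "s v \<otimes>\<^bsub>perm_group\<^esub> s u \<otimes>\<^bsub>perm_group\<^esub> s v \<in> generate perm_group X"
    using assms by (intro generate.eng)
  then show ?thesis using perm_conj(2) [OF assms(1,2)] perm_inv_s [OF assms(2)] by simp
qed

lemma list_prod_rp: "norm2 xs \<Longrightarrow> list_prod perm_group (map s xs) = rp xs"
proof -
  have "list_prod perm_group (map s xs) = rp xs \<and> rp xs \<in> carrier perm_group" if "norm2 xs"
    using that
  proof (induction xs)
    case Nil
    then show ?case using perm.one_closed by (simp add: list_prod_def perm_one id_def)
  next
    case (Cons x xs)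
    then have "s x \<otimes>\<^bsub>perm_group\<^esub> rp xs \<in> carrier perm_group" by (intro perm.m_closed) auto
    with Cons show ?case
      by (auto simp: list_prod_def perm_mult comp_def)
  qed
  then show "norm2 xs \<Longrightarrow> ?thesis" by blast
qed

lemma hurwitz_move_s:
  assumes "norm2 xs" "Suc i < length xs"
  shows "\<exists>ys. hw xs ys \<and> hurwitz_move perm_group (i, b) (map s xs) = map s ys"
proof -
  define us u v ws where "us = take i xs" "u = xs ! i" "v = xs ! Suc i" "ws = drop (Suc (Suc i)) xs"
  have *: "xs = us @ u # v # ws" "length us = i"
    using assms by (simp_all add: us_u_v_ws_def id_take_nth_drop Cons_nth_drop_Suc)
  have **: "B u u = 2" "B v v = 2" using assms(1) * by auto
  show ?thesis
  proof (cases b)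
    case True
    then show ?thesis
      using * ** perm.hurwitz_move_True [of "map s us" i "s u" "s v" "map s ws"] perm_conj
      by (intro exI [of _ "us @ v # s v u # ws"]) (auto intro: hstep_hw hstep.right)
  next
    case False
    then show ?thesis
      using * ** perm.hurwitz_move_False [of "map s us" i "s u" "s v" "map s ws"] perm_conj
      by (intro exI [of _ "us @ s u v # u # ws"]) (auto intro: hstep_hw hstep.left)
  qed
qed

abbreviation braid_act :: "braid_word \<Rightarrow> ('v \<Rightarrow> 'v) list \<Rightarrow> ('v \<Rightarrow> 'v) list" where
  "braid_act \<equiv> foldr (hurwitz_move perm_group)"

lemma foldr_hurwitz_s:
  assumes "norm2 xs" "valid_word (length xs) w"
  shows "\<exists>ys. hw xs ys \<and> braid_act w (map s xs) = map s ys"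
  using assms
proof (induction w)
  case (Cons l w)
  obtain i b where l: "l = (i, b)" by (cases l)
  obtain ys where ys: "hw xs ys" "braid_act w (map s xs) = map s ys"
    using Cons by auto
  obtain zs where "hw ys zs" "hurwitz_move perm_group (i, b) (map s ys) = map s zs"
    using hurwitz_move_s [of ys i b] hw_norm2 [OF ys(1)] hw_length [OF ys(1)] Cons.prems l by auto
  then show ?case using ys l hw_trans by auto
qed (auto intro: hw_refl)

text \<open>A flip does not change the reflection, so the empty word realises it.\<close>

lemma hw_foldr_hurwitz:
  assumes "hw xs ys"
  shows "\<exists>w. valid_word (length xs) w \<and> braid_act w (map s xs) = map s ys"
  using assms
proof (induction rule: hw_induct)
  case (refl xs)
  show ?case by (intro exI [of _ "[]"]) auto
next
  case (step xs ys zs)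
  obtain w where w: "valid_word (length xs) w"
    "braid_act w (map s xs) = map s ys"
    using step by auto
  have len: "length xs = length ys" using step hw_length by auto
  have "\<exists>w'. valid_word (length ys) w' \<and> braid_act w' (map s ys) = map s zs"
    using step.hyps(2)
  proof (cases rule: hstep.cases)
    case (right u v us ws)
    then show ?thesis
      using perm.hurwitz_move_True [of "map s us" "length us" "s u" "s v" "map s ws"] perm_conj
      by (intro exI [of _ "[(length us, True)]"]) auto
  next
    case (left u v us ws)
    then show ?thesis
      using perm.hurwitz_move_False [of "map s us" "length us" "s u" "s v" "map s ws"] perm_conj
      by (intro exI [of _ "[(length us, False)]"]) auto
  next
    case (flip u us ws)
    then show ?thesis by (intro exI [of _ "[]"]) auto
  qed
  then obtain w' where "valid_word (length ys) w'"
    "braid_act w' (map s ys) = map s zs" by blast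
  with w len show ?case by (intro exI [of _ "w' @ w"]) auto
qed

lemma hw_generate:
  assumes "hw xs ys" "norm2 xs"
  shows "generate perm_group (s ` set ys) = generate perm_group (s ` set xs)"
proof -
  \<comment> \<open>One inclusion suffices because steps are reversible.\<close>
  have step: "generate perm_group (s ` set ys) \<subseteq> generate perm_group (s ` set xs)"
    if "hstep xs ys" "norm2 xs" for xs ys
  proof (rule perm.generate_subgroup_incl)
    show "subgroup (generate perm_group (s ` set xs)) perm_group"
      using that(2) by (intro perm.generate_is_subgroup) auto
    have mem: "s u \<in> generate perm_group (s ` set xs)" if "u \<in> set xs" for u
      using that by (intro generate.incl) auto
    have conj: "s (s v u) \<in> generate perm_group (s ` set xs)" if "u \<in> set xs" "v \<in> set xs" for u v
      using that \<open>norm2 xs\<close> mem by (intro generate_s_conj) auto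
    show "s ` set ys \<subseteq> generate perm_group (s ` set xs)"
      using that(1) by (cases rule: hstep.cases) (use mem conj in auto)
  qed
  show ?thesis
    using assms
  proof (induction rule: hw_induct)
    case (step xs ys zs)
    have "norm2 ys" "norm2 zs"
      using hw_norm2 step hstep_hw by blast+
    then have "generate perm_group (s ` set zs) = generate perm_group (s ` set ys)"
      using \<open>hstep ys zs\<close> hstep_sym \<open>\<And>ys xs. hstep xs ys \<Longrightarrow> norm2 xs \<Longrightarrow> _ ys xs\<close>
      by (intro equalityI) blast+
    with step show ?case by simp
  qed simp
qed

text \<open>Evaluation at \<open>u\<close> shows that 2u is \<open>B v u\<close> times
  \<open>v\<close>, and pairing with \<open>u\<close> gives 4 as the square of \<open>B v u\<close>.
  This is what identifies reflections with roots up to sign.\<close>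

lemma s_eq_imp:
  assumes "s u = s v" "B u u = 2" "B v v = 2"
  shows "v = u \<or> v = - u"
proof -
  have *: "u + u = B v u *\<^sub>R v"
    using fun_cong [OF assms(1), of u] assms(2)
    by (simp add: s_self reflection_def [of B v]) (metis add_diff_cancel_left' diff_minus_eq_add diff_eq_eq)
  then have "B (u + u) u = B v u * B v u"
    by simp
  then have "(B v u)\<^sup>2 = 4" using assms(2) by (simp add: power2_eq_square)
  then have "(B v u - 2) * (B v u + 2) = 0"
    by (simp add: power2_eq_square algebra_simps)
  then consider "B v u = 2" | "B v u = -2" by auto
  then show ?thesis
  proof cases
    case 1
    then have "2 *\<^sub>R u = 2 *\<^sub>R v" using * by (simp add: scaleR_2)
    then show ?thesis by simp
  next
    case 2
    then have "2 *\<^sub>R u = 2 *\<^sub>R (- v)" using * by (simp add: scaleR_2)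
    then show ?thesis by (metis minus_minus real_vector.scale_left_imp_eq zero_neq_numeral)
  qed
qed

lemma map_s_eq_imp_hw:
  assumes "map s xs = map s ys" "norm2 xs" "norm2 ys"
  shows "hw xs ys"
proof (rule hw_flips)
  show len: "length xs = length ys" using assms(1) map_eq_imp_length_eq by blast
  fix i assume i: "i < length xs"
  then have "s (xs ! i) = s (ys ! i)"
    using assms(1) len by (metis nth_map)
  then show "ys ! i = xs ! i \<or> ys ! i = - xs ! i"
    using assms i len by (intro s_eq_imp) auto
qed (use assms in auto)

text \<open>
  The invariant separating the orbits. Writing \<open>1 - rp xs\<close> as the contraction with the form of a
  tensor in $V \otimes V$, there is a choice of this tensor that depends only on the class of
  \<open>xs\<close> under Hurwitz moves; \<open>tensor\<close> evaluates it on a pair of functionals.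
\<close>

fun tensor :: "('v \<Rightarrow> real) \<Rightarrow> ('v \<Rightarrow> real) \<Rightarrow> 'v list \<Rightarrow> real" where
  "tensor f g [] = 0"
| "tensor f g (x # xs) = f x * g (rp (rev xs) x) + tensor f g xs"

lemma tensor_append: "tensor f g (xs @ ys) = tensor f (\<lambda>v. g (rp (rev ys) v)) xs + tensor f g ys"
  by (induction xs) auto

text \<open>Entries before the pair see what follows only through its product, which the move
  preserves, so lists of length two remain. For these both sides evaluate u (x) u + v (x) v - B(u,v)
  u (x) v.\<close>

lemma tensor_right:
  assumes "linear f" "linear g" and uv: "B u u = 2" "B v v = 2"
  shows "tensor f g (us @ u # v # ws) = tensor f g (us @ v # s v u # ws)"
proof -
  define g' where "g' = (\<lambda>w. g (rp (rev ws) w))"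
  have g': "linear g'"
    using linear_compose [OF linear_rp assms(2)] by (simp add: g'_def comp_def)
  have "rp (rev (u # v # ws)) w = rp (rev (v # s v u # ws)) w" for w
    using uv by (simp add: s_conj)
  moreover have "tensor f g' [u, v] = tensor f g' [v, s v u]"
    using uv assms(1) g'
    by (simp add: s_conj s_self)
       (simp add: reflection_def linear_diff linear_scale linear_neg linear_add algebra_simps sym_B)
  ultimately show ?thesis
    using tensor_append [of f g us] tensor_append [of f g "[u,v]" ws]
      tensor_append [of f g "[v, s v u]" ws] by (simp add: g'_def)
qed

lemma hstep_tensor:
  assumes "linear f" "linear g" "hstep xs ys"
  shows "tensor f g xs = tensor f g ys"
  using assms(3)
proof (cases rule: hstep.cases)
  case (right u v us ws)
  show ?thesis unfolding right(1,2) by (rule tensor_right [OF assms(1,2) right(3,4)])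
next
  case (left u v us ws)
  \<comment> \<open>A left move is a right move read backwards.\<close>
  have "B (s u v) (s u v) = 2" using left by simp
  from tensor_right [OF assms(1,2) this left(3)] show ?thesis using left by (simp only: s_s)
next
  case (flip u us ws)
  have "tensor f g' (u # ws) = tensor f g' (- u # ws)" if "linear g'" for g'
    using that assms(1) by (simp add: linear_neg)
  then show ?thesis
    using flip assms by (simp add: tensor_append)
qed

lemma hw_tensor:
  "hw xs ys \<Longrightarrow> linear f \<Longrightarrow> linear g \<Longrightarrow> tensor f g xs = tensor f g ys"
  by (induction rule: hw_induct) (auto dest: hstep_tensor)

end

section \<open>Roots with a height function\<close>

text \<open>What the length arguments use of the affine root system, with \<open>R\<close> as its
  roots, \<open>h\<close> as the height and \<Delta> as the simple roots. Finiteness of bounded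
  ranges of heights is what keeps inversion sets finite when \<open>R\<close> is infinite.\<close>

locale height_roots = semidefinite_form B
  for B :: "'v::real_vector \<Rightarrow> 'v \<Rightarrow> real" +
  fixes R :: "'v set" and h :: "'v \<Rightarrow> real" and \<Delta> :: "'v set"
  assumes norm_R: "p \<in> R \<Longrightarrow> B p p = 2"
    and s_R: "p \<in> R \<Longrightarrow> q \<in> R \<Longrightarrow> s p q \<in> R"
    and B_Ints: "p \<in> R \<Longrightarrow> q \<in> R \<Longrightarrow> B p q \<in> \<int>"
    and linear_h: "linear h"
    and h_nonzero: "p \<in> R \<Longrightarrow> h p \<noteq> 0"
    and finite_height: "finite {p \<in> R. 0 < h p \<and> h p \<le> C}"
    and \<Delta>_roots: "\<Delta> \<subseteq> R"
    and simple_reflection: "\<alpha> \<in> \<Delta> \<Longrightarrow> p \<in> R \<Longrightarrow> h p > 0 \<Longrightarrow> h (s \<alpha> p) < 0 \<Longrightarrow> p = \<alpha>"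
begin

lemmas h_simps [simp] =
  linear_add [OF linear_h] linear_diff [OF linear_h] linear_scale [OF linear_h]
  linear_neg [OF linear_h] linear_0 [OF linear_h]

lemma minus_R: "p \<in> R \<Longrightarrow> - p \<in> R"
  using s_R [of p p] s_self [of p] norm_R by simp

lemma norm2_R: "set xs \<subseteq> R \<Longrightarrow> norm2 xs"
  using norm_R by blast

lemma rp_R: "set xs \<subseteq> R \<Longrightarrow> p \<in> R \<Longrightarrow> rp xs p \<in> R"
  by (induction xs) (auto simp: s_R)

text \<open>In a Coxeter group the number of inversions of an element is its length; counting them
  avoids reduced words.\<close>

definition inversions :: "('v \<Rightarrow> 'v) \<Rightarrow> 'v set" where
  "inversions g = {p \<in> R. h p > 0 \<and> h (g p) < 0}"

abbreviation len :: "('v \<Rightarrow> 'v) \<Rightarrow> nat" where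
  "len g \<equiv> card (inversions g)"

definition good :: "('v \<Rightarrow> 'v) \<Rightarrow> bool" where
  "good g \<longleftrightarrow> linear g \<and> g ` R \<subseteq> R \<and> finite (inversions g)"

lemma good_id: "good id"
proof -
  have "inversions id = {}" by (auto simp: inversions_def)
  then show ?thesis by (simp add: good_def linear_id)
qed

lemma finite_inversions_s:
  assumes "p \<in> R"
  shows "finite (inversions (s p))"
proof (rule finite_subset [OF _ finite_height])
  show "inversions (s p) \<subseteq> {q \<in> R. 0 < h q \<and> h q \<le> 2 * \<bar>h p\<bar>}"
  proof safe
    fix q assume "q \<in> inversions (s p)"
    then have q: "q \<in> R" "h q > 0" "h q < B p q * h p"
      by (auto simp: inversions_def reflection_def)
    have "\<bar>B p q\<bar> \<le> 2"
      using B_roots_bounds [of p q] q assms norm_R by (simp add: abs_le_iff)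
    then have "\<bar>B p q\<bar> * \<bar>h p\<bar> \<le> 2 * \<bar>h p\<bar>" by (rule mult_right_mono) simp
    then have "B p q * h p \<le> 2 * \<bar>h p\<bar>"
      using abs_mult [of "B p q" "h p"] by linarith
    with q show "h q \<le> 2 * \<bar>h p\<bar>" "q \<in> R" "0 < h q" by auto
  qed
qed

text \<open>A root inverted by the composite is either inverted by \<open>s p\<close> or carried by
  \<open>s p\<close> to an inversion of \<open>g\<close>.\<close>

lemma good_s:
  assumes "good g" "p \<in> R"
  shows "good (g \<circ> s p)"
proof -
  have "inversions (g \<circ> s p) \<subseteq> inversions (s p) \<union> s p ` inversions g"
  proof
    fix q assume q: "q \<in> inversions (g \<circ> s p)"
    then have "s p q \<in> R" "q = s p (s p q)"
      using assms s_R norm_R by (auto simp: inversions_def)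
    then show "q \<in> inversions (s p) \<union> s p ` inversions g"
      using q h_nonzero [of "s p q"] by (cases "h (s p q) < 0") (auto simp: inversions_def)
  qed
  moreover have "finite (inversions (s p) \<union> s p ` inversions g)"
    using assms finite_inversions_s by (auto simp: good_def)
  ultimately have "finite (inversions (g \<circ> s p))" by (rule finite_subset)
  then show ?thesis
    using assms s_R linear_compose [OF linear_s] by (auto simp: good_def image_subset_iff)
qed

lemma good_rp: "set xs \<subseteq> R \<Longrightarrow> good (rp xs)"
proof (induction xs rule: rev_induct)
  case (snoc x xs)
  have "rp (xs @ [x]) = rp xs \<circ> s x" by (simp add: fun_eq_iff)
  moreover have "good (rp xs \<circ> s x)" using snoc by (intro good_s) auto
  ultimately show ?case by (simp only:)
qed (simp add: good_id)

lemma good_image: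
  assumes "good g" "p \<in> R"
  shows "g p \<in> R" "h (g p) \<noteq> 0"
  using assms h_nonzero by (auto simp: good_def image_subset_iff)

lemma len_decreases:
  assumes g: "good g" and p: "p \<in> R" "h p > 0" "h (g p) < 0"
  shows "len (g \<circ> s p) < len g"
proof -
  have lin: "linear g" and fin: "finite (inversions g)" using g by (auto simp: good_def)
  \<comment> \<open>This map injects the inversions of \<open>g \<circ> s p\<close> into those of
    \<open>g\<close> other than \<open>p\<close>. Where \<open>s p q\<close> is negative,
    \<open>B p q\<close> is positive and \<open>g q\<close> is a sum of two vectors of negative
    height, so \<open>q\<close> itself is an inversion of \<open>g\<close>.\<close>
  define \<phi> where "\<phi> = (\<lambda>q. if h (s p q) > 0 then s p q else q)"
  have norm: "B p p = 2" using p norm_R by simp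
  have img: "\<phi> q \<in> inversions g - {p}" if "q \<in> inversions (g \<circ> s p)" for q
  proof -
    have q: "q \<in> R" "h q > 0" "h (g (s p q)) < 0"
      using that by (auto simp: inversions_def)
    have sq: "s p q \<in> R" using q p s_R by simp
    show ?thesis
    proof (cases "h (s p q) > 0")
      case True
      have "s p q \<noteq> p"
      proof
        assume "s p q = p"
        then have "q = - p" using s_s [OF norm, of q] s_self [OF norm] by simp
        then show False using q p by simp
      qed
      then show ?thesis using True q sq by (simp add: \<phi>_def inversions_def)
    next
      case False
      then have "h (s p q) < 0" using h_nonzero [OF sq] by linarith
      then have "B p q * h p > 0" using q by (simp add: reflection_def)
      then have b: "B p q > 0" using p by (simp add: zero_less_mult_iff)
      have "g q = g (s p q) + B p q *\<^sub>R g p"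
        using lin by (simp add: reflection_def linear_diff linear_scale)
      moreover have "B p q * h (g p) < 0" using b p by (simp add: mult_less_0_iff)
      ultimately have "h (g q) < 0" using q by simp
      moreover have "q \<noteq> p"
        using q p lin by (auto simp: s_self [OF norm] linear_neg)
      ultimately show ?thesis using False q by (simp add: \<phi>_def inversions_def)
    qed
  qed
  have "inj_on \<phi> (inversions (g \<circ> s p))"
  proof (rule inj_onI)
    fix q \<zeta> assume *: "q \<in> inversions (g \<circ> s p)" "\<zeta> \<in> inversions (g \<circ> s p)" "\<phi> q = \<phi> \<zeta>"
    have "h q > 0" "h \<zeta> > 0" "q = s p (s p q)" "\<zeta> = s p (s p \<zeta>)"
      using * norm by (auto simp: inversions_def)
    then show "q = \<zeta>"
      using *(3) by (auto simp: \<phi>_def split: if_splits)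
  qed
  then have "len (g \<circ> s p) \<le> card (inversions g - {p})"
    using img fin by (intro card_inj_on_le [of \<phi>]) auto
  also have "\<dots> < len g"
    using fin p by (intro card_Diff1_less) (auto simp: inversions_def)
  finally show ?thesis .
qed

lemma len_decreases_twice:
  assumes g: "good g" and p: "p \<in> R" "h p > 0" "h (g p) < 0"
    and q: "q \<in> R" "h q > 0" "h (g (s p q)) < 0"
  shows "len (g \<circ> s p \<circ> s q) < len g"
proof -
  have "len (g \<circ> s p \<circ> s q) < len (g \<circ> s p)"
    using good_s [OF g] p q by (intro len_decreases) auto
  with len_decreases [OF g p] show ?thesis by simp
qed

text \<open>Reflecting a term of the string in its successor yields the negative of the term after
  that, so two consecutive roots propagate.\<close>

lemma null_string:
  assumes "p \<in> R" "q \<in> R" "B p q = 2"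
  shows "p + real i *\<^sub>R (q - p) \<in> R"
proof (induction i rule: less_induct)
  case (less i)
  have rad: "B (q - p) w = 0" "B w (q - p) = 0" for w
    using B_eq_2_radical [of p q w] assms norm_R sym_B [of w] by metis+
  consider "i = 0" | "i = 1" | j where "i = Suc (Suc j)"
    by (metis One_nat_def not0_implies_Suc)
  then show ?case
  proof cases
    case 3
    have "- s (p + real (Suc j) *\<^sub>R (q - p)) (p + real j *\<^sub>R (q - p)) \<in> R"
      using less [of j] less [of "Suc j"] 3 by (intro minus_R s_R) (simp_all del: of_nat_Suc)
    also have "- s (p + real (Suc j) *\<^sub>R (q - p)) (p + real j *\<^sub>R (q - p)) =
        2 *\<^sub>R (p + real (Suc j) *\<^sub>R (q - p)) - (p + real j *\<^sub>R (q - p))"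
      unfolding reflection_def bilinear_ladd [OF bilinear_B] bilinear_radd [OF bilinear_B]
        bilinear_lmul [OF bilinear_B] bilinear_rmul [OF bilinear_B] rad
      using assms norm_R by simp
    also have "\<dots> = p + real i *\<^sub>R (q - p)"
      using 3 unfolding scaleR_2 by (simp add: algebra_simps scaleR_2)
    finally show ?thesis .
  qed (use assms in auto)
qed

text \<open>
  Two roots differing by a null vector \<open>d\<close> generate an infinite dihedral group, in which the
  translation \<open>s (p + d) \<circ> s p\<close> is the product of any two consecutive reflections of the string
  \<open>p + i d\<close>. The pair at the end of the inverted part of the string decreases the length twice.
\<close>

lemma len_decreases_null:
  assumes g: "good g" and p: "p \<in> R" "h p > 0" "h (g p) < 0"
    and q: "q \<in> R" "h q > 0" "h (g q) < 0"
    and null: "B p q = 2" and gd: "g (q - p) = q - p" and pos: "h (q - p) > 0"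
  shows "len (g \<circ> s q \<circ> s p) < len g"
proof -
  define d where "d = q - p"
  define c where "c = (\<lambda>i::nat. p + real i *\<^sub>R d)"
  have lin: "linear g" using g by (simp add: good_def)
  have norm: "B p p = 2" "B q q = 2" using p q norm_R by auto
  have rad: "B d w = 0" "B w d = 0" for w
    using B_eq_2_radical [OF norm null, of w] sym_B [of w d] by (auto simp: d_def)
  have hd: "h d > 0" using pos by (simp add: d_def)
  have g_c: "g (c i) = g p + real i *\<^sub>R d" for i
    using lin gd by (simp add: c_def d_def linear_add linear_scale)
  have step: "s (c (Suc j)) (c j) = - c (Suc (Suc j))" for j
  proof -
    have "x + j *\<^sub>R d - 2 *\<^sub>R (x + (1 + j) *\<^sub>R d) = - (x + (2 + j) *\<^sub>R d)" for x and j :: real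
      unfolding scaleR_2 by (simp add: algebra_simps scaleR_2)
    then show ?thesis using norm rad by (simp add: c_def reflection_def)
  qed
  have translation: "s (p + (x + 1) *\<^sub>R d) (s (p + x *\<^sub>R d) v) = v + B p v *\<^sub>R d" for x v
  proof -
    have "v - b *\<^sub>R (p + x *\<^sub>R d) - (b - b * 2) *\<^sub>R (p + (x + 1) *\<^sub>R d) = v + b *\<^sub>R d" for b
      by (simp add: algebra_simps)
    then show ?thesis using norm rad by (simp add: reflection_def)
  qed
  have c_roots: "c i \<in> R" for i
    using null_string [OF p(1) q(1) null] by (simp add: c_def d_def)
  have c_pos: "h (c i) > 0" for i
    using p hd by (simp add: c_def add_pos_nonneg)
  \<comment> \<open>\<open>g\<close> fixes the null vector \<open>d\<close>, so the height of
    \<open>g (c i)\<close> grows linearly in \<open>i\<close>.\<close>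
  obtain m where m: "h (g (c m)) > 0"
  proof -
    obtain m where "real m * h d > - h (g p)"
      using reals_Archimedean3 [OF hd] by blast
    then show ?thesis using that [of m] by (simp add: g_c)
  qed
  \<comment> \<open>This index is at least 2, since \<open>c 0\<close> and \<open>c 1\<close> are
    inverted. The two terms below it are inverted as well, and reflecting the lower one in the upper
    gives \<open>- c k\<close>, so both reflections shorten \<open>g\<close>.\<close>
  define k where "k = (LEAST i. h (g (c i)) > 0)"
  have k: "h (g (c k)) > 0" unfolding k_def using m by (rule LeastI)
  have below: "h (g (c i)) < 0" if "i < k" for i
    using not_less_Least [OF that [unfolded k_def]] good_image(2) [OF g c_roots [of i]] by linarith
  have "c 0 = p" "c 1 = q" by (simp_all add: c_def d_def)
  with k p q have "k \<noteq> 0" "k \<noteq> 1" by (metis less_asym)+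
  then obtain i where i: "k = Suc (Suc i)"
    by (metis One_nat_def not0_implies_Suc)
  have "len (g \<circ> s (c (Suc i)) \<circ> s (c i)) < len g"
  proof (rule len_decreases_twice [OF g])
    show "h (g (s (c (Suc i)) (c i))) < 0"
      using step [of i] k i lin by (simp add: linear_neg)
  qed (use c_roots c_pos below i in auto)
  moreover have "s (c (Suc i)) (s (c i) v) = s q (s p v)" for v
    using translation [of "real i" v] translation [of 0 v]
    by (simp add: c_def add.commute) (simp add: d_def)
  ultimately show ?thesis by (simp add: comp_def)
qed

text \<open>If \<open>B p q\<close> is at most 0, then \<open>s p q\<close> is also sent to negative
  height and the order \<open>p\<close>, \<open>q\<close> works. If it is 1, then
  \<open>s p q\<close> and \<open>s q p\<close> are opposite, so one of the two orders works. If it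
  is 2, the roots differ by a null vector and \<open>len_decreases_null\<close> applies.\<close>

lemma peak_reduction:
  assumes xs: "set xs \<subseteq> R" and p: "p \<in> R" "h p > 0" "h (rp xs p) < 0"
    and q: "q \<in> R" "h q > 0" "h (rp xs q) < 0" and "p \<noteq> q"
  shows "len (rp (xs @ [p, q])) < len (rp xs) \<or>
    len (rp (xs @ [q, p])) < len (rp xs)"
proof -
  have g: "good (rp xs)" using good_rp [OF xs] .
  have norm: "B p p = 2" "B q q = 2" using p q norm_R by auto
  have comp: "rp (xs @ [u, v]) = rp xs \<circ> s u \<circ> s v" for u v by (simp add: fun_eq_iff)
  obtain b where b: "B p q = of_int b"
    using B_Ints p q by (meson Ints_cases)
  have "b \<le> 2"
    using B_roots_bounds [OF norm] b by simp
  have sgn: "h (rp xs (s p q)) \<noteq> 0"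
    using good_image(2) [OF g] s_R p q by blast
  consider "b \<le> 0" | "b = 1" | "b = 2" using \<open>b \<le> 2\<close> by linarith
  then show ?thesis
  proof cases
    case 1
    have "real_of_int b * h (rp xs p) \<ge> 0"
      using 1 p by (simp add: mult_nonpos_nonpos)
    then have "h (rp xs (s p q)) < 0"
      using q b by (simp add: reflection_def)
    then show ?thesis
      unfolding comp using len_decreases_twice [OF g p, of q] q by simp
  next
    case 2
    then have "rp xs (s p q) = - rp xs (s q p)"
      using b by (simp add: reflection_def sym_B [of q p])
    then have "h (rp xs (s p q)) < 0 \<or> h (rp xs (s q p)) < 0"
      using sgn by auto
    then show ?thesis
      unfolding comp
      using len_decreases_twice [OF g p, of q]
        len_decreases_twice [OF g q, of p] p q by auto
  next
    case 3
    then have null: "B p q = 2" "B q p = 2" using b by (auto simp: sym_B [of q p])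
    have fixed: "rp xs (q - p) = q - p" "rp xs (p - q) = p - q"
      using radical_rp B_eq_2_radical norm null by metis+
    \<comment> \<open>Otherwise the whole null string would lie at the height of \<open>p\<close>,
      against \<open>finite_height\<close>.\<close>
    have "h (q - p) \<noteq> 0"
    proof
      assume 0: "h (q - p) = 0"
      define d where "d = q - p"
      define c where "c = (\<lambda>i::nat. p + real i *\<^sub>R d)"
      have "c i \<in> R" for i
        using null_string [OF p(1) q(1) null(1)] by (simp add: c_def d_def)
      then have "range c \<subseteq> {\<zeta> \<in> R. 0 < h \<zeta> \<and> h \<zeta> \<le> h p}"
        using 0 p by (auto simp: c_def d_def)
      moreover have "inj c"
        using \<open>p \<noteq> q\<close> by (auto simp: inj_on_def c_def d_def)
      ultimately show False
        using finite_height finite_subset range_inj_infinite by blast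
    qed
    then consider "h (q - p) > 0" | "h (p - q) > 0" by fastforce
    then show ?thesis
      unfolding comp
      using len_decreases_null [OF g p q null(1) fixed(1)]
        len_decreases_null [OF g q p null(2) fixed(2)] by cases auto
  qed
qed

section \<open>Removal of peaks from the path of partial products\<close>

definition ascending :: "'v list \<Rightarrow> bool" where
  "ascending xs \<longleftrightarrow> (\<forall>ys p zs. xs = ys @ p # zs \<longrightarrow> h p > 0 \<and> h (rp ys p) > 0)"

text \<open>The total length of the partial products. A Hurwitz move changes only one of them, so
  lowering a peak lowers the sum and the process terminates.\<close>

definition weight :: "'v list \<Rightarrow> nat" where
  "weight xs = (\<Sum>j\<le>length xs. len (rp (take j xs)))"

lemma weight_less:
  assumes "rp [a, b] = rp [u, v]"
    and "len (rp (xs @ [a])) < len (rp (xs @ [u]))"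
  shows "weight (xs @ a # b # ys) < weight (xs @ u # v # ys)"
proof -
  have eq: "rp (take j (xs @ a # b # ys)) = rp (take j (xs @ u # v # ys))"
    if "j \<noteq> Suc (length xs)" for j
  proof (cases "j \<le> length xs")
    case False
    with that have "j = length xs + Suc (Suc (j - length xs - 2))" by simp
    then obtain i where "j = length xs + Suc (Suc i)" ..
    then show ?thesis using fun_cong [OF assms(1)] by (simp add: fun_eq_iff)
  qed simp
  have less: "len (rp (take (Suc (length xs)) (xs @ a # b # ys))) <
      len (rp (take (Suc (length xs)) (xs @ u # v # ys)))"
    using assms(2) by simp
  have "len (rp (take j (xs @ a # b # ys))) \<le>
      len (rp (take j (xs @ u # v # ys)))" for j
  proof (cases "j = Suc (length xs)")
    case True
    with less show ?thesis by (simp only: less_imp_le)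
  next
    case False
    show ?thesis unfolding eq [OF False] ..
  qed
  then show ?thesis
    unfolding weight_def length_append length_Cons using less
    by (intro sum_strict_mono_ex1) (auto simp del: take_append intro!: bexI [of _ "Suc (length xs)"])
qed

lemma hw_positive:
  assumes "set xs \<subseteq> R"
  shows "\<exists>ys. hw xs ys \<and> set ys \<subseteq> R \<and> (\<forall>y\<in>set ys. h y > 0) \<and>
    weight ys = weight xs"
proof -
  define ys where "ys = map (\<lambda>p. if h p < 0 then - p else p) xs"
  have rp: "rp (take j ys) = rp (take j xs)" for j
  proof -
    have *: "s \<circ> (\<lambda>p. if h p < 0 then - p else p) = s" by (auto simp: fun_eq_iff)
    show ?thesis unfolding ys_def take_map by (rule ext) (simp only: foldr_map *)
  qed
  have "hw xs ys"
    using norm2_R [OF assms] by (intro hw_flips) (auto simp: ys_def)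
  moreover have "set ys \<subseteq> R" using assms minus_R by (auto simp: ys_def)
  moreover have "h y > 0" if y: "y \<in> set ys" for y
  proof -
    obtain x where "x \<in> set xs" "y = (if h x < 0 then - x else x)" using y by (auto simp: ys_def)
    then show ?thesis using h_nonzero [of x] assms by (cases "h x < 0") auto
  qed
  moreover have "weight ys = weight xs"
    unfolding weight_def rp by (simp add: ys_def)
  ultimately show ?thesis by blast
qed

lemma hw_repeat_or_ascending:
  assumes "set xs \<subseteq> R"
  shows "\<exists>ys. hw xs ys \<and> ((\<exists>us r vs. ys = us @ r # r # vs) \<or> ascending ys)"
  using assms
proof (induction "weight xs" arbitrary: xs rule: less_induct)
  case less
  obtain ys where ys: "hw xs ys" "set ys \<subseteq> R" "\<And>y. y \<in> set ys \<Longrightarrow> h y > 0"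
    "weight ys = weight xs"
    using hw_positive [OF less.prems] by blast
  show ?case
  proof (cases "ascending ys")
    case True
    with ys show ?thesis by blast
  next
    case False
    \<comment> \<open>A shortest prefix \<open>us\<close> followed by a descent is nonempty and ends
      in an ascent \<open>p\<close>; together with the next entry \<open>q\<close> this is a peak,
      or a repeated pair if \<open>p = q\<close>.\<close>
    define Q where "Q = (\<lambda>us. \<exists>q vs. ys = us @ q # vs \<and> \<not> h (rp us q) > 0)"
    have "\<exists>us. Q us" using False ys(3) by (auto simp: ascending_def Q_def)
    then obtain us where us: "Q us" "\<And>us'. length us' < length us \<Longrightarrow> \<not> Q us'"
      using ex_has_least_nat [of Q _ length] by (metis not_less)
    obtain q vs where q: "ys = us @ q # vs" "\<not> h (rp us q) > 0" using us(1) by (auto simp: Q_def)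
    have "us \<noteq> []" using q ys(3) [of q] by auto
    then obtain us' p where us': "us = us' @ [p]" by (metis rev_exhaust)
    have roots: "set us' \<subseteq> R" "p \<in> R" "q \<in> R" "h p > 0" "h q > 0"
      using ys(2,3) q us' by auto
    have "\<not> Q us'" using us(2) us' by simp
    then have "h (rp us' p) > 0" using q us' by (auto simp: Q_def)
    then have down: "h (rp us p) < 0" "h (rp us q) < 0"
      using q us' roots h_nonzero [of "rp us q"] rp_R [of us q] norm_R [of p]
      by (auto simp: s_self)
    show ?thesis
    proof (cases "p = q")
      case True
      then have "ys = us' @ p # p # vs" using q us' by simp
      with ys(1) show ?thesis by blast
    next
      case False
      have norm: "B p p = 2" "B q q = 2" using roots norm_R by auto
      consider "len (rp (us @ [p, q])) < len (rp us)"
        | "len (rp (us @ [q, p])) < len (rp us)"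
        using peak_reduction [of us p q] roots down False us' by auto
      then obtain zs where zs: "hw ys zs" "weight zs < weight ys"
      proof cases
        case 1
        have "rp (us' @ [q]) = rp (us @ [p, q])"
          using us' norm by (simp add: fun_eq_iff)
        then have "len (rp (us' @ [q])) < len (rp (us' @ [p]))"
          using 1 us' by simp
        then have "weight (us' @ q # s q p # vs) < weight (us' @ p # q # vs)"
          by (rule weight_less [rotated]) (use norm in \<open>auto simp: s_conj fun_eq_iff\<close>)
        moreover have "hw ys (us' @ q # s q p # vs)"
          using q us' norm by (auto intro: hstep_hw hstep.right)
        ultimately show ?thesis using that q us' by simp
      next
        case 2
        have "rp (us' @ [s p q]) = rp (us @ [q, p])"
          using us' norm by (simp add: fun_eq_iff s_conj)
        then have "len (rp (us' @ [s p q])) < len (rp (us' @ [p]))"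
          using 2 us' by simp
        then have "weight (us' @ s p q # p # vs) < weight (us' @ p # q # vs)"
          by (rule weight_less [rotated]) (use norm in \<open>auto simp: s_conj fun_eq_iff\<close>)
        moreover have "hw ys (us' @ s p q # p # vs)"
          using q us' norm by (auto intro: hstep_hw hstep.left)
        ultimately show ?thesis using that q us' by simp
      qed
      have "set zs \<subseteq> R" using hw_closed [OF zs(1) ys(2)] s_R minus_R by blast
      then obtain ws where "hw zs ws" "(\<exists>us r vs. ws = us @ r # r # vs) \<or> ascending ws"
        using less.hyps [of zs] zs(2) ys(4) by auto
      then show ?thesis using ys(1) zs(1) hw_trans by blast
    qed
  qed
qed

text \<open>On its way through the letters the root turns from positive to negative at some letter,
  and \<open>simple_reflection\<close> identifies it there with that letter.\<close>

lemma exchange: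
  assumes "set ss \<subseteq> \<Delta>" "p \<in> R" "h p > 0" "h (rp ss p) < 0"
  shows "\<exists>us \<alpha> vs. ss = us @ \<alpha> # vs \<and> rp vs p = \<alpha>"
  using assms
proof (induction ss)
  case (Cons \<alpha> ss)
  have "rp ss p \<in> R" using Cons.prems \<Delta>_roots by (intro rp_R) auto
  show ?case
  proof (cases "h (rp ss p) < 0")
    case True
    then obtain us \<alpha>' vs where "ss = us @ \<alpha>' # vs" "rp vs p = \<alpha>'" using Cons by auto
    then show ?thesis by (intro exI [of _ "\<alpha> # us"]) auto
  next
    case False
    then have "h (rp ss p) > 0" using h_nonzero [OF \<open>rp ss p \<in> R\<close>] by linarith
    then have "rp ss p = \<alpha>"
      using simple_reflection [of \<alpha> "rp ss p"] Cons.prems \<open>rp ss p \<in> R\<close> by auto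
    then show ?thesis by (intro exI [of _ "[]"]) auto
  qed
qed auto

text \<open>Without a repeated pair the list can be made ascending. Its last entry is then inverted
  by the product, so the exchange property deletes a letter of \<open>ss\<close>, and induction
  treats the shortened lists. If \<open>ss\<close> is strictly shorter than \<open>xs\<close>, only
  a repeated pair is possible, since moves keep the length.\<close>

lemma hw_simple_word:
  assumes "set ss \<subseteq> \<Delta>" "set xs \<subseteq> R" "length ss \<le> length xs" "\<And>v. rp xs v = rp ss v"
  shows "(\<exists>us r vs. hw xs (us @ r # r # vs)) \<or> hw xs ss"
  using assms
proof (induction "length ss" arbitrary: ss xs rule: less_induct)
  case less
  obtain ys where ys: "hw xs ys" "(\<exists>us r vs. ys = us @ r # r # vs) \<or> ascending ys"
    using hw_repeat_or_ascending [OF less.prems(2)] by blast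
  show ?case
  proof (cases "\<exists>us r vs. ys = us @ r # r # vs")
    case True
    with ys show ?thesis by blast
  next
    case False
    then have asc: "ascending ys" using ys by blast
    have ys_roots: "set ys \<subseteq> R" using hw_closed [OF ys(1) less.prems(2)] s_R minus_R by blast
    show ?thesis
    proof (cases ys rule: rev_cases)
      case Nil
      then have "ss = []" using hw_length [OF ys(1)] less.prems by simp
      with Nil ys(1) show ?thesis by simp
    next
      case (snoc zs p)
      have p: "p \<in> R" "set zs \<subseteq> R" "h p > 0" "h (rp zs p) > 0"
        using snoc ys_roots asc by (auto simp: ascending_def)
      have norm: "B p p = 2" using p norm_R by simp
      have rp: "rp ss v = rp zs (s p v)" for v
        using less.prems(4) hw_rp [OF ys(1)] snoc by simp
      have "h (rp ss p) < 0" using p rp norm by (simp add: s_self)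
      then obtain us \<alpha> vs where ss: "ss = us @ \<alpha> # vs" "rp vs p = \<alpha>"
        using exchange less.prems p by blast
      have vs: "norm2 vs" using less.prems(1) ss \<Delta>_roots norm_R by auto
      have "rp zs v = rp (us @ vs) v" for v
      proof -
        have "rp zs v = rp ss (s p v)" using rp norm by simp
        also have "\<dots> = rp us (s (rp vs p) (rp vs (s p v)))" using ss by simp
        also have "\<dots> = rp us (rp vs v)" using s_rp [OF vs] vs norm by simp
        finally show ?thesis by simp
      qed
      moreover have "length (us @ vs) \<le> length zs"
        using less.prems(3) hw_length [OF ys(1)] snoc ss by simp
      ultimately have "(\<exists>us r vs. hw zs (us @ r # r # vs)) \<or> hw zs (us @ vs)"
        using less.hyps [of "us @ vs" zs] ss less.prems p by auto
      then show ?thesis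
      proof (elim disjE exE)
        fix us' r vs' assume "hw zs (us' @ r # r # vs')"
        then have "hw ys (us' @ r # r # vs' @ [p])"
          using hw_append_right [of zs _ "[p]"] snoc by fastforce
        then show ?thesis using ys(1) hw_trans by blast
      next
        assume "hw zs (us @ vs)"
        then have "hw ys (us @ vs @ [p])"
          using hw_append_right [of zs "us @ vs" "[p]"] snoc by simp
        \<comment> \<open>Moving \<open>p\<close> left over \<open>vs\<close> turns it into
          \<open>rp vs p\<close>, the deleted letter.\<close>
        also have "hw \<dots> ss"
          using hw_append_left [OF hw_move_front [OF vs norm, of "[]"], of us] ss by simp
        finally show ?thesis using ys(1) hw_trans by blast
      qed
    qed
  qed
qed

end

section \<open>Coordinates with respect to an elliptic root basis\<close>

lemma group_closure_mono_closed:
  assumes "X \<subseteq> group_closure Y"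
  shows "group_closure X \<subseteq> group_closure Y"
proof
  fix v assume "v \<in> group_closure X"
  then show "v \<in> group_closure Y"
    by induction (use assms in \<open>auto intro: group_closure.diff\<close>)
qed

lemma group_closure_linear_image:
  assumes "linear f" "v \<in> group_closure X"
  shows "f v \<in> group_closure (f ` X)"
  using assms(2)
  by induction (use assms(1) in \<open>auto simp: linear_0 linear_diff intro: group_closure.intros\<close>)

lemma group_closure_functional:
  fixes f :: "'v::real_vector \<Rightarrow> real"
  assumes "linear f" "v \<in> group_closure X" "\<And>x. x \<in> X \<Longrightarrow> \<exists>z::int. f x = of_int z * c"
  shows "\<exists>z::int. f v = of_int z * c"
  using assms(2)
proof induction
  case (base v)
  then show ?case using assms(1,3) by (auto simp: linear_0 intro: exI [of _ 0])
next
  case (diff u v)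
  then obtain y z :: int where "f u = of_int y * c" "f v = of_int z * c" by blast
  then have "f (u - v) = of_int (y - z) * c"
    using assms(1) by (simp add: linear_diff algebra_simps)
  then show ?case by blast
qed

lemma int_unit_mult:
  assumes "of_int z * x = (1::real)" "x \<in> \<int>"
  shows "x = 1 \<or> x = - 1"
proof -
  obtain y where y: "x = of_int y" using assms(2) by (elim Ints_cases)
  then have "z * y = 1" using assms(1) by (metis of_int_eq_1_iff of_int_mult)
  then show ?thesis using y by (auto simp: zmult_eq_1_iff)
qed

text \<open>The working form of the hypotheses: \<open>co\<close> and \<open>coa\<close> are the
  coordinates in the basis of the \<alpha> i and \<open>a\<close>, and the marks are extended to the
  vertex 0 by 1. That an elliptic root basis provides all this is
  \<open>elliptic_basis_exists\<close>.\<close>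

locale elliptic_basis = semidefinite_form B
  for B :: "'v::real_vector \<Rightarrow> 'v \<Rightarrow> real" +
  fixes \<Phi> :: "'v set" and n t :: nat and \<alpha> :: "nat \<Rightarrow> 'v" and a :: 'v
    and co :: "nat \<Rightarrow> 'v \<Rightarrow> real" and coa :: "'v \<Rightarrow> real" and m :: "nat \<Rightarrow> nat"
  assumes norm_\<Phi>: "r \<in> \<Phi> \<Longrightarrow> B r r = 2"
    and s_\<Phi>: "r \<in> \<Phi> \<Longrightarrow> \<eta> \<in> \<Phi> \<Longrightarrow> s r \<eta> \<in> \<Phi>"
    and B_Ints_\<Phi>: "r \<in> \<Phi> \<Longrightarrow> \<eta> \<in> \<Phi> \<Longrightarrow> B r \<eta> \<in> \<int>"
    and linear_co: "linear (co i)"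
    and linear_coa: "linear coa"
    and co_\<alpha>: "i \<le> n \<Longrightarrow> j \<le> n \<Longrightarrow> co i (\<alpha> j) = (if i = j then 1 else 0)"
    and co_a [simp]: "i \<le> n \<Longrightarrow> co i a = 0"
    and coa_\<alpha> [simp]: "j \<le> n \<Longrightarrow> coa (\<alpha> j) = 0"
    and coa_a [simp]: "coa a = 1"
    and expansion: "v = (\<Sum>i\<le>n. co i v *\<^sub>R \<alpha> i) + coa v *\<^sub>R a"
    and \<alpha>_\<Phi>: "i \<le> n \<Longrightarrow> \<alpha> i \<in> \<Phi>"
    and a_radical [simp]: "B a v = 0"
    and m_0 [simp]: "m 0 = 1"
    and m_pos: "i \<le> n \<Longrightarrow> m i > 0"
    and \<delta>_radical': "B (\<Sum>i\<le>n. real (m i) *\<^sub>R \<alpha> i) v = 0"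
    and radical_span: "(\<And>w. B v w = 0) \<Longrightarrow>
      \<exists>x y. v = x *\<^sub>R a + y *\<^sub>R (\<Sum>i\<le>n. real (m i) *\<^sub>R \<alpha> i)"
    and coordinates: "r \<in> \<Phi> \<Longrightarrow>
      \<exists>k :: nat \<Rightarrow> nat. (\<forall>i\<le>n. co i r = k i) \<or> (\<forall>i\<le>n. co i r = - real (k i))"
    and coa_Ints: "r \<in> \<Phi> \<Longrightarrow> coa r \<in> \<int>"
    and t_bounds: "1 \<le> t" "t \<le> n"
    and m_le_m_t: "i \<le> n \<Longrightarrow> m i \<le> m t"
    and a_lattice: "a \<in> group_closure \<Phi>"
    and unit_pairing: "r \<in> \<Phi> \<Longrightarrow> \<exists>\<eta>\<in>\<Phi>. B r \<eta> = 1 \<or> B r \<eta> = - 1"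
    and n_ge_2: "n \<ge> 2"
begin

definition \<delta> :: 'v where
  "\<delta> = (\<Sum>i\<le>n. real (m i) *\<^sub>R \<alpha> i)"

text \<open>
  The quotient of $V$ by the line $U$ through \<open>a\<close> is realised as the range of the projection \<open>P\<close>,
  and the affine root system as \<open>P ` \<Phi>\<close>.
\<close>

definition P :: "'v \<Rightarrow> 'v" where
  "P v = v - coa v *\<^sub>R a"

definition height :: "'v \<Rightarrow> real" where
  "height v = (\<Sum>i\<le>n. co i v)"

lemmas co_linear_simps [simp] =
  linear_add [OF linear_co] linear_diff [OF linear_co] linear_scale [OF linear_co]
  linear_neg [OF linear_co] linear_0 [OF linear_co] linear_sum [OF linear_co]
  linear_add [OF linear_coa] linear_diff [OF linear_coa] linear_scale [OF linear_coa]
  linear_neg [OF linear_coa] linear_0 [OF linear_coa] linear_sum [OF linear_coa]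

lemma \<delta>_radical [simp]: "B \<delta> v = 0"
  using \<delta>_radical' by (simp add: \<delta>_def)

lemma radical_right [simp]: "B v a = 0" "B v \<delta> = 0"
  using sym_B [of v] by simp_all

lemma co_sum:
  assumes "I \<subseteq> {..n}" "j \<le> n"
  shows "co j (\<Sum>i\<in>I. f i *\<^sub>R \<alpha> i) = (if j \<in> I then f j else 0)"
proof -
  have "finite I" using assms finite_subset by auto
  have "co j (\<Sum>i\<in>I. f i *\<^sub>R \<alpha> i) = (\<Sum>i\<in>I. if i = j then f i else 0)"
    using assms by (simp, intro sum.cong) (auto simp: co_\<alpha>)
  then show ?thesis using \<open>finite I\<close> by simp
qed

lemma coa_sum: "I \<subseteq> {..n} \<Longrightarrow> coa (\<Sum>i\<in>I. f i *\<^sub>R \<alpha> i) = 0"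
  by (auto intro!: sum.neutral)

lemma co_\<delta> [simp]: "i \<le> n \<Longrightarrow> co i \<delta> = m i"
  using co_sum [of "{..n}" i "\<lambda>i. real (m i)"] by (simp add: \<delta>_def del: co_linear_simps)

lemma coa_\<delta> [simp]: "coa \<delta> = 0"
  by (simp add: \<delta>_def)

lemma linear_P: "linear P"
  by (rule linearI) (auto simp: P_def algebra_simps)

lemmas P_linear_simps [simp] =
  linear_add [OF linear_P] linear_diff [OF linear_P] linear_scale [OF linear_P]
  linear_neg [OF linear_P] linear_0 [OF linear_P]

lemma linear_height: "linear height"
  by (rule linearI) (auto simp: height_def sum.distrib sum_distrib_left)

lemmas height_linear_simps [simp] =
  linear_add [OF linear_height] linear_diff [OF linear_height] linear_scale [OF linear_height]
  linear_neg [OF linear_height] linear_0 [OF linear_height]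

lemma B_P [simp]: "B (P v) w = B v w" "B w (P v) = B w v"
  by (simp_all add: P_def)

lemma co_P [simp]: "i \<le> n \<Longrightarrow> co i (P v) = co i v"
  by (simp add: P_def)

lemma coa_P [simp]: "coa (P v) = 0"
  by (simp add: P_def)

lemma height_P [simp]: "height (P v) = height v"
  by (simp add: height_def)

lemma P_\<alpha> [simp]: "i \<le> n \<Longrightarrow> P (\<alpha> i) = \<alpha> i"
  by (simp add: P_def)

lemma P_a [simp]: "P a = 0"
  by (simp add: P_def)

lemma P_decomp: "v = P v + coa v *\<^sub>R a"
  by (simp add: P_def)

lemma P_s: "P (s u v) = s (P u) (P v)"
  by (simp add: reflection_def)

lemma P_rp: "P (rp xs v) = rp (map P xs) (P v)"
  by (induction xs) (auto simp: P_s)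

lemma coordinates_eqI:
  assumes "\<And>i. i \<le> n \<Longrightarrow> co i v = co i w" "coa v = coa w"
  shows "v = w"
  using expansion [of v] expansion [of w] assms by (metis (no_types, lifting) atMost_iff sum.cong)

lemma B_expansion: "B w v = (\<Sum>i\<le>n. co i v * B w (\<alpha> i))"
proof -
  have "B w v = B w ((\<Sum>i\<le>n. co i v *\<^sub>R \<alpha> i) + coa v *\<^sub>R a)"
    using expansion by metis
  then show ?thesis by (simp add: B_sum_right)
qed

lemma minus_\<Phi>: "r \<in> \<Phi> \<Longrightarrow> - r \<in> \<Phi>"
  using s_\<Phi> [of r r] s_self [of r] norm_\<Phi> by simp

lemma norm_\<alpha> [simp]: "i \<le> n \<Longrightarrow> B (\<alpha> i) (\<alpha> i) = 2"
  using norm_\<Phi> \<alpha>_\<Phi> by blast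

lemma co_Ints: "r \<in> \<Phi> \<Longrightarrow> i \<le> n \<Longrightarrow> co i r \<in> \<int>"
  using coordinates [of r] by (metis Ints_minus Ints_of_nat)

lemma co_same_sign:
  assumes "r \<in> \<Phi>" "i \<le> n" "j \<le> n" "co i r > 0"
  shows "co j r \<ge> 0"
  using coordinates [OF assms(1)] assms(2-4)
  by (elim exE disjE) (auto simp del: of_nat_0_less_iff)

lemma radical_eq:
  assumes "\<And>w. B v w = 0"
  obtains x y where "v = x *\<^sub>R a + y *\<^sub>R \<delta>"
  using radical_span [OF assms] that by (auto simp: \<delta>_def)

lemma positive_coordinates:
  assumes "r \<in> \<Phi>" "height r > 0"
  obtains k :: "nat \<Rightarrow> nat" where "\<And>i. i \<le> n \<Longrightarrow> co i r = k i"
proof -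
  obtain k :: "nat \<Rightarrow> nat" where
    k: "(\<forall>i\<le>n. co i r = k i) \<or> (\<forall>i\<le>n. co i r = - real (k i))"
    using coordinates [OF assms(1)] by blast
  have False if "\<forall>i\<le>n. co i r = - real (k i)"
    using that assms(2) sum_nonneg [of "{..n}" "\<lambda>i. real (k i)"]
    by (simp add: height_def sum_negf)
  with k that show ?thesis by blast
qed

lemma height_nonzero:
  assumes "r \<in> \<Phi>"
  shows "height r \<noteq> 0"
proof
  assume 0: "height r = 0"
  obtain k :: "nat \<Rightarrow> nat" where
    k: "(\<forall>i\<le>n. co i r = k i) \<or> (\<forall>i\<le>n. co i r = - real (k i))"
    using coordinates [OF assms(1)] by blast
  then have "(\<Sum>i\<le>n. real (k i)) = 0"
    using 0 by (auto simp: height_def sum_negf)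
  then have "\<forall>i\<le>n. k i = 0" by (simp add: sum_nonneg_eq_0_iff)
  with k have "co i r = 0" if "i \<le> n" for i using that by auto
  then have "B r r = 0" by (subst B_expansion) simp
  with norm_\<Phi> [OF assms] show False by simp
qed

text \<open>The reflection changes only the coordinate at \<open>i\<close>. A positive coordinate
  elsewhere would keep the whole root positive, so modulo \<open>a\<close> the root is a multiple of
  \<alpha> i, and its norm fixes the factor.\<close>

lemma simple_reflection_\<Phi>:
  assumes "i \<le> n" "r \<in> \<Phi>" "height r > 0" "height (s (\<alpha> i) r) < 0"
  shows "P r = \<alpha> i"
proof -
  obtain k where k: "\<And>j. j \<le> n \<Longrightarrow> co j r = real (k j)"
    using positive_coordinates assms by blast
  have s: "co j (s (\<alpha> i) r) = co j r" if "j \<noteq> i" "j \<le> n" for j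
    using that assms by (simp add: reflection_def co_\<alpha>)
  have "k j = 0" if "j \<noteq> i" "j \<le> n" for j
  proof (rule ccontr)
    assume "k j \<noteq> 0"
    then have "co j (s (\<alpha> i) r) > 0" using s k that by simp
    then have "height (s (\<alpha> i) r) \<ge> 0"
      unfolding height_def using co_same_sign [OF s_\<Phi> [OF \<alpha>_\<Phi>]] assms that
      by (intro sum_nonneg) auto
    then show False using assms by simp
  qed
  then have P: "P r = real (k i) *\<^sub>R \<alpha> i"
    using assms k by (intro coordinates_eqI) (auto simp: co_\<alpha>)
  have "B (P r) (P r) = 2" using norm_\<Phi> assms by simp
  then have "real (k i) * real (k i) = 1" unfolding P using assms by simp
  then have "k i = 1" by (simp flip: of_nat_mult)
  with P show ?thesis by simp
qed

lemma finite_height_\<Phi>: "finite {r \<in> P ` \<Phi>. 0 < height r \<and> height r \<le> C}"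
proof (rule finite_subset)
  define F where "F = (\<lambda>k. \<Sum>i\<le>n. real (k i) *\<^sub>R \<alpha> i) ` ({..n} \<rightarrow>\<^sub>E {..nat \<lfloor>C\<rfloor>})"
  show "finite F" by (simp add: F_def finite_PiE)
  show "{r \<in> P ` \<Phi>. 0 < height r \<and> height r \<le> C} \<subseteq> F"
  proof safe
    fix r assume r: "r \<in> \<Phi>" "0 < height (P r)" "height (P r) \<le> C"
    then obtain k where k: "\<And>j. j \<le> n \<Longrightarrow> co j r = real (k j)"
      using positive_coordinates by auto
    have "P r = (\<Sum>i\<le>n. co i (P r) *\<^sub>R \<alpha> i) + coa (P r) *\<^sub>R a" by (rule expansion)
    also have "\<dots> = (\<Sum>i\<le>n. real (restrict k {..n} i) *\<^sub>R \<alpha> i)" using k by simp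
    finally have "P r = (\<Sum>i\<le>n. real (restrict k {..n} i) *\<^sub>R \<alpha> i)" .
    moreover have "k i \<le> nat \<lfloor>C\<rfloor>" if "i \<le> n" for i
    proof -
      have "real (k i) \<le> (\<Sum>i\<le>n. real (k i))"
        using that by (intro member_le_sum) auto
      then have "real (k i) \<le> C" using r k by (simp add: height_def)
      then show ?thesis by (simp add: le_nat_floor)
    qed
    ultimately show "P r \<in> F" unfolding F_def
      by (intro image_eqI [of _ _ "restrict k {..n}"]) (auto simp: PiE_iff)
  qed
qed

sublocale height_roots B "P ` \<Phi>" height "\<alpha> ` {..n}"
proof
  show "B r r = 2" if "r \<in> P ` \<Phi>" for r using that norm_\<Phi> by auto
  show "s r \<eta> \<in> P ` \<Phi>" if "r \<in> P ` \<Phi>" "\<eta> \<in> P ` \<Phi>" for r \<eta>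
    using that s_\<Phi> by (auto simp flip: P_s)
  show "B r \<eta> \<in> \<int>" if "r \<in> P ` \<Phi>" "\<eta> \<in> P ` \<Phi>" for r \<eta>
    using that B_Ints_\<Phi> by auto
  show "height r \<noteq> 0" if "r \<in> P ` \<Phi>" for r using that height_nonzero by auto
  show "finite {r \<in> P ` \<Phi>. 0 < height r \<and> height r \<le> C}" for C by (rule finite_height_\<Phi>)
  show "\<alpha> ` {..n} \<subseteq> P ` \<Phi>" using \<alpha>_\<Phi> by (auto intro!: image_eqI [of _ P])
  show "r = \<eta>" if *: "\<eta> \<in> \<alpha> ` {..n}" "r \<in> P ` \<Phi>" "height r > 0" "height (s \<eta> r) < 0" for r \<eta>
  proof -
    obtain i r' where **: "i \<le> n" "\<eta> = \<alpha> i" "r' \<in> \<Phi>" "r = P r'" using * by auto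
    have "s \<eta> r = P (s (\<alpha> i) r')" using ** by (simp add: P_s)
    then show ?thesis using simple_reflection_\<Phi> [of i r'] * ** by simp
  qed
qed auto

text \<open>The first-order effect, in the direction of \<open>a\<close>, of replacing each \<alpha>
  i by \<open>lift l i\<close> in a product of reflections; see \<open>rp_lift\<close>. Higher
  orders vanish because \<open>a\<close> is radical and hence fixed by every reflection.\<close>

fun shift :: "(nat \<Rightarrow> real) \<Rightarrow> nat list \<Rightarrow> 'v" where
  "shift l [] = 0"
| "shift l (i # is) = shift l is + l i *\<^sub>R rp (rev (map \<alpha> is)) (\<alpha> i)"

definition lift :: "(nat \<Rightarrow> real) \<Rightarrow> nat \<Rightarrow> 'v" where
  "lift l i = \<alpha> i + l i *\<^sub>R a"

lemma B_lift [simp]: "B (lift l i) v = B (\<alpha> i) v" "B v (lift l i) = B v (\<alpha> i)"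
  by (simp_all add: lift_def)

lemma co_lift: "i \<le> n \<Longrightarrow> j \<le> n \<Longrightarrow> co i (lift l j) = (if i = j then 1 else 0)"
  by (simp add: lift_def co_\<alpha>)

lemma coa_lift [simp]: "i \<le> n \<Longrightarrow> coa (lift l i) = l i"
  by (simp add: lift_def)

lemma P_lift [simp]: "i \<le> n \<Longrightarrow> P (lift l i) = \<alpha> i"
  by (simp add: lift_def)

lemma s_a [simp]: "s u a = a"
  by (simp add: reflection_def)

lemma rp_a [simp]: "rp xs a = a"
  by (induction xs) auto

lemma norm2_map_\<alpha>: "set is \<subseteq> {..n} \<Longrightarrow> norm2 (map \<alpha> is)"
  by auto

lemma B_rp_left: "norm2 xs \<Longrightarrow> B u (rp xs v) = B (rp (rev xs) u) v"
  using B_rp_rp [of "rev xs" u "rp xs v"] by simp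

lemma rp_lift:
  assumes "set is \<subseteq> {..n}"
  shows "rp (map (lift l) is) v = rp (map \<alpha> is) v - B (shift l is) v *\<^sub>R a"
  using assms
proof (induction "is")
  case (Cons i "is")
  have "s (lift l i) w = s (\<alpha> i) w - (l i * B (\<alpha> i) w) *\<^sub>R a" for w
    by (simp add: reflection_def lift_def algebra_simps)
  moreover have "B (\<alpha> i) (rp (map \<alpha> is) v) = B (rp (rev (map \<alpha> is)) (\<alpha> i)) v"
    using Cons.prems by (intro B_rp_left norm2_map_\<alpha>) auto
  ultimately have "rp (map (lift l) (i # is)) v =
      s (\<alpha> i) (rp (map \<alpha> is) v - B (shift l is) v *\<^sub>R a) -
      (l i * B (rp (rev (map \<alpha> is)) (\<alpha> i)) v) *\<^sub>R a"
    using Cons by simp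
  then show ?case by (simp add: algebra_simps)
qed simp

lemma co_rp_\<alpha>: "set is \<subseteq> {..n} \<Longrightarrow> j \<le> n \<Longrightarrow> j \<notin> set is \<Longrightarrow> co j (rp (map \<alpha> is) v) = co j v"
  by (induction "is") (auto simp: reflection_def co_\<alpha>)

lemma co_rp_rev_\<alpha>:
  "set is \<subseteq> {..n} \<Longrightarrow> j \<le> n \<Longrightarrow> j \<notin> set is \<Longrightarrow> co j (rp (rev (map \<alpha> is)) v) = co j v"
  using co_rp_\<alpha> [of "rev is" j v] by (simp add: rev_map)

lemma coa_rp_\<alpha>: "set is \<subseteq> {..n} \<Longrightarrow> coa (rp (map \<alpha> is) v) = coa v"
  by (induction "is") (auto simp: reflection_def)

lemma coa_rp_rev_\<alpha>: "set is \<subseteq> {..n} \<Longrightarrow> coa (rp (rev (map \<alpha> is)) v) = coa v"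
  using coa_rp_\<alpha> [of "rev is" v] by (simp add: rev_map)

lemma co_shift_outside:
  "set is \<subseteq> {..n} \<Longrightarrow> j \<le> n \<Longrightarrow> j \<notin> set is \<Longrightarrow> co j (shift l is) = 0"
  by (induction "is") (auto simp: co_rp_rev_\<alpha> co_\<alpha>)

lemma coa_shift: "set is \<subseteq> {..n} \<Longrightarrow> coa (shift l is) = 0"
  by (induction "is") (auto simp: coa_rp_rev_\<alpha>)

lemma rp_\<Phi>: "set xs \<subseteq> \<Phi> \<Longrightarrow> r \<in> \<Phi> \<Longrightarrow> rp xs r \<in> \<Phi>"
  by (induction xs) (auto simp: s_\<Phi>)

lemma rp_rev_\<alpha>_\<Phi>: "set is \<subseteq> {..n} \<Longrightarrow> i \<le> n \<Longrightarrow> rp (rev (map \<alpha> is)) (\<alpha> i) \<in> \<Phi>"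
  using \<alpha>_\<Phi> by (intro rp_\<Phi>) auto

lemma co_shift_Ints:
  "set is \<subseteq> {..n} \<Longrightarrow> (\<And>i. i \<in> set is \<Longrightarrow> l i \<in> \<int>) \<Longrightarrow> j \<le> n \<Longrightarrow> co j (shift l is) \<in> \<int>"
  by (induction "is") (auto intro!: Ints_add Ints_mult co_Ints rp_rev_\<alpha>_\<Phi>)

lemma shift_diff: "shift (\<lambda>i. l i - l' i) is = shift l is - shift l' is"
  by (induction "is") (auto simp: algebra_simps)

lemma shift_cong: "(\<And>i. i \<in> set is \<Longrightarrow> l i = l' i) \<Longrightarrow> shift l is = shift l' is"
  by (induction "is") auto

text \<open>Triangularity: the root attached to the first letter has coordinate 1 at that letter,
  and later letters contribute nothing there.\<close>

lemma shift_eq_0: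
  assumes "set is \<subseteq> {..n}" "distinct is" "shift l is = 0" "i \<in> set is"
  shows "l i = 0"
  using assms
proof (induction "is")
  case (Cons j "is")
  have "co j (shift l (j # is)) = l j"
    using Cons.prems(1,2) by (simp add: co_shift_outside co_rp_rev_\<alpha> co_\<alpha>)
  then have "l j = 0" using Cons.prems(3) by (simp del: shift.simps)
  then show ?case using Cons by auto
qed simp

lemma shift_surj:
  assumes "set is \<subseteq> {..n}" "distinct is"
  shows "\<exists>l. (\<forall>i. l i \<in> \<int>) \<and> shift l is = (\<Sum>i\<in>set is. real_of_int (c i) *\<^sub>R \<alpha> i)"
  using assms
proof (induction "is" arbitrary: c)
  case Nil
  show ?case by (intro exI [of _ "\<lambda>_. 0"]) auto
next
  case (Cons i "is")
  define r where "r = rp (rev (map \<alpha> is)) (\<alpha> i)"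
  have r: "r \<in> \<Phi>" using Cons.prems by (auto simp: r_def intro: rp_rev_\<alpha>_\<Phi>)
  \<comment> \<open>\<open>r\<close> has coordinate 1 at \<open>i\<close>, so the first letter must
    carry the shift \<open>c i\<close>; the later letters correct the other coordinates of
    \<open>c i\<close> times \<open>r\<close>.\<close>
  define c' where "c' = (\<lambda>j. c j - c i * \<lfloor>co j r\<rfloor>)"
  obtain l where l: "\<And>i. l i \<in> \<int>" "shift l is = (\<Sum>j\<in>set is. real_of_int (c' j) *\<^sub>R \<alpha> j)"
    using Cons.IH [of c'] Cons.prems by auto
  define l' where "l' = l(i := of_int (c i))"
  have floor: "real_of_int \<lfloor>co j r\<rfloor> = co j r" if "j \<le> n" for j
    using co_Ints [OF r that] by (simp add: of_int_floor_cancel)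
  have "shift l' is = shift l is"
    using Cons.prems by (intro shift_cong) (auto simp: l'_def)
  then have "shift l' (i # is) = (\<Sum>j\<in>set is. real_of_int (c' j) *\<^sub>R \<alpha> j) + real_of_int (c i) *\<^sub>R r"
    using l by (simp add: l'_def r_def)
  also have "\<dots> = (\<Sum>j\<in>set (i # is). real_of_int (c j) *\<^sub>R \<alpha> j)"
  proof (rule coordinates_eqI)
    fix j assume j: "j \<le> n"
    have "co j r = (if j = i then 1 else 0)" if "j \<notin> set is"
      using Cons.prems that j by (simp add: r_def co_rp_rev_\<alpha> co_\<alpha>)
    then show "co j ((\<Sum>j\<in>set is. real_of_int (c' j) *\<^sub>R \<alpha> j) + real_of_int (c i) *\<^sub>R r) =
      co j (\<Sum>j\<in>set (i # is). real_of_int (c j) *\<^sub>R \<alpha> j)"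
      using Cons.prems j floor [OF j] unfolding linear_add [OF linear_co]
      by (subst (1 2) co_sum) (auto simp: c'_def)
  next
    show "coa ((\<Sum>j\<in>set is. real_of_int (c' j) *\<^sub>R \<alpha> j) + real_of_int (c i) *\<^sub>R r) =
      coa (\<Sum>j\<in>set (i # is). real_of_int (c j) *\<^sub>R \<alpha> j)"
      using Cons.prems unfolding linear_add [OF linear_coa] by (subst (1 2) coa_sum) (auto simp: r_def coa_rp_rev_\<alpha>)
  qed
  finally have "shift l' (i # is) = (\<Sum>j\<in>set (i # is). real_of_int (c j) *\<^sub>R \<alpha> j)" .
  moreover have "l' j \<in> \<int>" for j using l(1) by (simp add: l'_def)
  ultimately show ?case by blast
qed

section \<open>Canonical factorisations\<close>

definition tail :: "real \<Rightarrow> 'v list" where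
  "tail e = [\<alpha> t, \<alpha> t + e *\<^sub>R a]"

lemma t_le [simp]: "t \<le> n"
  by (rule t_bounds)

lemma height_\<alpha> [simp]: "i \<le> n \<Longrightarrow> height (\<alpha> i) = 1"
  by (simp add: height_def co_\<alpha>)

lemma map_P_eq_map_\<alpha>:
  assumes "map P ds = map \<alpha> is" "distinct is" "set is \<subseteq> {..n}"
  shows "\<exists>l. ds = map (lift l) is"
  using assms
proof (induction "is" arbitrary: ds)
  case (Cons i "is")
  then obtain d ds' where ds: "ds = d # ds'" "P d = \<alpha> i" "map P ds' = map \<alpha> is"
    by (auto simp: map_eq_Cons_conv)
  then obtain l where l: "ds' = map (lift l) is" using Cons by auto
  have "d = lift (l(i := coa d)) i" using P_decomp [of d] ds by (simp add: lift_def)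
  moreover have "ds' = map (lift (l(i := coa d))) is"
    using l Cons.prems by (auto simp: lift_def)
  ultimately show ?case using ds by (metis list.simps(9))
qed auto

text \<open>Conjugating the pair by an \<alpha> i, i different from t, with positive product lowers
  the height and keeps the coordinate 1 at \<open>t\<close>. When no such i is left, expanding
  \<open>B r r = 2\<close> forces product 2 with \<alpha> t. Then \<open>r\<close> and \<alpha> t
  differ by a radical vector, which vanishes because its \<open>a\<close>-component and its
  coordinate at \<open>t\<close> do.\<close>

lemma hw_to_lowest_pair:
  assumes "r \<in> P ` \<Phi>" "co t r = 1" "set is = {..n} - {t}"
  shows "hw (map \<alpha> is @ [r, r]) (map \<alpha> is @ [\<alpha> t, \<alpha> t])"
  using assms(1,2)
proof (induction "nat \<lfloor>height r\<rfloor>" arbitrary: r rule: less_induct)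
  case less
  obtain g where g: "g \<in> \<Phi>" "r = P g" using less.prems by auto
  have r_norm: "B r r = 2" using g norm_\<Phi> by simp
  have pos: "co i r \<ge> 0" if "i \<le> n" for i
    using co_same_sign [OF g(1), of t i] less.prems g that by simp
  have norm2: "norm2 (map \<alpha> is)" using assms(3) by auto
  show ?case
  proof (cases "\<exists>i\<in>{..n} - {t}. B r (\<alpha> i) > 0")
    case True
    then obtain i where i: "i \<le> n" "i \<noteq> t" "B r (\<alpha> i) > 0" by auto
    define b where "b = B r (\<alpha> i)"
    define r' where "r' = s (\<alpha> i) r"
    have r': "r' = r - b *\<^sub>R \<alpha> i" by (simp add: r'_def b_def reflection_def sym_B)
    have mem: "r' \<in> P ` \<Phi>"
      using g i \<alpha>_\<Phi> s_\<Phi> by (auto simp: r'_def P_s intro!: image_eqI [of _ P "s (\<alpha> i) g"])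
    then obtain g' where g': "g' \<in> \<Phi>" "r' = P g'" by auto
    have "b \<in> \<int>" using B_Ints_\<Phi> [OF g(1) \<alpha>_\<Phi> [OF i(1)]] g by (simp add: b_def)
    with i have "b \<ge> 1" by (auto simp: b_def elim!: Ints_cases)
    have "co t r' = 1" using less.prems i by (simp add: r' co_\<alpha>)
    moreover have "height r' \<ge> 0"
      unfolding height_def using co_same_sign [OF g'(1), of t] g' calculation
      by (intro sum_nonneg) auto
    moreover have "height r' \<le> height r - 1" using i \<open>b \<ge> 1\<close> by (simp add: r')
    ultimately have "hw (map \<alpha> is @ [r', r']) (map \<alpha> is @ [\<alpha> t, \<alpha> t])"
      using mem by (intro less.hyps) (auto, linarith)
    moreover have "hw (map \<alpha> is @ [r, r]) (map \<alpha> is @ [r', r'])"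
      unfolding r'_def using i assms(3) norm2 r_norm by (intro hw_pair_conj_at_end) auto
    ultimately show ?thesis using hw_trans by blast
  next
    case False
    have "2 = (\<Sum>i\<le>n. co i r * B r (\<alpha> i))" using r_norm B_expansion by metis
    also have "\<dots> = B r (\<alpha> t) + (\<Sum>i\<in>{..n} - {t}. co i r * B r (\<alpha> i))"
      using less.prems by (subst sum.remove [of _ t]) auto
    also have "(\<Sum>i\<in>{..n} - {t}. co i r * B r (\<alpha> i)) \<le> 0"
      using False pos by (intro sum_nonpos) (auto simp: not_less intro: mult_nonneg_nonpos)
    finally have "B (\<alpha> t) r = 2"
      using B_roots_bounds(1) [of "\<alpha> t" r] r_norm by (simp add: sym_B)
    then obtain x y where xy: "r - \<alpha> t = x *\<^sub>R a + y *\<^sub>R \<delta>"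
      using radical_eq [of "r - \<alpha> t"] B_eq_2_radical [of "\<alpha> t" r] r_norm by auto
    have "coa (r - \<alpha> t) = x" "co t (r - \<alpha> t) = y * m t" unfolding xy by simp_all
    then have "x = 0" "y = 0"
      using g less.prems m_pos [of t] by (auto simp: co_\<alpha>)
    with xy have "r = \<alpha> t" by simp
    then show ?thesis by simp
  qed
qed

text \<open>Reflecting a term of the string in the next one gives minus the one after, so a Hurwitz
  move and a flip slide two neighbours one place along the string.\<close>

lemma hw_tail_shift:
  fixes e :: real and j :: int
  shows "hw [\<alpha> t + (j * e) *\<^sub>R a, \<alpha> t + ((j + 1) * e) *\<^sub>R a] (tail e)"
proof -
  define q where "q = (\<lambda>j::int. [\<alpha> t + (j * e) *\<^sub>R a, \<alpha> t + ((j + 1) * e) *\<^sub>R a])"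
  have step: "hw (q j) (q (j + 1))" for j
  proof -
    define u v w where "u = \<alpha> t + (j * e) *\<^sub>R a" "v = \<alpha> t + ((j + 1) * e) *\<^sub>R a"
      "w = \<alpha> t + ((real_of_int j + 2) * e) *\<^sub>R a"
    have norm: "B u u = 2" "B v v = 2" by (simp_all add: u_v_w_def)
    have "s v u = u - 2 *\<^sub>R v" by (simp add: u_v_w_def reflection_def)
    also have "\<dots> = - w"
      unfolding u_v_w_def scaleR_2 by (simp add: algebra_simps flip: scaleR_add_left)
    finally have "s v u = - w" .
    then have "hw [u, v] [v, - w]" using hw_Cons_Cons_right [OF norm, of "[]"] by simp
    moreover have "hw [v, - w] [v, w]"
      using hstep_hw [OF hstep.flip [of "- w" "[v]" "[]"]] by (simp add: u_v_w_def add.commute)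
    moreover have "real_of_int (j + 1) + 1 = real_of_int j + 2" by simp
    then have "q j = [u, v]" "q (j + 1) = [v, w]"
      unfolding q_def u_v_w_def by (simp_all only: of_int_add of_int_1)
    ultimately show ?thesis using hw_trans by simp
  qed
  have pos: "hw (q (- int i)) (q 0)" for i
  proof (induction i)
    case (Suc i)
    have "hw (q (- int (Suc i))) (q (- int i))" using step [of "- int (Suc i)"] by simp
    then show ?case using Suc hw_trans by blast
  qed simp
  have neg: "hw (q 0) (q (int i))" for i
  proof (induction i)
    case (Suc i)
    have "hw (q (int i)) (q (int (Suc i)))" using step [of "int i"] by (simp add: add.commute)
    then show ?case using Suc hw_trans by blast
  qed simp
  have "hw (q j) (q 0)"
    using pos [of "nat (- j)"] hw_sym [OF neg [of "nat j"]] by (cases "j \<ge> 0") auto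
  then show ?thesis by (simp add: q_def tail_def)
qed

lemma rp_tail: "rp (tail e) v = v - (e * B (\<alpha> t) v) *\<^sub>R a"
proof -
  have "v - x *\<^sub>R (\<alpha> t + e *\<^sub>R a) - (x - x * 2) *\<^sub>R \<alpha> t = v - (e * x) *\<^sub>R a" for x
    by (simp add: algebra_simps)
  then show ?thesis by (simp add: tail_def reflection_def)
qed

text \<open>The two products differ by a multiple of \<open>a\<close> only, with coefficients given
  by \<open>rp_lift\<close> and \<open>rp_tail\<close>; the reference word has all shifts 0 and
  \<open>e = 1\<close>.\<close>

lemma tail_eq_iff_shift:
  assumes "set is \<subseteq> {..n}"
  shows "(\<forall>v. rp (map (lift l) is @ tail e) v = rp (map \<alpha> is @ tail 1) v) \<longleftrightarrow>
    (\<forall>v. B (shift l is + (e - 1) *\<^sub>R \<alpha> t) v = 0)"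
proof -
  have "rp (map (lift l) is @ tail e) v - rp (map \<alpha> is @ tail 1) v =
      - B (shift l is + (e - 1) *\<^sub>R \<alpha> t) v *\<^sub>R a" for v
    unfolding foldr_append o_apply rp_tail rp_lift [OF assms] by (simp add: algebra_simps)
  moreover have "a \<noteq> 0" using coa_a by force
  ultimately show ?thesis
    by (metis eq_iff_diff_eq_0 neg_equal_0_iff_equal scaleR_eq_0_iff)
qed

theorem canonical_form:
  assumes gs: "set gs \<subseteq> \<Phi>" "length gs = n + 2" "\<Phi> \<subseteq> group_closure (set gs)"
    and "is": "distinct is" "set is = {..n} - {t}"
    and prod: "\<And>v. rp gs v = rp (map \<alpha> is @ tail 1) v"
  obtains l e where "hw gs (map (lift l) is @ tail e)" "e = 1 \<or> e = - 1"
    "\<And>i. i \<in> set is \<Longrightarrow> l i \<in> \<int>"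
proof -
  define xs where "xs = map P gs"
  define ss where "ss = map \<alpha> is"
  have is_n: "set is \<subseteq> {..n}" using "is" by auto
  have "length is = n" using distinct_card [OF "is"(1)] "is"(2) by simp
  then have len: "length ss = n" "length xs = n + 2" using gs by (simp_all add: ss_def xs_def)
  have xs: "set xs \<subseteq> P ` \<Phi>" using gs by (auto simp: xs_def)
  have ss: "set ss \<subseteq> \<alpha> ` {..n}" using is_n by (auto simp: ss_def)
  have norm2_ss: "norm2 ss" using is_n by (auto simp: ss_def)
  have map_P_ss: "map P ss = ss" using is_n by (auto simp: ss_def)
  have rp_xs: "rp xs v = rp ss v" for v
  proof -
    have "rp xs (P v) = P (rp (map \<alpha> is @ tail 1) v)"
      using prod by (simp add: xs_def flip: P_rp)
    also have "\<dots> = rp (ss @ [\<alpha> t, \<alpha> t]) (P v)"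
      unfolding P_rp map_append map_P_ss [unfolded ss_def] by (simp add: tail_def ss_def)
    finally have "rp xs (P v) = rp ss (P v)" by simp
    then have "rp xs (P v + coa v *\<^sub>R a) = rp ss (P v + coa v *\<^sub>R a)" by simp
    then show ?thesis by (simp flip: P_decomp)
  qed
  \<comment> \<open>A second repetition leaves at most n distinct roots, too few to span the image
    of \<open>P\<close>, which has dimension n + 1.\<close>
  have rank: "\<not> hw xs (us @ r # vs @ [r', r'])"
    if dup: "r \<in> set us \<union> set vs" for us r vs r'
  proof
    assume hw: "hw xs (us @ r # vs @ [r', r'])"
    define X where "X = set us \<union> set vs \<union> {r'}"
    have "\<alpha> i \<in> span X" if "i \<le> n" for i
    proof -
      have "group_closure (set gs) \<subseteq> span (set gs)"
      proof
        fix v assume "v \<in> group_closure (set gs)"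
        then show "v \<in> span (set gs)"
          by induction (auto intro: span_base span_diff span_zero)
      qed
      then have "P (\<alpha> i) \<in> P ` span (set gs)" using \<alpha>_\<Phi> [OF that] gs(3) by blast
      then have "\<alpha> i \<in> span (set xs)"
        using that by (simp add: xs_def linear_span_image [OF linear_P])
      moreover have "set xs \<subseteq> span X"
        using hw_span [OF hw_sym [OF hw]] dup by (simp add: X_def insert_absorb Un_ac)
      ultimately show ?thesis by (metis span_mono span_span subsetD)
    qed
    moreover have inj: "inj_on \<alpha> {..n}"
      by (rule inj_onI) (metis co_\<alpha> atMost_iff zero_neq_one)
    moreover have "independent (\<alpha> ` {..n})"
    proof (rule independent_if_scalars_zero)
      fix f v assume *: "(\<Sum>x\<in>\<alpha> ` {..n}. f x *\<^sub>R x) = 0" "v \<in> \<alpha> ` {..n}"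
      then obtain i where i: "i \<le> n" "v = \<alpha> i" by auto
      have "(\<Sum>j\<in>{..n}. f (\<alpha> j) *\<^sub>R \<alpha> j) = 0" using * inj by (simp add: sum.reindex)
      then have "co i (\<Sum>j\<in>{..n}. f (\<alpha> j) *\<^sub>R \<alpha> j) = 0" by (simp del: co_linear_simps add: linear_0 [OF linear_co])
      then show "f v = 0" using i by (simp add: co_sum del: co_linear_simps)
    qed simp
    ultimately have "card (\<alpha> ` {..n}) \<le> card X"
      using independent_span_bound [of X "\<alpha> ` {..n}"] by (auto simp: X_def)
    also have "\<dots> \<le> length (us @ vs @ [r'])"
      using card_length [of "us @ vs @ [r']"] by (simp add: X_def Un_ac)
    also have "\<dots> < n + 1" using hw_length [OF hw] len by simp
    finally show False using inj by (simp add: card_image)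
  qed
  \<comment> \<open>\<open>ss\<close> is two letters shorter than \<open>xs\<close>, which leaves
    only the repeated pair in \<open>hw_simple_word\<close>.\<close>
  obtain us r vs where "hw xs (us @ r # r # vs)"
  proof -
    have "\<not> hw xs ss" using hw_length [of xs ss] len by auto
    then show ?thesis using hw_simple_word [of ss xs] ss xs len rp_xs that by auto
  qed
  moreover have norm2_r: "norm2 (us @ r # r # vs)"
    using hw_norm2 calculation norm2_R [OF xs] by blast
  moreover have "hw (us @ r # r # vs) ((us @ vs) @ [r, r])"
    using hw_pair_to_end [of vs r us] norm2_r by simp
  ultimately have hw1: "hw xs ((us @ vs) @ [r, r])" using hw_trans by blast
  have roots1: "set ((us @ vs) @ [r, r]) \<subseteq> P ` \<Phi>"
    using hw_closed [OF hw1 xs] s_R minus_R by blast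
  have rp1: "rp (us @ vs) v = rp ss v" for v
    using rp_xs [of v] hw_rp [OF hw1, of v] norm2_r by simp
  \<comment> \<open>The remaining entries have the length of \<open>ss\<close>, and a second
    repetition among them is excluded by \<open>rank\<close>.\<close>
  have hw2: "hw xs (ss @ [r, r])"
  proof -
    have "(\<exists>us' r' vs'. hw (us @ vs) (us' @ r' # r' # vs')) \<or> hw (us @ vs) ss"
      using hw_simple_word [of ss "us @ vs"] ss roots1 rp1 hw_length [OF hw1] len by auto
    moreover have False if "hw (us @ vs) (us' @ r' # r' # vs')" for us' r' vs'
      using hw_trans [OF hw1 hw_append_right [OF that, of "[r, r]"]] rank [of r' us' "r' # vs'" r]
      by simp
    ultimately have "hw (us @ vs) ss" by blast
    then show ?thesis using hw_append_right hw1 hw_trans by blast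
  qed
  have r: "r \<in> P ` \<Phi>" using roots1 by simp
  then have r_norm: "B r r = 2" using norm_\<Phi> by auto
  \<comment> \<open>Every entry other than \<open>r\<close> has coordinate 0 at \<open>t\<close>,
    yet the entries span a lattice containing \<alpha> t.\<close>
  have "co t r = 1 \<or> co t r = - 1"
  proof -
    have "P (\<alpha> t) \<in> group_closure (P ` set gs)"
      using gs(3) \<alpha>_\<Phi> [of t] by (intro group_closure_linear_image [OF linear_P]) auto
    then have "\<alpha> t \<in> group_closure (set xs)" by (simp add: xs_def)
    moreover have "set xs \<subseteq> group_closure (set (ss @ [r, r]))"
      using hw_group_closure [OF hw2 _ _ _ xs] s_R minus_R B_Ints by blast
    ultimately have *: "\<alpha> t \<in> group_closure (set (ss @ [r, r]))"
      using group_closure_mono_closed by blast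
    have "\<exists>z::int. co t (\<alpha> t) = of_int z * co t r"
    proof (rule group_closure_functional [OF linear_co *])
      fix x assume "x \<in> set (ss @ [r, r])"
      then consider "x = r" | i where "i \<in> set is" "x = \<alpha> i" by (auto simp: ss_def)
      then show "\<exists>z::int. co t x = of_int z * co t r"
      proof cases
        case 1
        then show ?thesis by (intro exI [of _ 1]) simp
      next
        case 2
        then show ?thesis using "is"(2) by (intro exI [of _ 0]) (auto simp: co_\<alpha>)
      qed
    qed
    moreover have "co t r \<in> \<int>" using r co_Ints by auto
    ultimately show ?thesis using int_unit_mult by (auto simp: co_\<alpha>)
  qed
  then obtain r' where r': "r' \<in> P ` \<Phi>" "co t r' = 1" "r' = r \<or> r' = - r"
    using r minus_R by fastforce
  have "hw (ss @ [r, r]) (ss @ [r', r'])"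
    using r' r_norm norm2_ss by (intro hw_append_left hw_flips) (auto simp: nth_Cons split: nat.splits)
  then have "hw xs (ss @ [\<alpha> t, \<alpha> t])"
    using hw2 hw_to_lowest_pair [OF r'(1,2) "is"(2)] hw_trans unfolding ss_def by blast
  then obtain zs where zs: "hw gs zs" "map P zs = ss @ [\<alpha> t, \<alpha> t]"
    using hw_lift [OF linear_P, of xs "ss @ [\<alpha> t, \<alpha> t]" gs] by (auto simp: xs_def)
  then obtain ds e1 e2 where ds: "zs = ds @ [e1, e2]" "map P ds = map \<alpha> is" "P e1 = \<alpha> t" "P e2 = \<alpha> t"
    by (auto simp: map_eq_append_conv map_eq_Cons_conv ss_def)
  then obtain l where l: "ds = map (lift l) is" using map_P_eq_map_\<alpha> "is"(1) is_n by blast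
  have zs_\<Phi>: "set zs \<subseteq> \<Phi>" using hw_closed [OF zs(1) gs(1)] s_\<Phi> minus_\<Phi> by blast
  define x where "x = coa e1"
  define e where "e = coa e2 - x"
  have e: "e1 = \<alpha> t + x *\<^sub>R a" "e2 = \<alpha> t + (x + e) *\<^sub>R a"
    using P_decomp [of e1] P_decomp [of e2] ds by (simp_all add: x_def e_def)
  have Ints: "x \<in> \<int>" "coa e2 \<in> \<int>" using zs_\<Phi> ds coa_Ints by (auto simp: x_def)
  have l_Ints: "l i \<in> \<int>" if "i \<in> set is" for i
  proof -
    have "i \<le> n" "lift l i \<in> \<Phi>" using zs_\<Phi> ds l that is_n by auto
    then show ?thesis using coa_Ints [of "lift l i"] by simp
  qed
  have "e = 1 \<or> e = - 1"
  proof -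
    \<comment> \<open>The coordinate along \<open>a\<close> in the basis formed by the entries
      before \<open>e2\<close> and \<open>a\<close>. It vanishes on these entries, is
      \<open>e\<close> on \<open>e2\<close> and 1 on \<open>a\<close>; as \<open>a\<close> lies in
      the lattice of the entries, \<open>e\<close> is a unit.\<close>
    define F where "F = (\<lambda>v. coa v - (\<Sum>i\<in>{..n} - {t}. co i v * l i) - x * co t v)"
    have F: "linear F"
      by (rule linearI) (auto simp: F_def algebra_simps sum.distrib sum_distrib_left)
    have "set gs \<subseteq> group_closure (set zs)"
      using hw_group_closure [OF zs(1) _ _ _ gs(1)] s_\<Phi> minus_\<Phi> B_Ints_\<Phi> by blast
    then have "\<Phi> \<subseteq> group_closure (set zs)"
      using gs(3) group_closure_mono_closed [of "set gs"] by fast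
    then have "a \<in> group_closure (set zs)"
      using a_lattice group_closure_mono_closed by blast
    then have "\<exists>z::int. F a = of_int z * e"
    proof (rule group_closure_functional [OF F])
      fix v assume "v \<in> set zs"
      then consider i where "i \<in> set is" "v = lift l i" | "v = e1" | "v = e2"
        using ds l by auto
      then show "\<exists>z::int. F v = of_int z * e"
      proof cases
        case 1
        have i: "i \<le> n" "i \<noteq> t" using 1 "is"(2) by auto
        have "(\<Sum>j\<in>{..n} - {t}. co j v * l j) = (\<Sum>j\<in>{..n} - {t}. if j = i then l j else 0)"
          using 1 i by (intro sum.cong) (auto simp: co_lift)
        then have "F v = 0" using 1 i by (simp add: F_def co_lift)
        then show ?thesis by (intro exI [of _ 0]) simp
      next
        case 2
        have "F v = 0" using 2 by (simp add: F_def e co_\<alpha>)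
        then show ?thesis by (intro exI [of _ 0]) simp
      next
        case 3
        have "F v = e" using 3 by (simp add: F_def e co_\<alpha>)
        then show ?thesis by (intro exI [of _ 1]) simp
      qed
    qed
    then obtain z :: int where "of_int z * e = 1" by (auto simp: F_def)
    then show ?thesis using int_unit_mult Ints by (auto simp: e_def)
  qed
  moreover have "hw gs (map (lift l) is @ tail e)"
  proof -
    obtain j where j: "x = of_int j" using Ints by (elim Ints_cases)
    \<comment> \<open>As \<open>e\<close> is a unit, \<open>x\<close> is a multiple of it, which
      places the pair on the string of \<open>hw_tail_shift\<close>.\<close>
    obtain k :: int where "x = k * e"
      using j \<open>e = 1 \<or> e = - 1\<close> that by (metis minus_mult_minus mult.right_neutral of_int_minus)
    then have "hw [e1, e2] (tail e)"
      using hw_tail_shift [of k e] e by (simp add: algebra_simps)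
    then show ?thesis using hw_append_left zs(1) ds l hw_trans by blast
  qed
  ultimately show ?thesis using that l_Ints by blast
qed

text \<open>Equality of the products makes \<open>shift l is\<close> minus twice \<alpha> t radical,
  with some coefficient y at \<delta>. The vertex 0 has mark 1, so y is the coordinate there and
  hence an integer; the coordinate at \<open>t\<close> says that y times \<open>m t\<close> is
  -2.\<close>

lemma canonical_shifts_negative:
  assumes "is": "distinct is" "set is = {..n} - {t}" and l: "\<And>i. i \<in> set is \<Longrightarrow> l i \<in> \<int>"
    and prod: "\<And>v. rp (map (lift l) is @ tail (- 1)) v = rp (map \<alpha> is @ tail 1) v"
  shows "m t \<le> 2"
proof -
  have is_n: "set is \<subseteq> {..n}" using "is" by auto
  have "B (shift l is - 2 *\<^sub>R \<alpha> t) v = 0" for v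
    using tail_eq_iff_shift [OF is_n, of l "- 1"] prod by simp
  then obtain x y where xy: "shift l is - 2 *\<^sub>R \<alpha> t = x *\<^sub>R a + y *\<^sub>R \<delta>" using radical_eq by blast
  have "co t (shift l is - 2 *\<^sub>R \<alpha> t) = y * m t" "co 0 (shift l is - 2 *\<^sub>R \<alpha> t) = y"
    unfolding xy by simp_all
  then have *: "y * m t = - 2" "y = co 0 (shift l is)"
    using co_shift_outside [OF is_n, of t] "is"(2) t_bounds by (auto simp: co_\<alpha>)
  have "co 0 (shift l is) \<in> \<int>" using co_shift_Ints [OF is_n] l by simp
  then obtain z where "y = of_int z" using * by (auto elim: Ints_cases)
  then have "real_of_int (z * int (m t)) = real_of_int (- 2)" using * by simp
  then have "z * int (m t) = - 2" by (simp only: of_int_eq_iff)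
  then have "int (m t) dvd 2" by (metis dvd_minus_iff dvd_triv_right)
  then show ?thesis using zdvd_imp_le by fastforce
qed

text \<open>The shift vectors differ by a radical vector without \<open>a\<close>-component and with
  coordinate 0 at \<open>t\<close>, hence by 0, as the mark at \<open>t\<close> is positive.
  Triangularity then compares the shifts letter by letter.\<close>

lemma canonical_shifts_unique:
  assumes "is": "distinct is" "set is = {..n} - {t}"
    and prod: "\<And>v. rp (map (lift l) is @ tail e) v = rp (map \<alpha> is @ tail 1) v"
      "\<And>v. rp (map (lift l') is @ tail e) v = rp (map \<alpha> is @ tail 1) v"
  shows "map (lift l) is = map (lift l') is"
proof -
  have is_n: "set is \<subseteq> {..n}" using "is" by auto
  have "B (shift (\<lambda>i. l i - l' i) is) v = 0" for v
    using tail_eq_iff_shift [OF is_n, of l e] tail_eq_iff_shift [OF is_n, of l' e] prod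
    by (simp add: shift_diff) (metis add_right_cancel)
  then obtain x y where xy: "shift (\<lambda>i. l i - l' i) is = x *\<^sub>R a + y *\<^sub>R \<delta>" using radical_eq by blast
  have "coa (shift (\<lambda>i. l i - l' i) is) = x" "co t (shift (\<lambda>i. l i - l' i) is) = y * m t"
    unfolding xy by simp_all
  then have "x = 0" "y = 0"
    using coa_shift [OF is_n] co_shift_outside [OF is_n, of t] "is"(2) m_pos [of t] by auto
  then have "shift (\<lambda>i. l i - l' i) is = 0" using xy by simp
  then have "l i - l' i = 0" if "i \<in> set is" for i using shift_eq_0 [OF is_n "is"(1) _ that] by blast
  then show ?thesis by (auto simp: lift_def)
qed

lemma canonical_shifts_exist:
  assumes "is": "distinct is" "set is = {..n} - {t}" and m: "m t \<le> 2"
  obtains l where "\<And>i. l i \<in> \<int>"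
    "\<And>v. rp (map (lift l) is @ tail (- 1)) v = rp (map \<alpha> is @ tail 1) v"
proof -
  have is_n: "set is \<subseteq> {..n}" using "is" by auto
  \<comment> \<open>The division is exact for the marks 1 and 2. Taking -q times \<delta> without
    its \<alpha> t term as the shift vector completes -2 \<alpha> t to the radical vector -q
    \<delta>.\<close>
  define q :: int where "q = 2 div int (m t)"
  have "m t = 1 \<or> m t = 2" using m m_pos [of t] by auto
  then have q: "real_of_int q * real (m t) = 2" by (auto simp: q_def)
  obtain l where l: "\<And>i. l i \<in> \<int>" "shift l is = (\<Sum>i\<in>set is. real_of_int (- q * int (m i)) *\<^sub>R \<alpha> i)"
    using shift_surj [OF is_n "is"(1), of "\<lambda>i. - q * int (m i)"] by auto
  have "\<delta> = real (m t) *\<^sub>R \<alpha> t + (\<Sum>i\<in>set is. real (m i) *\<^sub>R \<alpha> i)"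
    unfolding \<delta>_def "is"(2) by (subst sum.remove [of _ t]) auto
  then have "- real_of_int q *\<^sub>R \<delta> = - 2 *\<^sub>R \<alpha> t + shift l is"
    using q unfolding l(2) by (simp add: scaleR_right_distrib scaleR_sum_right sum_negf)
  then have "shift l is + (- 1 - 1) *\<^sub>R \<alpha> t = - real_of_int q *\<^sub>R \<delta>" by simp
  then have "B (shift l is + (- 1 - 1) *\<^sub>R \<alpha> t) v = 0" for v by (simp only:) simp
  then have "\<forall>v. rp (map (lift l) is @ tail (- 1)) v = rp (map \<alpha> is @ tail 1) v"
    using tail_eq_iff_shift [OF is_n] by blast
  with l(1) that show ?thesis by blast
qed

text \<open>The lifted entries have coordinate 0 at \<open>t\<close>, which the later factors do not
  change, and the first entry of the tail has \<open>coa\<close> equal to 0. These two functionals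
  thus read off the last entry alone.\<close>

lemma tensor_canonical:
  assumes "set is = {..n} - {t}"
  shows "tensor coa (co t) (map (lift l) is @ tail e) = e"
proof -
  have "co t (rp (rev (tail e)) v) = co t v" for v
    by (simp add: tail_def reflection_def co_\<alpha>)
  moreover have "tensor coa g (map (lift l) is) = 0"
    if "g = co t" "set is \<subseteq> {..n} - {t}" for g "is"
    using that(2)
  proof (induction "is")
    case (Cons i "is")
    have "co t (rp (rev (map (lift l) is)) v) = co t v" for v
    proof -
      have "co t (rp (map (lift l) js) v) = co t v" if "set js \<subseteq> {..n} - {t}" for js
        using that by (induction js) (auto simp: reflection_def co_lift)
      from this [of "rev is"] show ?thesis using Cons.prems by (simp add: rev_map)
    qed
    then show ?case using Cons that by (simp add: co_lift)
  qed simp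
  moreover have "tensor coa (co t) (tail e) = e"
    by (simp add: tail_def co_\<alpha>)
  ultimately show ?thesis
    using assms by (simp add: tensor_append)
qed

end

section \<open>Root strings and generation\<close>

lemma Ints_pos_ge_1: "x \<in> \<int> \<Longrightarrow> x > 0 \<Longrightarrow> x \<ge> (1::real)"
  by (auto elim!: Ints_cases)

lemma sum_pos_term:
  fixes f :: "nat \<Rightarrow> real"
  assumes "(\<Sum>i\<le>n. f i) > 0"
  shows "\<exists>i\<le>n. f i > 0"
proof (rule ccontr)
  assume "\<not> ?thesis"
  then have "(\<Sum>i\<le>n. f i) \<le> 0" by (intro sum_nonpos) (auto simp: not_less)
  with assms show False by simp
qed

text \<open>
  The booleans encode adjacency in an affine diagram with five vertices, and \<open>m4\<close> is its largest mark.
\<close>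

lemma five_vertex_labels:
  fixes m0 m1 m2 m3 m4 :: int
  assumes "m0 = 1" "m1 \<ge> 1" "m2 \<ge> 1" "m3 \<ge> 1" "m1 \<le> m4" "m2 \<le> m4" "m3 \<le> m4"
    and "2 * m0 = (if p01 then m1 else 0) + (if p02 then m2 else 0) + (if p03 then m3 else 0) + (if p04 then m4 else 0)"
    and "2 * m1 = (if p01 then m0 else 0) + (if p12 then m2 else 0) + (if p13 then m3 else 0) + (if p14 then m4 else 0)"
    and "2 * m2 = (if p02 then m0 else 0) + (if p12 then m1 else 0) + (if p23 then m3 else 0) + (if p24 then m4 else 0)"
    and "2 * m3 = (if p03 then m0 else 0) + (if p13 then m1 else 0) + (if p23 then m2 else 0) + (if p34 then m4 else 0)"
    and "2 * m4 = (if p04 then m0 else 0) + (if p14 then m1 else 0) + (if p24 then m2 else 0) + (if p34 then m3 else 0)"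
  shows "m4 \<le> 2"
  using assms by (smt (z3))

context elliptic_basis
begin

text \<open>A positive product would give \<open>s (\<alpha> i) (\<alpha> j)\<close> coordinates of
  both signs. Product -2 would make the sum of the two roots radical, but a radical vector with a
  nonzero coordinate has all n + 1 \<ge> 3 coordinates nonzero.\<close>

lemma B_\<alpha>_cases:
  assumes "i \<le> n" "j \<le> n" "i \<noteq> j"
  shows "B (\<alpha> i) (\<alpha> j) = 0 \<or> B (\<alpha> i) (\<alpha> j) = - 1"
proof -
  define b where "b = B (\<alpha> i) (\<alpha> j)"
  obtain z where z: "b = of_int z"
    using B_Ints_\<Phi> [OF \<alpha>_\<Phi> \<alpha>_\<Phi>, of i j] assms by (auto simp: b_def elim: Ints_cases)
  have "s (\<alpha> i) (\<alpha> j) \<in> \<Phi>" using assms s_\<Phi> \<alpha>_\<Phi> by simp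
  moreover have "co j (s (\<alpha> i) (\<alpha> j)) > 0" "co i (s (\<alpha> i) (\<alpha> j)) = - b"
    using assms by (simp_all add: reflection_def co_\<alpha> b_def)
  ultimately have "b \<le> 0" using co_same_sign [of _ j i] assms by fastforce
  moreover have "b \<noteq> - 2"
  proof
    assume "b = - 2"
    then have "B (\<alpha> j + \<alpha> i) w = 0" for w
      using assms by (intro B_eq_neg_2_radical) (auto simp: b_def)
    then obtain x y where xy: "\<alpha> j + \<alpha> i = x *\<^sub>R a + y *\<^sub>R \<delta>" using radical_eq by blast
    have co: "co k (\<alpha> j + \<alpha> i) = y * m k" if "k \<le> n" for k
      unfolding xy using that by simp
    obtain k where k: "k \<le> n" "k \<noteq> i" "k \<noteq> j"
    proof -
      have "card ({..n} - {i, j}) > 0" using assms n_ge_2 by (simp add: card_Diff_insert)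
      then have "{..n} - {i, j} \<noteq> {}" by (metis card.empty less_numeral_extra(3))
      then show ?thesis using that by blast
    qed
    have "y = 0" using co [of k] k assms m_pos [of k] by (auto simp: co_\<alpha>)
    with co [of i] assms show False by (simp add: co_\<alpha>)
  qed
  moreover have "b \<ge> - 2" using B_roots_bounds [of "\<alpha> i" "\<alpha> j"] assms by (simp add: b_def)
  ultimately have "z \<le> 0" "z \<noteq> - 2" "z \<ge> - 2" using z by auto
  then have "z = 0 \<or> z = - 1" by auto
  then show ?thesis using z by (auto simp: b_def)
qed

text \<open>If no edge leaves I, the part of \<delta> supported on I is orthogonal to everything,
  hence radical. Its coordinates are then proportional to the marks, so none of them can
  vanish.\<close>

lemma connected_diagram:
  assumes "I \<subseteq> {..n}" "I \<noteq> {}" "\<And>i j. i \<in> I \<Longrightarrow> j \<in> {..n} - I \<Longrightarrow> B (\<alpha> i) (\<alpha> j) = 0"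
  shows "I = {..n}"
proof (rule ccontr)
  assume "I \<noteq> {..n}"
  then obtain k where k: "k \<le> n" "k \<notin> I" using assms by blast
  obtain i where i: "i \<in> I" "i \<le> n" using assms by blast
  define v where "v = (\<Sum>i\<in>I. real (m i) *\<^sub>R \<alpha> i)"
  define v' where "v' = (\<Sum>i\<in>{..n} - I. real (m i) *\<^sub>R \<alpha> i)"
  have \<delta>: "\<delta> = v + v'"
    unfolding \<delta>_def v_def v'_def using assms(1) by (simp add: sum.subset_diff [of I] add.commute)
  have "B v (\<alpha> j) = 0" if "j \<le> n" for j
  proof (cases "j \<in> I")
    case True
    then have "B (\<alpha> j) v' = 0"
      using assms(3) [OF True] unfolding v'_def B_sum_right by (intro sum.neutral) auto
    then have "B v' (\<alpha> j) = 0" by (simp add: sym_B)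
    with \<delta> \<delta>_radical [of "\<alpha> j"] show ?thesis by simp
  next
    case False
    then show ?thesis
      using assms(3) that by (auto simp: v_def B_sum_left intro!: sum.neutral)
  qed
  then have "B v w = 0" for w by (subst B_expansion) simp
  then obtain x y where xy: "v = x *\<^sub>R a + y *\<^sub>R \<delta>" using radical_eq by blast
  have co: "co j v = y * m j" if "j \<le> n" for j unfolding xy using that by simp
  have "co i v = m i" "co k v = 0"
    using i k assms(1) by (simp_all add: v_def co_sum del: co_linear_simps)
  with co [of i] co [of k] i k m_pos [of i] m_pos [of k] show False by simp
qed

text \<open>
  The set \<open>D\<close> is used with \<open>D = \<Phi>\<close> and with the roots whose reflections lie in a given subgroup.
\<close>

context
  fixes D :: "'v set" and d :: "nat \<Rightarrow> 'v"
  assumes norm_D: "r \<in> D \<Longrightarrow> B r r = 2"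
    and s_D: "r \<in> D \<Longrightarrow> q \<in> D \<Longrightarrow> s r q \<in> D"
    and d_D: "i \<le> n \<Longrightarrow> d i \<in> D"
    and B_d: "i \<le> n \<Longrightarrow> B (d i) v = B (\<alpha> i) v"
begin

lemma minus_D: "r \<in> D \<Longrightarrow> - r \<in> D"
  using s_D [of r r] s_self [of r] norm_D by simp

text \<open>On \<open>d i + r\<close>, the reflection in \<open>d j + r'\<close> followed by that in
  \<open>d j\<close> is the translation by \<open>r'\<close>.\<close>

lemma string_add_adjacent:
  assumes "i \<le> n" "j \<le> n" "B (\<alpha> i) (\<alpha> j) = - 1" "\<And>w. B r w = 0" "\<And>w. B r' w = 0"
    and "d i + r \<in> D" "d j + r' \<in> D"
  shows "d i + (r + r') \<in> D"
proof -
  have rr: "B w r = 0" "B w r' = 0" for w using assms(4,5) sym_B by metis+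
  have Bd: "B (d j) (d i) = - 1" "B (d j) (d j) = 2"
    using assms B_d sym_B norm_D d_D by metis+
  have "s (d j + r') (d i + r) \<in> D" using assms s_D by blast
  moreover have "s (d j + r') (d i + r) = d i + r + (d j + r')"
    using assms(4,5) rr Bd by (simp add: reflection_def)
  ultimately have "s (d j) (d i + r + (d j + r')) \<in> D" using assms s_D d_D by metis
  moreover have "s (d j) (d i + r + (d j + r')) = d i + (r + r')"
    using rr Bd by (simp add: reflection_def)
  ultimately show ?thesis by simp
qed

text \<open>The indices whose string contains the shift \<open>r\<close> are closed under adjacency
  in a connected diagram.\<close>

lemma string_transfer:
  assumes "\<And>w. B r w = 0" "i \<le> n" "d i + r \<in> D" "j \<le> n"
  shows "d j + r \<in> D"
proof -
  define I where "I = {i. i \<le> n \<and> d i + r \<in> D}"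
  have "I = {..n}"
  proof (rule connected_diagram)
    fix i j assume ij: "i \<in> I" "j \<in> {..n} - I"
    have "d j + (0 + r) \<in> D" if "B (\<alpha> i) (\<alpha> j) = - 1"
      using ij that assms(1) d_D [of j]
      by (intro string_add_adjacent [of j i]) (auto simp: I_def sym_B)
    then show "B (\<alpha> i) (\<alpha> j) = 0"
      using ij B_\<alpha>_cases [of i j] by (cases "i = j") (auto simp: I_def)
  qed (use assms in \<open>auto simp: I_def\<close>)
  then show ?thesis using assms by (auto simp: I_def)
qed

lemma string_minus:
  assumes "\<And>w. B r w = 0" "i \<le> n" "d i + r \<in> D"
  shows "d i - r \<in> D"
proof -
  have "B w r = 0" for w using assms(1) sym_B by metis
  then have "s (d i) (d i + r) = r - d i"
    using norm_D [OF d_D] assms(2) by (simp add: reflection_def scaleR_2)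
  moreover have "s (d i) (d i + r) \<in> D" using assms s_D d_D by blast
  ultimately show ?thesis using minus_D by fastforce
qed

lemma string_add:
  assumes "\<And>w. B r w = 0" "\<And>w. B r' w = 0" "i \<le> n" "d i + r \<in> D" "d i + r' \<in> D"
  shows "d i + (r + r') \<in> D"
proof -
  have "{i} \<noteq> {..n}" using n_ge_2 by (metis atMost_iff le_numeral_extra(2) le_trans
      one_le_numeral order_refl singletonD zero_le zero_neq_one)
  then obtain j where "j \<in> {..n} - {i}" "B (\<alpha> i) (\<alpha> j) \<noteq> 0"
    using connected_diagram [of "{i}"] assms(3) by auto
  then have j: "j \<le> n" "B (\<alpha> i) (\<alpha> j) = - 1" using B_\<alpha>_cases [of i j] assms(3) by auto
  then show ?thesis
    using string_add_adjacent [of i j r r'] string_transfer [of r' i j] assms by blast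
qed

lemma string_multiple:
  assumes "\<And>w. B r w = 0" "i \<le> n" "d i + r \<in> D" "x \<in> \<int>" "j \<le> n"
  shows "d j + x *\<^sub>R r \<in> D"
proof -
  have nat: "d i + real k *\<^sub>R r \<in> D" for k
  proof (induction k)
    case (Suc k)
    have "d i + (real k *\<^sub>R r + r) \<in> D" using assms Suc by (intro string_add) auto
    then show ?case by (simp add: algebra_simps)
  qed (use assms d_D in simp)
  obtain z where z: "x = of_int z" using assms(4) by (elim Ints_cases)
  have "d i + x *\<^sub>R r \<in> D"
  proof (cases "z \<ge> 0")
    case True
    then show ?thesis using nat [of "nat z"] z by simp
  next
    case False
    then have "x = - real (nat (- z))" using z by simp
    then show ?thesis using string_minus [OF _ assms(2) nat [of "nat (- z)"]] assms(1) by simp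
  qed
  then show ?thesis using string_transfer [of "x *\<^sub>R r" i j] assms by simp
qed

end

text \<open>Descent on the height through reflections in lifted simple roots, ending at roots that
  lie over a simple root. The shifts \<open>l\<close> can be chosen freely because the height
  ignores \<open>a\<close>.\<close>

lemma roots_induct [consumes 1, case_names lift base minus reflect]:
  assumes "r \<in> \<Phi>" and lift: "\<And>i. i \<le> n \<Longrightarrow> lift l i \<in> \<Phi>"
    and base: "\<And>r i. r \<in> \<Phi> \<Longrightarrow> i \<le> n \<Longrightarrow> P r = \<alpha> i \<Longrightarrow> Q r"
    and minus: "\<And>r. r \<in> \<Phi> \<Longrightarrow> Q r \<Longrightarrow> Q (- r)"
    and reflect: "\<And>r i. r \<in> \<Phi> \<Longrightarrow> i \<le> n \<Longrightarrow> Q r \<Longrightarrow> Q (s (lift l i) r)"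
  shows "Q r"
proof -
  have pos: "Q r" if "r \<in> \<Phi>" "height r > 0" for r
    using that
  proof (induction "nat \<lfloor>height r\<rfloor>" arbitrary: r rule: less_induct)
    case less
    obtain k where k: "\<And>j. j \<le> n \<Longrightarrow> co j r = real (k j)"
      using positive_coordinates less.prems by blast
    obtain i where i: "i \<le> n" "B r (\<alpha> i) > 0"
    proof -
      have "B r r = (\<Sum>i\<le>n. co i r * B r (\<alpha> i))" by (rule B_expansion)
      then have "(\<Sum>i\<le>n. co i r * B r (\<alpha> i)) > 0" using norm_\<Phi> less.prems by simp
      from sum_pos_term [OF this] obtain i where "i \<le> n" "co i r * B r (\<alpha> i) > 0" by blast
      then show ?thesis using k that by (auto simp: zero_less_mult_iff)
    qed
    define r' where "r' = s (lift l i) r"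
    have r': "r' \<in> \<Phi>" using lift i less.prems s_\<Phi> by (simp add: r'_def)
    have invol: "r = s (lift l i) r'" using i by (simp add: r'_def)
    have height_lift: "height (lift l i) = 1" using i by (simp add: height_def co_lift)
    have b: "B (\<alpha> i) r \<ge> 1"
      using Ints_pos_ge_1 [OF B_Ints_\<Phi> [OF \<alpha>_\<Phi> [OF i(1)] less.prems(1)]] i(2)
      by (simp add: sym_B)
    have height: "height r' = height r - B (\<alpha> i) r"
      using height_lift by (simp add: r'_def reflection_def)
    show ?case
    proof (cases "height r' > 0")
      case True
      then have "nat \<lfloor>height r'\<rfloor> < nat \<lfloor>height r\<rfloor>" using height b by linarith
      then have "Q r'" using less.hyps r' True by blast
      then show ?thesis using invol reflect r' i by metis
    next
      case False
      have "height (s (\<alpha> i) r) = height r'"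
        using i height by (simp add: reflection_def)
      then have "height (s (\<alpha> i) r) < 0" using False height_nonzero [OF r'] by linarith
      then have "P r = \<alpha> i" using simple_reflection_\<Phi> i less.prems by blast
      then show ?thesis using base less.prems i by blast
    qed
  qed
  show ?thesis
  proof (cases "height r > 0")
    case True
    then show ?thesis using pos assms(1) by blast
  next
    case False
    then have "height (- r) > 0" using height_nonzero [OF assms(1)] by simp
    then have "Q (- r)" using pos minus_\<Phi> assms(1) by blast
    then show ?thesis using minus [of "- r"] minus_\<Phi> assms(1) by simp
  qed
qed

lemma lift_0 [simp]: "lift (\<lambda>_. 0) = \<alpha>"
  by (auto simp: lift_def)

text \<open>By the string rules, the multiples of \<open>a\<close> that may be added to \<alpha> 0
  form a group containing \<open>coa r\<close> for every root \<open>r\<close>. It contains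
  \<open>coa a = 1\<close>, since \<open>a\<close> lies in the root lattice.\<close>

lemma \<alpha>_add_a: "\<alpha> 0 + a \<in> \<Phi>"
proof -
  note string_rules = norm_\<Phi> s_\<Phi> \<alpha>_\<Phi> refl
  have "\<alpha> 0 + coa r *\<^sub>R a \<in> \<Phi>" if "r \<in> \<Phi>" for r
    using that
  proof (induction rule: roots_induct [where l = "\<lambda>_. 0"])
    case (lift i)
    then show ?case by (simp add: \<alpha>_\<Phi>)
  next
    case (base r i)
    then have "\<alpha> i + coa r *\<^sub>R a \<in> \<Phi>" using P_decomp [of r] by simp
    then show ?case using string_transfer [of \<Phi> \<alpha> "coa r *\<^sub>R a" i 0] string_rules base by auto
  next
    case (minus r)
    then show ?case using string_minus [of \<Phi> \<alpha> "coa r *\<^sub>R a" 0] string_rules by auto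
  next
    case (reflect r i)
    then show ?case by (simp add: reflection_def)
  qed
  moreover have "\<alpha> 0 + coa v *\<^sub>R a \<in> \<Phi>" if "v \<in> group_closure \<Phi>" for v
    using that
  proof induction
    case (base v)
    then show ?case using calculation \<alpha>_\<Phi> by auto
  next
    case (diff u v)
    have "\<alpha> 0 - coa v *\<^sub>R a \<in> \<Phi>"
      using diff string_minus [of \<Phi> \<alpha> "coa v *\<^sub>R a" 0] string_rules by auto
    then have "\<alpha> 0 + (coa u *\<^sub>R a + - coa v *\<^sub>R a) \<in> \<Phi>"
      using diff string_add [of \<Phi> \<alpha> "coa u *\<^sub>R a" "- coa v *\<^sub>R a" 0] string_rules by auto
    then show ?case by (simp add: algebra_simps)
  qed
  ultimately show ?thesis using a_lattice by fastforce
qed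

lemma lift_\<Phi>: "i \<le> n \<Longrightarrow> l i \<in> \<int> \<Longrightarrow> lift l i \<in> \<Phi>"
  unfolding lift_def
  using string_multiple [of \<Phi> \<alpha> a 0 "l i" i] norm_\<Phi> s_\<Phi> \<alpha>_\<Phi> \<alpha>_add_a by auto

lemma tail_\<Phi>: "e \<in> \<int> \<Longrightarrow> set (tail e) \<subseteq> \<Phi>"
  using lift_\<Phi> [of t "\<lambda>_. e"] \<alpha>_\<Phi> [of t] by (auto simp: tail_def lift_def)

text \<open>The vectors of norm 2 whose reflections lie in the generated group are closed under
  reflection and contain two neighbours of the string through \<alpha> t in direction
  \<open>a\<close>. The string rules spread this to all integral lifts of simple roots, and
  \<open>roots_induct\<close> to all roots.\<close>

lemma generate_canonical:
  assumes "is": "set is = {..n} - {t}" and l: "\<And>i. l i \<in> \<int>" and e: "e = 1 \<or> e = - 1"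
  shows "generate perm_group (set (map s (map (lift l) is @ tail e))) = generate perm_group (s ` \<Phi>)"
proof -
  define zs where "zs = map (lift l) is @ tail e"
  define G where "G = generate perm_group (set (map s zs))"
  have "e \<in> \<int>" using e by auto
  then have zs_\<Phi>: "set zs \<subseteq> \<Phi>" using tail_\<Phi> lift_\<Phi> l "is" by (auto simp: zs_def)
  \<comment> \<open>The tail contains \<alpha> t unshifted, so its lift gets shift 0.\<close>
  define l' where "l' = l(t := 0)"
  define D where "D = {v. B v v = 2 \<and> s v \<in> G}"
  have D_zs: "z \<in> D" if "z \<in> set zs" for z
    using that zs_\<Phi> norm_\<Phi> by (auto simp: D_def G_def intro: generate.incl)
  have norm_D: "B r r = 2" if "r \<in> D" for r using that by (simp add: D_def)
  have s_D: "s r q \<in> D" if "r \<in> D" "q \<in> D" for r q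
    using that generate_s_conj [of q r] by (simp add: D_def G_def)
  have d_D: "lift l' i \<in> D" if "i \<le> n" for i
  proof (cases "i = t")
    case True
    then show ?thesis by (intro D_zs) (simp add: zs_def tail_def lift_def l'_def)
  next
    case False
    then have "lift l' i = lift l i" by (simp add: lift_def l'_def)
    then show ?thesis using that False "is" by (intro D_zs) (simp add: zs_def)
  qed
  have "\<alpha> t + e *\<^sub>R a \<in> D" by (intro D_zs) (simp add: zs_def tail_def)
  then have "lift l' t + e *\<^sub>R a \<in> D" by (simp add: lift_def l'_def)
  then have string: "lift l' i + (x * e) *\<^sub>R a \<in> D" if "i \<le> n" "x \<in> \<int>" for i x
    using string_multiple [of D "lift l'" "e *\<^sub>R a" t x i] norm_D s_D d_D that by auto
  have l'_Ints: "l' i \<in> \<int>" for i using l by (simp add: l'_def)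
  have "r \<in> D" if "r \<in> \<Phi>" for r
    using that
  proof (induction rule: roots_induct [where l = l'])
    case (lift i)
    then show ?case using lift_\<Phi> l'_Ints by blast
  next
    case (base r i)
    define x where "x = (coa r - l' i) * e"
    have "x \<in> \<int>" using base coa_Ints l'_Ints \<open>e \<in> \<int>\<close> by (simp add: x_def)
    then have "lift l' i + (x * e) *\<^sub>R a \<in> D" using string base by blast
    moreover have "x * e = coa r - l' i" using e by (auto simp: x_def)
    ultimately have "lift l' i + (coa r - l' i) *\<^sub>R a \<in> D" by simp
    then show ?case using base P_decomp [of r] by (simp add: lift_def algebra_simps)
  next
    case (minus r)
    then show ?case by (simp add: D_def)
  next
    case (reflect r i)
    then show ?case using s_D d_D by simp
  qed
  then have "s ` \<Phi> \<subseteq> G" by (auto simp: D_def)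
  moreover have "subgroup G perm_group"
    unfolding G_def using zs_\<Phi> norm_\<Phi> by (intro perm.generate_is_subgroup) auto
  ultimately have "generate perm_group (s ` \<Phi>) \<subseteq> G"
    by (intro perm.generate_subgroup_incl)
  moreover have "G \<subseteq> generate perm_group (s ` \<Phi>)"
    unfolding G_def using zs_\<Phi> by (intro perm.mono_generate) auto
  ultimately show ?thesis by (simp add: G_def zs_def)
qed

text \<open>The generated group moves every lattice vector by an element of the integral span of
  \<open>rs\<close>. Applied to \<open>s r\<close> and a root having product 1 or -1 with
  \<open>r\<close>, this puts \<open>r\<close> itself into that span.\<close>

lemma generate_imp_lattice:
  assumes "set rs \<subseteq> \<Phi>" "generate perm_group (s ` \<Phi>) = generate perm_group (set (map s rs))"
  shows "\<Phi> \<subseteq> group_closure (set rs)"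
proof
  have integral: "B r v \<in> \<int>" if "r \<in> \<Phi>" "v \<in> group_closure \<Phi>" for r v
    using that(2) by induction (use that(1) B_Ints_\<Phi> in auto)
  have sub: "group_closure (set rs) \<subseteq> group_closure \<Phi>"
    using assms(1) by (intro group_closure_mono_closed) (auto intro: group_closure.base)
  have "s r v - v \<in> group_closure (set rs)" if "r \<in> set rs" "v \<in> group_closure \<Phi>" for r v
    using that group_closure_scaleR [of r "set rs" "B r v"] integral [of r v] assms(1)
    by (auto simp: reflection_def intro: group_closure.base)
  then have gen: "g v - v \<in> group_closure (set rs)" "(inv\<^bsub>perm_group\<^esub> g) v - v \<in> group_closure (set rs)"
    if "g \<in> set (map s rs)" "v \<in> group_closure \<Phi>" for g v
    using that perm_inv_s assms(1) norm_\<Phi> by auto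
  have move: "g v - v \<in> group_closure (set rs)"
    if "g \<in> generate perm_group (set (map s rs))" "v \<in> group_closure \<Phi>" for g v
    using that
  proof (induction arbitrary: v)
    case one
    then show ?case by (simp add: perm_one)
  next
    case (incl g)
    then show ?case using gen(1) by blast
  next
    case (inv g)
    then show ?case using gen(2) by blast
  next
    case (eng g h)
    have carrier: "g \<in> carrier perm_group" "h \<in> carrier perm_group"
      using eng.hyps perm.generate_in_carrier [of "set (map s rs)"] assms(1) norm_\<Phi>
      by (metis (no_types, lifting) image_subset_iff list.set_map s_in_perm subsetD)+
    have hv: "h v - v \<in> group_closure (set rs)" using eng by blast
    then have "h v - v + v \<in> group_closure \<Phi>"
      using sub eng.prems by (intro group_closure_add) auto
    then have "g (h v) - h v \<in> group_closure (set rs)" using eng by simp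
    with hv have "(g (h v) - h v) + (h v - v) \<in> group_closure (set rs)"
      by (rule group_closure_add [rotated])
    then show ?case using carrier by (simp add: perm_mult)
  qed
  fix r assume r: "r \<in> \<Phi>"
  then obtain q where q: "q \<in> \<Phi>" "B r q = 1 \<or> B r q = - 1" using unit_pairing by blast
  have "s r \<in> generate perm_group (set (map s rs))"
    using r assms(2) by (metis generate.incl imageI)
  then have "s r q - q \<in> group_closure (set rs)"
    using move q by (auto intro: group_closure.base)
  then have "- (B r q *\<^sub>R r) \<in> group_closure (set rs)" by (simp add: reflection_def)
  then show "r \<in> group_closure (set rs)" using q by auto
qed

section \<open>The largest mark\<close>

text \<open>\<open>r + \<delta>\<close> has nonnegative coordinates, is 0 at the vertex 0 and has
  product 2 with \<open>r\<close>, so some \<alpha> i with i \<ge> 1 has positive product with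
  \<open>r\<close>. Product 1 allows \<alpha> i to be subtracted, which lowers the height; product 2
  makes \<open>r - \<alpha> i\<close> radical, and its coordinate -1 at 0 identifies it as
  \<open>- \<delta>\<close>.\<close>

lemma exists_null_lowered_root:
  assumes "r \<in> \<Phi>" "coa r = 0" "co 0 r = - 1" "\<And>i. i \<in> {1..n} \<Longrightarrow> co i r + m i \<ge> 0"
  shows "\<exists>i\<in>{1..n}. \<alpha> i - \<delta> \<in> \<Phi>"
  using assms
proof (induction "nat \<lfloor>height r + height \<delta>\<rfloor>" arbitrary: r rule: less_induct)
  case less
  note norm = norm_\<Phi> [OF less.prems(1)]
  define k where "k = (\<lambda>i. co i (r + \<delta>))"
  have k0: "k 0 = 0" using less.prems by (simp add: k_def)
  have k_pos: "k i \<ge> 0" if "i \<le> n" for i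
    using less.prems(4) [of i] that k0 by (cases "i = 0") (auto simp: k_def)
  have "B r (r + \<delta>) = (\<Sum>i\<le>n. k i * B r (\<alpha> i))"
    unfolding k_def by (rule B_expansion)
  then have "(\<Sum>i\<le>n. k i * B r (\<alpha> i)) > 0" using norm by simp
  from sum_pos_term [OF this] obtain i where i: "i \<le> n" "k i * B r (\<alpha> i) > 0" by blast
  then have pos: "k i > 0" "B r (\<alpha> i) > 0" using k_pos [of i] by (auto simp: zero_less_mult_iff)
  then have i1: "i \<in> {1..n}" using i k0 by (cases "i = 0") auto
  obtain b where b: "B r (\<alpha> i) = of_int b"
    using B_Ints_\<Phi> [OF less.prems(1) \<alpha>_\<Phi> [OF i(1)]] by (elim Ints_cases)
  have "B r (\<alpha> i) \<le> 2" using B_roots_bounds norm i by simp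
  then have "b = 1 \<or> b = 2" using b pos by auto
  then show ?case
  proof
    assume "b = 1"
    define r' where "r' = s (\<alpha> i) r"
    have r': "r' = r - \<alpha> i" using b \<open>b = 1\<close> by (simp add: r'_def reflection_def sym_B)
    have co: "co j r' = co j r - (if j = i then 1 else 0)" if "j \<le> n" for j
      using i that by (simp add: r' co_\<alpha>)
    have "k i \<in> \<int>" using co_Ints [OF less.prems(1)] i by (simp add: k_def)
    then have "k i \<ge> 1" using pos by (auto elim!: Ints_cases)
    then have "co i r' + m i \<ge> 0" using i co by (simp add: k_def)
    then have nonneg: "co j r' + m j \<ge> 0" if "j \<in> {1..n}" for j
      using co [of j] less.prems(4) that by (cases "j = i") auto
    have "height (r + \<delta>) \<ge> 1"
      using member_le_sum [of i "{..n}" k] i k_pos \<open>k i \<ge> 1\<close> by (simp add: height_def k_def)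
    then have "nat \<lfloor>height r' + height \<delta>\<rfloor> < nat \<lfloor>height r + height \<delta>\<rfloor>"
      using i by (simp add: r') linarith
    then show ?thesis
      using less.hyps [of r'] less.prems nonneg co [of 0] i1 i s_\<Phi> [OF \<alpha>_\<Phi>]
      by (auto simp: r'_def) (simp add: r'_def [symmetric] r')
  next
    assume "b = 2"
    then have "B (r - \<alpha> i) w = 0" for w
      using b i norm by (intro B_eq_2_radical) (auto simp: sym_B)
    then obtain x y where xy: "r - \<alpha> i = x *\<^sub>R a + y *\<^sub>R \<delta>" using radical_eq by blast
    have "coa (r - \<alpha> i) = x" "co 0 (r - \<alpha> i) = y" unfolding xy by simp_all
    then have "x = 0" "y = - 1" using less.prems i i1 by (auto simp: co_\<alpha>)
    then have "r = \<alpha> i - \<delta>" using xy by (simp add: algebra_simps)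
    then show ?thesis using less.prems i1 by auto
  qed
qed

lemma \<alpha>_minus_\<delta>: "\<alpha> 0 + (- \<delta>) \<in> \<Phi>"
proof -
  have "\<exists>i\<in>{1..n}. \<alpha> i - \<delta> \<in> \<Phi>"
    using minus_\<Phi> [OF \<alpha>_\<Phi> [of 0]] m_pos by (intro exists_null_lowered_root [of "- \<alpha> 0"]) (auto simp: co_\<alpha>)
  then obtain i where "i \<le> n" "\<alpha> i + (- \<delta>) \<in> \<Phi>" by auto
  then show ?thesis
    using string_transfer [of \<Phi> \<alpha> "- \<delta>" i 0] norm_\<Phi> s_\<Phi> \<alpha>_\<Phi> by auto
qed

lemma shift_\<delta>_\<Phi>:
  assumes "r \<in> \<Phi>" "x \<in> \<int>"
  shows "r + x *\<^sub>R \<delta> \<in> \<Phi>"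
proof -
  have "\<forall>x\<in>\<int>. r + x *\<^sub>R \<delta> \<in> \<Phi>"
    using assms(1)
  proof (induction rule: roots_induct [where l = "\<lambda>_. 0"])
    case (lift i)
    then show ?case by (simp add: \<alpha>_\<Phi>)
  next
    case (base r i)
    show ?case
    proof
      fix x :: real assume x: "x \<in> \<int>"
      have "\<alpha> i + coa r *\<^sub>R a \<in> \<Phi>" using base P_decomp [of r] by simp
      moreover have "\<alpha> i + (- x) *\<^sub>R (- \<delta>) \<in> \<Phi>"
        using string_multiple [of \<Phi> \<alpha> "- \<delta>" 0 "- x" i] norm_\<Phi> s_\<Phi> \<alpha>_\<Phi> \<alpha>_minus_\<delta> x base by auto
      ultimately have "\<alpha> i + (coa r *\<^sub>R a + x *\<^sub>R \<delta>) \<in> \<Phi>"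
        using string_add [of \<Phi> \<alpha> "coa r *\<^sub>R a" "x *\<^sub>R \<delta>" i] norm_\<Phi> s_\<Phi> \<alpha>_\<Phi> base by auto
      moreover have "r + x *\<^sub>R \<delta> = \<alpha> i + (coa r *\<^sub>R a + x *\<^sub>R \<delta>)"
        using base P_decomp [of r] by (metis add.assoc)
      ultimately show "r + x *\<^sub>R \<delta> \<in> \<Phi>" by (simp only:)
    qed
  next
    case (minus r)
    show ?case
    proof
      fix x :: real assume "x \<in> \<int>"
      then have "r + (- x) *\<^sub>R \<delta> \<in> \<Phi>" using minus by (intro bspec [OF minus.IH]) simp
      then show "- r + x *\<^sub>R \<delta> \<in> \<Phi>" using minus_\<Phi> by fastforce
    qed
  next
    case (reflect r i)
    then have "s (\<alpha> i) (r + x *\<^sub>R \<delta>) \<in> \<Phi>" if "x \<in> \<int>" for x using s_\<Phi> \<alpha>_\<Phi> that by blast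
    then show ?case by (simp add: radical_s)
  qed
  then show ?thesis using assms(2) by blast
qed

text \<open>The coordinate of the image modulo the radical: subtracting \<open>co 0 v\<close> times
  \<delta> removes the \<alpha> 0 component, as \<open>m 0 = 1\<close>.\<close>

definition finite_coord :: "nat \<Rightarrow> 'v \<Rightarrow> real" where
  "finite_coord j v = co j v - real (m j) * co 0 v"

definition finite_height :: "'v \<Rightarrow> real" where
  "finite_height v = (\<Sum>j\<le>n. finite_coord j v)"

lemma finite_coord_linear [simp]:
  "finite_coord j (v + w) = finite_coord j v + finite_coord j w"
  "finite_coord j (v - w) = finite_coord j v - finite_coord j w"
  "finite_coord j (x *\<^sub>R v) = x * finite_coord j v"
  "finite_coord j (- v) = - finite_coord j v"
  by (simp_all add: finite_coord_def algebra_simps)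

lemma finite_height_linear [simp]:
  "finite_height (v + w) = finite_height v + finite_height w"
  "finite_height (v - w) = finite_height v - finite_height w"
  "finite_height (x *\<^sub>R v) = x * finite_height v"
  by (simp_all add: finite_height_def sum.distrib sum_subtractf sum_distrib_left)

lemma finite_coord_Ints: "r \<in> \<Phi> \<Longrightarrow> j \<le> n \<Longrightarrow> finite_coord j r \<in> \<int>"
  unfolding finite_coord_def using co_Ints by auto

text \<open>A multiple of \<delta> brings the coordinate at 0 to 0. Adding the resulting root to
  \<delta>, or subtracting it from \<delta>, gives roots with coordinate 1 at 0 and therefore with
  no negative coordinate.\<close>

lemma finite_coord_bounds:
  assumes "r \<in> \<Phi>"
  shows "(\<forall>j\<le>n. 0 \<le> finite_coord j r \<and> finite_coord j r \<le> m j) \<or>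
    (\<forall>j\<le>n. - real (m j) \<le> finite_coord j r \<and> finite_coord j r \<le> 0)"
proof -
  define r' where "r' = r + (- co 0 r) *\<^sub>R \<delta>"
  have r': "r' \<in> \<Phi>"
    unfolding r'_def using assms co_Ints by (intro shift_\<delta>_\<Phi>) auto
  have co: "co j r' = finite_coord j r" if "j \<le> n" for j
    using that by (simp add: r'_def finite_coord_def algebra_simps)
  have "co 0 r' = 0" by (simp add: r'_def)
  have "r' + 1 *\<^sub>R \<delta> \<in> \<Phi>" "r' + (- 1) *\<^sub>R \<delta> \<in> \<Phi>" using shift_\<delta>_\<Phi> [OF r', of 1] shift_\<delta>_\<Phi> [OF r', of "- 1"] by simp_all
  then have *: "r' + \<delta> \<in> \<Phi>" "\<delta> - r' \<in> \<Phi>" using minus_\<Phi> by fastforce+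
  have "co j (r' + \<delta>) \<ge> 0" "co j (\<delta> - r') \<ge> 0" if "j \<le> n" for j
    using co_same_sign [OF *(1), of 0 j] co_same_sign [OF *(2), of 0 j] \<open>co 0 r' = 0\<close> that by simp_all
  then have "- real (m j) \<le> finite_coord j r" "finite_coord j r \<le> m j" if "j \<le> n" for j
    using co that by fastforce+
  moreover have "(\<forall>j\<le>n. 0 \<le> finite_coord j r) \<or> (\<forall>j\<le>n. finite_coord j r \<le> 0)"
    using coordinates [OF r'] co by (metis neg_le_0_iff_le of_nat_0_le_iff)
  ultimately show ?thesis by blast
qed

lemma finite_height_nonzero:
  assumes "r \<in> \<Phi>"
  shows "finite_height r \<noteq> 0"
proof
  assume 0: "finite_height r = 0"
  have zero: "finite_coord j r = 0" if "j \<le> n" for j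
    using finite_coord_bounds [OF assms] 0 that
      sum_nonneg_eq_0_iff [of "{..n}" "\<lambda>j. finite_coord j r"]
      sum_nonneg_eq_0_iff [of "{..n}" "\<lambda>j. - finite_coord j r"]
    by (elim disjE) (simp_all add: finite_height_def sum_negf)
  have "r = coa r *\<^sub>R a + co 0 r *\<^sub>R \<delta>"
  proof (rule coordinates_eqI)
    show "co j r = co j (coa r *\<^sub>R a + co 0 r *\<^sub>R \<delta>)" if "j \<le> n" for j
      using zero [OF that] that by (simp add: finite_coord_def)
  qed simp
  from arg_cong [OF this, of "\<lambda>v. B v r"] have "B r r = 0" by simp
  with norm_\<Phi> [OF assms] show False by simp
qed

lemma finite_height_Ints: "r \<in> \<Phi> \<Longrightarrow> finite_height r \<in> \<int>"
  unfolding finite_height_def by (intro Ints_sum finite_coord_Ints) auto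

lemma finite_height_le:
  assumes "r \<in> \<Phi>"
  shows "finite_height r \<le> (\<Sum>j\<le>n. real (m j))"
  unfolding finite_height_def
proof (rule sum_mono)
  fix j assume "j \<in> {..n}"
  then show "finite_coord j r \<le> real (m j)"
    using finite_coord_bounds [OF assms] by (auto intro: order_trans)
qed

section \<open>Bounds on the largest mark\<close>

definition E6_family :: "(nat \<Rightarrow> 'v) \<Rightarrow> bool" where
  "E6_family g \<longleftrightarrow> (\<forall>i<6. g i \<in> \<Phi>) \<and> (\<forall>i<6. \<forall>j<6. B (g i) (g j) = cartan_entry E6 i j)"

text \<open>The coordinates of half the sum of the positive roots of \<open>E6\<close>.\<close>

definition E6_rho :: "nat \<Rightarrow> real" where
  "E6_rho i = [8, 15, 21, 15, 8, 11] ! i"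

lemma E6_rho_pairing: "k < 6 \<Longrightarrow> (\<Sum>i<6. E6_rho i * cartan_entry E6 k i) = 1"
proof -
  assume "k < 6"
  then have "k \<in> {0, 1, 2, 3, 4, 5}" by auto
  then show ?thesis
    by (auto simp: E6_rho_def cartan_entry_def numeral_eq_Suc)
qed

text \<open>The family is reflected in a member of negative height. The vector with coordinates
  \<open>E6_rho\<close> thereby loses exactly that member, so its height rises by at least 1, while
  heights modulo the radical are bounded.\<close>

lemma positive_E6_family:
  assumes "E6_family g"
  shows "\<exists>g. E6_family g \<and> (\<forall>i<6. finite_height (g i) > 0)"
proof -
  \<comment> \<open>78 is the sum of the entries of \<open>E6_rho\<close>.\<close>
  define M where "M = 78 * (\<Sum>j\<le>n. real (m j))"
  define F where "F = (\<lambda>g. \<Sum>i<6. E6_rho i * finite_height (g i))"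
  have rho_pos: "E6_rho i \<ge> 0" if "i < 6" for i
    using that by (auto simp: E6_rho_def nth_Cons' numeral_eq_Suc)
  have F_le: "F g \<le> M" if "E6_family g" for g
  proof -
    have "F g \<le> (\<Sum>i<6. E6_rho i * (\<Sum>j\<le>n. real (m j)))"
      unfolding F_def using that rho_pos finite_height_le
      by (intro sum_mono mult_left_mono) (auto simp: E6_family_def)
    also have "\<dots> = M"
      unfolding M_def by (simp add: E6_rho_def numeral_eq_Suc flip: sum_distrib_right)
    finally show ?thesis .
  qed
  show ?thesis
    using assms
  proof (induction "nat \<lfloor>M - F g\<rfloor>" arbitrary: g rule: less_induct)
    case less
    show ?case
    proof (cases "\<forall>i<6. finite_height (g i) > 0")
      case True
      with less.prems show ?thesis by blast
    next
      case False
      then obtain k where k: "k < 6" "\<not> finite_height (g k) > 0" by auto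
      have gk: "g k \<in> \<Phi>" "B (g k) (g k) = 2" using less.prems k norm_\<Phi> by (auto simp: E6_family_def)
      have "- finite_height (g k) \<ge> 1"
        using k finite_height_nonzero [OF gk(1)] finite_height_Ints [OF gk(1)]
        by (intro Ints_pos_ge_1) auto
      define g' where "g' = (\<lambda>i. s (g k) (g i))"
      have g': "E6_family g'"
        using less.prems k gk s_\<Phi> by (auto simp: E6_family_def g'_def)
      have "F g' = (\<Sum>i<6. E6_rho i * finite_height (g i) -
          finite_height (g k) * (E6_rho i * cartan_entry E6 k i))"
        unfolding F_def g'_def
      proof (rule sum.cong)
        fix i :: nat assume "i \<in> {..<6}"
        then have "B (g k) (g i) = cartan_entry E6 k i"
          using less.prems k by (auto simp: E6_family_def)
        then show "E6_rho i * finite_height (s (g k) (g i)) = E6_rho i * finite_height (g i) -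
            finite_height (g k) * (E6_rho i * cartan_entry E6 k i)"
          by (simp add: reflection_def algebra_simps)
      qed simp
      also have "\<dots> = F g - finite_height (g k)"
        using E6_rho_pairing [OF k(1)] by (simp add: F_def sum_subtractf flip: sum_distrib_left)
      finally have "M - F g' \<le> M - F g - 1" using \<open>- finite_height (g k) \<ge> 1\<close> by simp
      then have "nat \<lfloor>M - F g'\<rfloor> < nat \<lfloor>M - F g\<rfloor>"
        using F_le [OF g'] by linarith
      then show ?thesis using less.hyps g' by blast
    qed
  qed
qed

lemma add_\<Phi>: "r \<in> \<Phi> \<Longrightarrow> q \<in> \<Phi> \<Longrightarrow> B r q = - 1 \<Longrightarrow> r + q \<in> \<Phi>"
  using s_\<Phi> [of q r] by (simp add: reflection_def sym_B)

text \<open>In a positive family no member has a negative coordinate. A coordinate where the branch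
  member \<open>g 2\<close> is positive is thus at least 3 in a root containing \<open>g 2\<close>
  three times, and the marks bound the coordinates.\<close>

lemma E6_family_mark:
  assumes "E6_family g"
  shows "m t \<ge> 3"
proof -
  obtain g where g: "E6_family g" "\<And>i. i < 6 \<Longrightarrow> finite_height (g i) > 0"
    using positive_E6_family [OF assms] by blast
  have roots: "g 0 \<in> \<Phi>" "g 1 \<in> \<Phi>" "g 2 \<in> \<Phi>" "g 3 \<in> \<Phi>" "g 4 \<in> \<Phi>" "g 5 \<in> \<Phi>"
    using g(1) by (auto simp: E6_family_def)
  have prods: "B (g i) (g j) = cartan_entry E6 i j" if "i < 6" "j < 6" for i j
    using g(1) that by (auto simp: E6_family_def)
  note [simp] = prods cartan_entry_def
  \<comment> \<open>Successive reflections reach a root with coefficient 3 at the branch vertex.\<close>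
  define x where "x = g 2 + g 1 + g 3 + g 5 + g 2 + g 0 + g 1 + g 4 + g 3 + g 2"
  have x: "x \<in> \<Phi>" unfolding x_def by (intro roots add_\<Phi>) simp_all
  have nonneg: "finite_coord j r \<ge> 0" if "r \<in> \<Phi>" "finite_height r > 0" "j \<le> n" for j r
  proof (rule ccontr)
    assume "\<not> finite_coord j r \<ge> 0"
    then have "\<forall>j\<le>n. finite_coord j r \<le> 0"
      using finite_coord_bounds [OF that(1)] that(3) by auto
    then have "finite_height r \<le> 0"
      unfolding finite_height_def by (intro sum_nonpos) auto
    with that show False by simp
  qed
  obtain j where j: "j \<le> n" "finite_coord j (g 2) > 0"
    using g(2) [of 2] sum_pos_term [of "\<lambda>j. finite_coord j (g 2)" n] by (auto simp: finite_height_def)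
  then have "finite_coord j (g 2) \<ge> 1"
    using finite_coord_Ints roots by (intro Ints_pos_ge_1) auto
  moreover have "finite_coord j (g i) \<ge> 0" if "i \<in> {0, 1, 3, 4, 5}" for i
    using that nonneg g roots j by auto
  from this [of 0] this [of 1] this [of 3] this [of 4] this [of 5]
  have "0 \<le> finite_coord j (g 0)" "0 \<le> finite_coord j (g 1)" "0 \<le> finite_coord j (g 3)"
    "0 \<le> finite_coord j (g 4)" "0 \<le> finite_coord j (g 5)" by simp_all
  ultimately have "finite_coord j x \<ge> 3" by (simp add: x_def)
  then have "real (m j) \<ge> 3" using finite_coord_bounds [OF x] j by auto
  then show ?thesis using m_le_m_t [OF j(1)] by linarith
qed

text \<open>Orthogonality of \<delta> to each simple root says that twice a mark is the sum of the
  neighbouring marks. With five vertices this leaves a finite problem over the possible adjacencies,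
  solved in \<open>five_vertex_labels\<close>.\<close>

lemma rank_4_mark:
  assumes "n = 4"
  shows "m t \<le> 2"
proof -
  have "card ({..n} - {0, t}) = 3" using assms t_bounds by (simp add: card_Diff_insert)
  then obtain i j k where ijk: "{..n} - {0, t} = {i, j, k}" "i \<noteq> j" "i \<noteq> k" "j \<noteq> k"
    by (auto simp: card_3_iff)
  have le: "i \<le> n" "j \<le> n" "k \<le> n" and ne: "i \<noteq> 0" "j \<noteq> 0" "k \<noteq> 0" "i \<noteq> t" "j \<noteq> t" "k \<noteq> t" "t \<noteq> 0"
  proof -
    have "i \<in> {..n} - {0, t}" "j \<in> {..n} - {0, t}" "k \<in> {..n} - {0, t}" unfolding ijk(1) by auto
    then show "i \<le> n" "j \<le> n" "k \<le> n" "i \<noteq> 0" "j \<noteq> 0" "k \<noteq> 0" "i \<noteq> t" "j \<noteq> t" "k \<noteq> t" "t \<noteq> 0"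
      using t_bounds by auto
  qed
  have "{..n} = {0, t} \<union> ({..n} - {0, t})" using t_bounds by auto
  then have set: "{..n} = {0, i, j, k, t}" unfolding ijk(1) by auto
  have sum: "(\<Sum>x\<le>n. f x) = f 0 + f i + f j + f k + f t" for f :: "nat \<Rightarrow> int"
    unfolding set using ijk ne by simp
  define M where "M = (\<lambda>x. int (m x))"
  define e where "e = (\<lambda>x y. if B (\<alpha> x) (\<alpha> y) = - 1 then M y else 0)"
  have e: "2 * M x = (\<Sum>y\<le>n. if y = x then 0 else e x y)" if x: "x \<le> n" for x
  proof -
    define S where "S = (\<Sum>y\<le>n. if y = x then 0 else e x y)"
    have "0 = B (\<alpha> x) \<delta>" by simp
    also have "\<dots> = (\<Sum>y\<le>n. m y * B (\<alpha> x) (\<alpha> y))" by (simp add: \<delta>_def B_sum_right)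
    also have "\<dots> = (\<Sum>y\<le>n. (if y = x then 2 * real (m x) else 0) - of_int (if y = x then 0 else e x y))"
      using x B_\<alpha>_cases by (intro sum.cong) (auto simp: e_def M_def)
    also have "\<dots> = 2 * real (m x) - of_int S"
      using x by (simp add: sum_subtractf S_def)
    finally have "real_of_int (2 * M x) = of_int S" by (simp add: M_def)
    then show ?thesis unfolding S_def by (simp only: of_int_eq_iff)
  qed
  define p where "p = (\<lambda>x y. B (\<alpha> x) (\<alpha> y) = - 1)"
  have sym: "p x y = p y x" for x y by (simp add: p_def sym_B)
  have "M t \<le> 2"
  proof (rule five_vertex_labels [of "M 0" "M i" "M j" "M k" _
        "p 0 i" "p 0 j" "p 0 k" "p 0 t" "p i j" "p i k" "p i t" "p j k" "p j t" "p k t"])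
    show "2 * M 0 = (if p 0 i then M i else 0) + (if p 0 j then M j else 0) +
        (if p 0 k then M k else 0) + (if p 0 t then M t else 0)"
      using e [of 0] ijk ne unfolding sum by (simp add: e_def p_def)
    show "2 * M i = (if p 0 i then M 0 else 0) + (if p i j then M j else 0) +
        (if p i k then M k else 0) + (if p i t then M t else 0)"
      using e [of i] ijk ne le sym [of 0 i] unfolding sum by (simp add: e_def p_def)
    show "2 * M j = (if p 0 j then M 0 else 0) + (if p i j then M i else 0) +
        (if p j k then M k else 0) + (if p j t then M t else 0)"
      using e [of j] ijk ne le sym [of 0 j] sym [of i j] unfolding sum by (simp add: e_def p_def)
    show "2 * M k = (if p 0 k then M 0 else 0) + (if p i k then M i else 0) +
        (if p j k then M j else 0) + (if p k t then M t else 0)"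
      using e [of k] ijk ne le sym [of 0 k] sym [of i k] sym [of j k] unfolding sum
      by (simp add: e_def p_def)
    show "2 * M t = (if p 0 t then M 0 else 0) + (if p i t then M i else 0) +
        (if p j t then M j else 0) + (if p k t then M k else 0)"
      using e [of t] ijk ne le sym [of 0 t] sym [of i t] sym [of j t] sym [of k t] unfolding sum
      by (simp add: e_def p_def)
  qed (use m_pos m_le_m_t le in \<open>auto simp: M_def Suc_le_eq simp flip: of_nat_le_iff\<close>)
  then show ?thesis by (simp add: M_def)
qed

section \<open>Orbits of the Hurwitz action\<close>

context
  fixes "is" :: "nat list" and c :: "'v \<Rightarrow> 'v" and E :: "('v \<Rightarrow> 'v) list set"
  assumes is_distinct: "distinct is" and is_set: "set is = {..n} - {t}"
    and c_def: "c = rp (map \<alpha> is @ tail 1)"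
    and E_def: "E = Red_gen B \<Phi> (n + 2) c"
begin

definition generating :: "'v list \<Rightarrow> bool" where
  "generating rs \<longleftrightarrow> set rs \<subseteq> \<Phi> \<and> length rs = n + 2 \<and> rp rs = c \<and>
    generate perm_group (s ` \<Phi>) = generate perm_group (s ` set rs)"

lemma E_eq: "E = map s ` Collect generating"
proof (rule Set.set_eqI)
  fix ts
  have lists: "set ts \<subseteq> s ` \<Phi> \<longleftrightarrow> (\<exists>rs. ts = map s rs \<and> set rs \<subseteq> \<Phi>)"
  proof (induction ts)
    case (Cons g ts)
    have "set (g # ts) \<subseteq> s ` \<Phi> \<longleftrightarrow>
        (\<exists>r\<in>\<Phi>. g = s r) \<and> (\<exists>rs. ts = map s rs \<and> set rs \<subseteq> \<Phi>)"
      using Cons by auto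
    also have "\<dots> \<longleftrightarrow> (\<exists>rs. g # ts = map s rs \<and> set rs \<subseteq> \<Phi>)"
      by (auto simp: Cons_eq_map_conv) (metis insert_subset list.simps(15))
    finally show ?case .
  qed simp
  have "ts \<in> E \<longleftrightarrow> (\<exists>rs. ts = map s rs \<and> set rs \<subseteq> \<Phi>) \<and> length ts = n + 2 \<and>
      c = list_prod perm_group ts \<and>
      generate perm_group (s ` \<Phi>) = generate perm_group (set ts)"
    unfolding E_def Red_gen_def reflections_def elliptic_weyl_group_def lists [symmetric] by auto
  also have "\<dots> \<longleftrightarrow> (\<exists>rs. ts = map s rs \<and> generating rs)"
  proof -
    have "list_prod perm_group (map s rs) = rp rs" if "set rs \<subseteq> \<Phi>" for rs
      using that norm_\<Phi> by (intro list_prod_rp) auto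
    then show ?thesis by (auto simp: generating_def)
  qed
  also have "\<dots> \<longleftrightarrow> ts \<in> map s ` Collect generating" by auto
  finally show "ts \<in> E \<longleftrightarrow> ts \<in> map s ` Collect generating" .
qed

lemma generating_norm2: "generating rs \<Longrightarrow> norm2 rs"
  using norm_\<Phi> by (auto simp: generating_def)

lemma generating_hw:
  assumes "generating rs" "hw rs qs"
  shows "generating qs"
proof -
  have "set qs \<subseteq> \<Phi>"
    using hw_closed [OF assms(2)] s_\<Phi> minus_\<Phi> assms(1) by (auto simp: generating_def)
  moreover have "rp qs = rp rs" using hw_rp [OF assms(2)] by (simp add: fun_eq_iff)
  ultimately show ?thesis
    using assms hw_length hw_generate [OF assms(2) generating_norm2] by (auto simp: generating_def)
qed

lemma E_tuples: "E \<subseteq> perm.tuples (n + 2)"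
proof -
  have "s r \<in> carrier perm_group" if "set rs \<subseteq> \<Phi>" "r \<in> set rs" for r rs
    using that norm_\<Phi> by (intro s_in_perm) blast
  then show ?thesis by (auto simp: E_eq generating_def perm.tuples_def)
qed

lemma E_move:
  assumes "ts \<in> E" "Suc i < n + 2"
  shows "hurwitz_move perm_group (i, b) ts \<in> E"
proof -
  obtain rs where rs: "generating rs" "ts = map s rs" using assms(1) by (auto simp: E_eq)
  then obtain ys where "hw rs ys" "hurwitz_move perm_group (i, b) ts = map s ys"
    using hurwitz_move_s [of rs i b] generating_norm2 [OF rs(1)] assms(2)
    by (auto simp: generating_def)
  then show ?thesis using generating_hw [OF rs(1)] by (auto simp: E_eq simp del: hurwitz_move.simps)
qed

abbreviation orbs :: "('v \<Rightarrow> 'v) list set set" where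
  "orbs \<equiv> orbits (braid_group (n + 2)) E (hurwitz_action perm_group E)"

abbreviation orb :: "('v \<Rightarrow> 'v) list \<Rightarrow> ('v \<Rightarrow> 'v) list set" where
  "orb \<equiv> orbit (braid_group (n + 2)) (hurwitz_action perm_group E)"

lemma action: "group_action (braid_group (n + 2)) E (hurwitz_action perm_group E)"
  by (rule perm.group_action_hurwitz [OF E_tuples E_move])

text \<open>Braid words act on reflections and \<open>hw\<close> on roots; the signs lost in between
  are restored by flips.\<close>

lemma orb_iff:
  assumes "generating rs" "generating qs"
  shows "map s qs \<in> orb (map s rs) \<longleftrightarrow> hw rs qs"
proof -
  have "map s rs \<in> E" using assms by (auto simp: E_eq)
  then have "map s qs \<in> orb (map s rs) \<longleftrightarrow>
      (\<exists>u. valid_word (n + 2) u \<and> braid_act u (map s rs) = map s qs)"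
    using perm.mem_orbit_hurwitz [OF E_tuples E_move] by blast
  also have "\<dots> \<longleftrightarrow> hw rs qs"
  proof safe
    fix u assume u: "valid_word (n + 2) u"
      "braid_act u (map s rs) = map s qs"
    then obtain ys where ys: "hw rs ys" "map s ys = map s qs"
      using foldr_hurwitz_s [of rs u] generating_norm2 [OF assms(1)] assms(1)
      by (auto simp: generating_def)
    have "hw ys qs"
      using map_s_eq_imp_hw [OF ys(2)] generating_norm2 generating_hw assms ys(1) by blast
    with ys(1) show "hw rs qs" by (rule hw_trans)
  next
    assume "hw rs qs"
    from hw_foldr_hurwitz [OF this] assms(1)
    show "\<exists>u. valid_word (n + 2) u \<and> braid_act u (map s rs) = map s qs"
      by (simp add: generating_def)
  qed
  finally show ?thesis .
qed

lemma orb_eq: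
  assumes "generating rs" "generating qs" "hw rs qs"
  shows "orb (map s rs) = orb (map s qs)"
proof -
  have "map s rs \<in> E" "map s qs \<in> E" using assms by (auto simp: E_eq)
  moreover have "map s qs \<in> orb (map s rs)" using orb_iff assms by blast
  ultimately have "orb (map s rs) \<inter> orb (map s qs) \<noteq> {}"
    using group_action.orbit_refl [OF action] by blast
  then show ?thesis
    using group_action.disjoint_union [OF action] \<open>map s rs \<in> E\<close> \<open>map s qs \<in> E\<close>
    unfolding orbits_def by blast
qed

lemma generating_canonical:
  assumes "generating rs"
  shows "\<exists>l e. hw rs (map (lift l) is @ tail e) \<and> (e = 1 \<or> e = - 1) \<and>
    (\<forall>i\<in>set is. l i \<in> \<int>) \<and> rp (map (lift l) is @ tail e) = c"
proof -
  have gen: "set rs \<subseteq> \<Phi>" "length rs = n + 2" "rp rs = c"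
    using assms unfolding generating_def by simp_all
  then have prod: "rp rs v = rp (map \<alpha> is @ tail 1) v" for v unfolding c_def by simp
  have lattice: "\<Phi> \<subseteq> group_closure (set rs)"
    using generate_imp_lattice [of rs] assms by (auto simp: generating_def)
  show ?thesis
  proof (rule canonical_form [OF gen(1,2) lattice is_distinct is_set prod])
    fix l e
    assume l: "hw rs (map (lift l) is @ tail e)" "e = 1 \<or> e = - 1" "\<And>i. i \<in> set is \<Longrightarrow> l i \<in> \<int>"
    moreover have "rp (map (lift l) is @ tail e) = c"
      using hw_rp [OF l(1)] unfolding gen(3) [symmetric] fun_eq_iff by simp
    ultimately show ?thesis by blast
  qed
qed

theorem Hurwitz_transitive:
  assumes "m t \<ge> 3"
  shows "transitive_action (braid_group (n + 2)) E (hurwitz_action perm_group E)"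
proof -
  have canonical: "hw rs (map \<alpha> is @ tail 1)" if gen: "generating rs" for rs
  proof -
    obtain l e where l: "hw rs (map (lift l) is @ tail e)" "e = 1 \<or> e = - 1"
      "\<forall>i\<in>set is. l i \<in> \<int>" "rp (map (lift l) is @ tail e) = c"
      using generating_canonical [OF gen] by blast
    have prod: "rp (map (lift l) is @ tail e) v = rp (map \<alpha> is @ tail 1) v" for v
      using l(4) unfolding c_def by simp
    have "e \<noteq> - 1"
    proof
      assume "e = - 1"
      then have "m t \<le> 2"
        using l(3) prod by (intro canonical_shifts_negative [OF is_distinct is_set, of l]) auto
      with assms show False by simp
    qed
    then have "e = 1" using l by simp
    then show ?thesis using canonical_shifts_unique [OF is_distinct is_set, of l 1 "\<lambda>_. 0"] l(1) prod
      unfolding lift_0 by metis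
  qed
  have "\<exists>g\<in>carrier (braid_group (n + 2)). hurwitz_action perm_group E g x = y"
    if xy: "x \<in> E" "y \<in> E" for x y
  proof -
    obtain rs qs where *: "generating rs" "x = map s rs" "generating qs" "y = map s qs"
      using xy by (auto simp: E_eq)
    then have "hw rs qs" using canonical hw_sym hw_trans by blast
    then have "y \<in> orb x" using orb_iff * by simp
    then show ?thesis by (auto simp: orbit_def)
  qed
  then show ?thesis
    using action by (simp add: transitive_action_def transitive_action_axioms_def)
qed

theorem Hurwitz_two_orbits:
  assumes "m t \<le> 2"
  shows "card (orbs) = 2"
proof -
  obtain l where l: "\<And>i. l i \<in> \<int>"
    "\<And>v. rp (map (lift l) is @ tail (- 1)) v = rp (map \<alpha> is @ tail 1) v"
    using canonical_shifts_exist [OF is_distinct is_set assms] by blast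
  define F where "F = map \<alpha> is @ tail 1"
  define F' where "F' = map (lift l) is @ tail (- 1)"
  have len: "length is = n" using distinct_card [OF is_distinct] is_set by simp
  have F: "generating F"
    unfolding generating_def
  proof (intro conjI)
    show "set F \<subseteq> \<Phi>" using tail_\<Phi> [of 1] \<alpha>_\<Phi> is_set by (auto simp: F_def)
    show "length F = n + 2" using len by (simp add: F_def tail_def)
    show "rp F = c" unfolding F_def c_def ..
    show "generate perm_group (s ` \<Phi>) = generate perm_group (s ` set F)"
      using generate_canonical [OF is_set, of "\<lambda>_. 0" 1] unfolding F_def set_map lift_0 by simp
  qed
  have F': "generating F'"
    unfolding generating_def
  proof (intro conjI)
    show "set F' \<subseteq> \<Phi>" using tail_\<Phi> [of "- 1"] lift_\<Phi> [OF _ l(1)] is_set by (auto simp: F'_def)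
    show "length F' = n + 2" using len by (simp add: F'_def tail_def)
    show "rp F' = c" unfolding F'_def c_def using l(2) by blast
    show "generate perm_group (s ` \<Phi>) = generate perm_group (s ` set F')"
      using generate_canonical [OF is_set l(1), of "- 1"] unfolding F'_def set_map by simp
  qed
  have cases: "hw rs F \<or> hw rs F'" if gen: "generating rs" for rs
  proof -
    obtain l' e where l': "hw rs (map (lift l') is @ tail e)" "e = 1 \<or> e = - 1"
      "\<forall>i\<in>set is. l' i \<in> \<int>" "rp (map (lift l') is @ tail e) = c"
      using generating_canonical [OF gen] by blast
    have prod: "rp (map (lift l') is @ tail e) v = rp (map \<alpha> is @ tail 1) v" for v
      using l'(4) unfolding c_def by simp
    from l'(2) show ?thesis
    proof
      assume "e = 1"
      then show ?thesis
        using canonical_shifts_unique [OF is_distinct is_set, of l' 1 "\<lambda>_. 0"] l'(1) prod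
        unfolding F_def lift_0 by metis
    next
      assume "e = - 1"
      then show ?thesis
        using canonical_shifts_unique [OF is_distinct is_set, of l' "- 1" l] l'(1) prod l(2)
        unfolding F'_def by metis
    qed
  qed
  have "\<not> hw F F'"
  proof
    assume "hw F F'"
    from hw_tensor [OF this linear_coa linear_co [of t]]
    have "(1::real) = - 1"
      using tensor_canonical [OF is_set, of "\<lambda>_. 0" 1] tensor_canonical [OF is_set, of l "- 1"]
      by (simp add: F_def F'_def)
    then show False by simp
  qed
  then have "map s F' \<notin> orb (map s F)" using orb_iff F F' by blast
  moreover have "map s F' \<in> orb (map s F')"
    using F' group_action.orbit_refl [OF action] by (auto simp: E_eq)
  ultimately have ne: "orb (map s F) \<noteq> orb (map s F')" by blast
  have "orbs = {orb (map s F), orb (map s F')}"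
  proof
    show "orbs \<subseteq> {orb (map s F), orb (map s F')}"
    proof
      fix X assume "X \<in> orbs"
      then obtain rs where rs: "generating rs" "X = orb (map s rs)"
        unfolding orbits_def E_eq by blast
      from cases [OF rs(1)] show "X \<in> {orb (map s F), orb (map s F')}"
        using orb_eq [OF rs(1) F] orb_eq [OF rs(1) F'] rs(2) by blast
    qed
    have "map s F \<in> E" "map s F' \<in> E" using F F' by (simp_all add: E_eq)
    then show "{orb (map s F), orb (map s F')} \<subseteq> orbs"
      unfolding orbits_def by blast
  qed
  then show ?thesis using ne by simp
qed

end

end

section \<open>Choice of coordinates\<close>

lemma spanning_if_card_eq_dim:
  fixes X :: "'v::real_vector set"
  assumes "X \<subseteq> V" "independent X" "card X = dim V" "dim V > 0"
  shows "V \<subseteq> span X"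
proof
  fix v assume v: "v \<in> V"
  obtain Y where Y: "Y \<subseteq> V" "independent Y" "V \<subseteq> span Y" "card Y = dim V"
    by (rule basis_exists)
  have fin: "finite Y" "finite X" using Y assms by (metis card.infinite less_irrefl)+
  show "v \<in> span X"
  proof (rule ccontr)
    assume "v \<notin> span X"
    then have "independent (insert v X)" "v \<notin> X"
      using assms(2) by (auto simp: independent_insertI span_base)
    moreover have "insert v X \<subseteq> span Y" using v assms(1) Y(3) by auto
    ultimately have "card (insert v X) \<le> card Y" using independent_span_bound fin by blast
    then show False using fin \<open>v \<notin> X\<close> Y assms by simp
  qed
qed

lemma independent_preimage:
  fixes f :: "'v::real_vector \<Rightarrow> 'w::real_vector"
  assumes "linear f" "independent (f ` X)" "inj_on f X"
  shows "independent X"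
proof
  assume "dependent X"
  then obtain x where x: "x \<in> X" "x \<in> span (X - {x})" by (auto simp: dependent_def)
  then have "f x \<in> span (f ` (X - {x}))" using linear_span_image [OF assms(1)] by blast
  also have "f ` (X - {x}) = f ` X - {f x}" using assms(3) x(1) by (auto simp: inj_on_def)
  finally show False using assms(2) x(1) by (auto simp: dependent_def)
qed

lemma group_closure_nat_sum:
  fixes f :: "nat \<Rightarrow> 'v::real_vector"
  assumes "\<And>i. i \<in> I \<Longrightarrow> f i \<in> group_closure X"
  shows "(\<Sum>i\<in>I. real (k i) *\<^sub>R f i) \<in> group_closure X"
  using assms
  by (induction I rule: infinite_finite_induct) (auto intro!: group_closure_add group_closure_scaleR)

lemma fin_type_edge:
  assumes "fin_type B \<Phi> X"
  obtains r \<eta> where "r \<in> \<Phi>" "\<eta> \<in> \<Phi>" "B r \<eta> = - 1"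
proof -
  obtain r where r: "r ` {..<type_rank X} \<subseteq> \<Phi>"
    "\<And>i j. i < type_rank X \<Longrightarrow> j < type_rank X \<Longrightarrow> B (r i) (r j) = cartan_entry X i j"
    using assms by (auto simp: fin_type_def)
  have "0 < type_rank X" "1 < type_rank X" "cartan_entry X 0 1 = - 1"
    by (cases X; simp add: cartan_entry_def)+
  with r show ?thesis by (intro that [of "r 0" "r 1"]) auto
qed

text \<open>Otherwise every root not orthogonal to \<open>r\<close> is \<open>r\<close> or
  \<open>- r\<close> modulo the radical, so these roots split off orthogonally. Some root is
  orthogonal to \<open>r\<close>, because two roots joined by an edge of the diagram cannot both be
  of this kind; this contradicts irreducibility.\<close>

lemma (in semidefinite_form) exists_unit_pairing:
  assumes "elliptic_root_system B \<Phi>" "irreducible_roots B \<Phi>" "fin_type B \<Phi> X" and r: "r \<in> \<Phi>"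
  shows "\<exists>\<eta>\<in>\<Phi>. B r \<eta> = 1 \<or> B r \<eta> = - 1"
proof (rule ccontr)
  assume neg: "\<not> ?thesis"
  have norm: "B \<eta> \<eta> = 2" if "\<eta> \<in> \<Phi>" for \<eta>
    using assms(1) that by (auto simp: elliptic_root_system_def)
  have val: "B r \<eta> = 0 \<or> B r \<eta> = 2 \<or> B r \<eta> = - 2" if "\<eta> \<in> \<Phi>" for \<eta>
  proof -
    have "B r \<eta> \<in> \<int>" using assms(1) r that by (auto simp: elliptic_root_system_def)
    then obtain z where z: "B r \<eta> = of_int z" by (elim Ints_cases)
    have "- 2 \<le> z" "z \<le> 2" using B_roots_bounds [of r \<eta>] norm r that z by auto
    moreover have "z \<noteq> 1" "z \<noteq> - 1" using neg that z by auto
    ultimately have "z = 0 \<or> z = 2 \<or> z = - 2" by auto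
    then show ?thesis using z by auto
  qed
  have par: "B \<eta> w = B r w \<or> B \<eta> w = - B r w" if "\<eta> \<in> \<Phi>" "B r \<eta> \<noteq> 0" for \<eta> w
    using val [OF that(1)] that B_eq_2_radical [OF norm norm, of r \<eta> w] r
      B_eq_neg_2_radical [OF norm norm, of r \<eta> w] by auto
  define \<Phi>\<^sub>1 \<Phi>\<^sub>2 where "\<Phi>\<^sub>1 = {\<eta> \<in> \<Phi>. B r \<eta> \<noteq> 0}" and "\<Phi>\<^sub>2 = {\<eta> \<in> \<Phi>. B r \<eta> = 0}"
  have "\<Phi>\<^sub>2 \<noteq> {}"
  proof
    assume empty: "\<Phi>\<^sub>2 = {}"
    obtain \<eta> \<zeta> where *: "\<eta> \<in> \<Phi>" "\<zeta> \<in> \<Phi>" "B \<eta> \<zeta> = - 1" using fin_type_edge assms(3) by blast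
    then have "B r \<eta> \<noteq> 0" "B r \<zeta> \<noteq> 0" using empty by (auto simp: \<Phi>\<^sub>2_def)
    then have "B r \<zeta> = - 1 \<or> B r \<zeta> = 1" using par [of \<eta> \<zeta>] * by auto
    with val * show False by fastforce
  qed
  moreover have "\<Phi>\<^sub>1 \<noteq> {}" using r norm [OF r] by (auto simp: \<Phi>\<^sub>1_def)
  moreover have "\<Phi> = \<Phi>\<^sub>1 \<union> \<Phi>\<^sub>2" by (auto simp: \<Phi>\<^sub>1_def \<Phi>\<^sub>2_def)
  moreover have "B \<eta> \<zeta> = 0" if "\<eta> \<in> \<Phi>\<^sub>1" "\<zeta> \<in> \<Phi>\<^sub>2" for \<eta> \<zeta>
    using par [of \<eta> \<zeta>] that by (auto simp: \<Phi>\<^sub>1_def \<Phi>\<^sub>2_def)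
  ultimately show False using assms(2) unfolding irreducible_roots_def by blast
qed

text \<open>The \<alpha> i and \<open>a\<close> are independent and as many as the dimension, hence
  a basis, and \<open>co\<close>, \<open>coa\<close> are its dual functionals. Data of the quotient
  are pulled back by noting that preimages differ by multiples of \<open>a\<close>.\<close>

lemma elliptic_basis_exists:
  fixes B :: "'v::real_vector \<Rightarrow> 'v \<Rightarrow> real"
  assumes tub: "tubular B \<Phi>" and basis: "elliptic_root_basis B \<Phi> n \<alpha> t \<alpha>'"
  shows "\<exists>a co coa m. elliptic_basis B \<Phi> n t \<alpha> a co coa m \<and> \<alpha>' = \<alpha> t + a \<and>
    (\<forall>X. fin_type B \<Phi> X \<longrightarrow> n = type_rank X)"
proof -
  have ers: "elliptic_root_system B \<Phi>" and irr: "irreducible_roots B \<Phi>"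
    using tub by (auto simp: tubular_def)
  have bil: "bilinear B" and sym: "\<And>v w. B v w = B w v" and psd: "\<And>v. B v v \<ge> 0"
    and dim_rad: "dim (radical B) = 2" and norm: "\<And>r. r \<in> \<Phi> \<Longrightarrow> B r r = 2"
    and span_\<Phi>: "span \<Phi> = UNIV"
    and refl: "\<And>r \<eta>. r \<in> \<Phi> \<Longrightarrow> \<eta> \<in> \<Phi> \<Longrightarrow> reflection B r \<eta> \<in> \<Phi>"
    and Ints: "\<And>r \<eta>. r \<in> \<Phi> \<Longrightarrow> \<eta> \<in> \<Phi> \<Longrightarrow> B r \<eta> \<in> \<int>"
  proof -
    note ers' = ers [unfolded elliptic_root_system_def image_subset_iff]
    from ers' show "bilinear B" "dim (radical B) = 2" "span \<Phi> = UNIV" by simp_all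
    from ers' show "B v w = B w v" "B v v \<ge> 0" for v w by simp_all
    from ers' show "B r r = 2" if "r \<in> \<Phi>" for r using that by simp
    from ers' show "reflection B r \<eta> \<in> \<Phi>" "B r \<eta> \<in> \<int>" if "r \<in> \<Phi>" "\<eta> \<in> \<Phi>" for r \<eta>
      using that by simp_all
  qed
  interpret semidefinite_form B using bil sym psd by unfold_locales
  obtain U a m0 and p :: "'v \<Rightarrow> 'v" where dim_UNIV: "dim (UNIV :: 'v set) = n + 2"
    and U: "subspace U" "dim U = 1" "U \<subseteq> radical B"
    and LU: "group_closure \<Phi> \<inter> U \<noteq> {0}" "group_closure \<Phi> \<inter> U = group_closure {a}"
    and p: "linear p" "{v. p v = 0} = U"
    and \<alpha>: "\<alpha> ` {0..n} \<subseteq> \<Phi>"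
    and simple: "simple_system (p ` \<Phi>) {0..n} (p \<circ> \<alpha>)"
    and m0: "\<forall>i\<in>{1..n}. m0 i > (0::nat)"
    and mark: "group_closure ((p \<circ> \<alpha>) ` {0..n}) \<inter> p ` radical B =
          group_closure {p (\<alpha> 0) + (\<Sum>i=1..n. real (m0 i) *\<^sub>R p (\<alpha> i))}"
    and t: "t \<in> {1..n}" "m0 t = Max (m0 ` {1..n})"
    and \<alpha>': "\<alpha>' = \<alpha> t + a"
  proof -
    from basis show ?thesis
      unfolding elliptic_root_basis_def quotient_map_of_def
    proof (elim conjE exE, goal_cases)
      case (1 U a p m)
      then show ?case by (rule that)
    qed
  qed
  note m0_pos = bspec [OF m0]
  define m where "m = m0(0 := 1)"
  define \<delta> where "\<delta> = (\<Sum>i\<le>n. real (m i) *\<^sub>R \<alpha> i)"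
  have aLU: "a \<in> group_closure \<Phi>" "a \<in> U"
    using LU(2) group_closure.base [of a "{a}"] by auto
  have a0: "a \<noteq> 0"
  proof
    assume "a = 0"
    then have "group_closure {a} = {0}" using group_closure_insert_zero [of "{}"] by simp
    with LU show False by simp
  qed
  have U_a: "\<exists>x. v = x *\<^sub>R a" if "v \<in> U" for v
  proof -
    have "U \<subseteq> span {a}" using U aLU a0 by (intro spanning_if_card_eq_dim) auto
    then show ?thesis using that by (auto simp: span_singleton)
  qed
  have pa: "p a = 0" using p aLU by auto
  have p\<alpha>: "inj_on (p \<circ> \<alpha>) {..n}" "independent (p ` \<alpha> ` {..n})"
    using simple by (auto simp: simple_system_def atLeast0AtMost image_comp)
  have inj: "inj_on \<alpha> {..n}" "inj_on p (\<alpha> ` {..n})"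
    using p\<alpha>(1) by (auto intro: inj_on_imageI inj_on_imageI2)
  have ind\<alpha>: "independent (\<alpha> ` {..n})" using independent_preimage p p\<alpha> inj by blast
  \<comment> \<open>The \<alpha> i stay independent modulo $U$, so \<open>a\<close>, which
    \<open>p\<close> kills, is not in their span.\<close>
  have p_inj: "inj_on p (span (\<alpha> ` {..n}))"
    using linear_inj_on_span_independent_image [OF p(1) p\<alpha>(2) inj(2)] .
  have a_span: "a \<notin> span (\<alpha> ` {..n})"
    using inj_onD [OF p_inj, of a 0] pa a0 linear_0 [OF p(1)] by (auto simp: span_zero)
  then have a_\<alpha>: "\<alpha> i \<noteq> a" if "i \<le> n" for i using that by (auto intro: span_base)
  define X where "X = insert a (\<alpha> ` {..n})"
  have indX: "independent X" unfolding X_def using a_span ind\<alpha> by (rule independent_insertI)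
  have "card X = n + 2"
    unfolding X_def using a_span inj(1) by (subst card_insert_disjoint) (auto simp: card_image span_base)
  then have spanX: "span X = UNIV"
    using spanning_if_card_eq_dim [of X UNIV] indX dim_UNIV by auto
  have "\<exists>f :: 'v \<Rightarrow> real. linear f \<and> (\<forall>x\<in>X. f x = (if x = \<alpha> i then 1 else 0))" for i
    by (rule linear_independent_extend [OF indX])
  then obtain co :: "nat \<Rightarrow> 'v \<Rightarrow> real" where
    co: "\<And>i. linear (co i)" "\<And>i x. x \<in> X \<Longrightarrow> co i x = (if x = \<alpha> i then 1 else 0)"
    by metis
  obtain coa :: "'v \<Rightarrow> real" where
    coa: "linear coa" "\<And>x. x \<in> X \<Longrightarrow> coa x = (if x = a then 1 else 0)"
    using linear_independent_extend [OF indX, of "\<lambda>x. if x = a then 1 else 0"] by metis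
  have co\<alpha>: "co i (\<alpha> j) = (if i = j then 1 else 0)" if "i \<le> n" "j \<le> n" for i j
    using co(2) [of "\<alpha> j" i] that inj(1) by (auto simp: X_def inj_on_def)
  have co_a: "co i a = 0" if "i \<le> n" for i
    using co(2) [of a i] a_\<alpha> [OF that] by (auto simp: X_def)
  have coa\<alpha>: "coa (\<alpha> j) = 0" if "j \<le> n" for j using coa(2) [of "\<alpha> j"] a_\<alpha> [OF that] that by (auto simp: X_def)
  have coaa: "coa a = 1" using coa(2) [of a] by (simp add: X_def)
  have expansion: "v = (\<Sum>i\<le>n. co i v *\<^sub>R \<alpha> i) + coa v *\<^sub>R a" for v
  proof (rule linear_eq_on [where B = X and f = "\<lambda>v. v" and g = "\<lambda>v. (\<Sum>i\<le>n. co i v *\<^sub>R \<alpha> i) + coa v *\<^sub>R a"])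
    show "linear (\<lambda>v::'v. v)" by (rule linear_ident)
    show "linear (\<lambda>v. (\<Sum>i\<le>n. co i v *\<^sub>R \<alpha> i) + coa v *\<^sub>R a)"
      using co(1) coa(1)
      by (intro linearI) (simp_all add: linear_add linear_scale scaleR_left_distrib
          scaleR_right_distrib sum.distrib scaleR_sum_right)
    fix x assume "x \<in> X"
    then consider "x = a" | j where "j \<le> n" "x = \<alpha> j" by (auto simp: X_def)
    then show "x = (\<Sum>i\<le>n. co i x *\<^sub>R \<alpha> i) + coa x *\<^sub>R a"
    proof cases
      case 1
      then show ?thesis by (simp add: co_a coaa)
    next
      case 2
      have "(\<Sum>i\<le>n. co i x *\<^sub>R \<alpha> i) = (\<Sum>i\<le>n. if i = j then \<alpha> i else 0)"
        using 2 by (intro sum.cong) (auto simp: co\<alpha>)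
      then show ?thesis using 2 by (simp add: coa\<alpha>)
    qed
  qed (simp add: spanX)
  have a_rad: "B a v = 0" for v using aLU U by (auto simp: radical_def)
  have p_sum: "p (\<Sum>i\<in>I. c i *\<^sub>R \<alpha> i) = (\<Sum>i\<in>I. c i *\<^sub>R p (\<alpha> i))" for c and I :: "nat set"
    using p(1) by (simp add: linear_sum linear_scale)
  have "p \<delta> = p (\<alpha> 0) + (\<Sum>i=1..n. real (m0 i) *\<^sub>R p (\<alpha> i))"
    unfolding \<delta>_def p_sum by (simp add: m_def sum.atMost_shift sum.atLeast_Suc_atMost atLeast0AtMost [symmetric])
  \<comment> \<open>The marks place the image of \<delta> in the image of the radical; as the kernel
    $U$ is radical too, so is \<delta> itself.\<close>
  then have "p \<delta> \<in> p ` radical B"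
    using mark group_closure.base [of "p \<delta>" "{p \<delta>}"] by auto
  then obtain r where r: "r \<in> radical B" "p \<delta> = p r" by auto
  then have "\<delta> - r \<in> U" using p by (auto simp: linear_diff)
  then have \<delta>_rad: "B \<delta> v = 0" for v
  proof -
    have "B (\<delta> - r) v = 0" "B r v = 0" using \<open>\<delta> - r \<in> U\<close> U r by (auto simp: radical_def)
    then show ?thesis by simp
  qed
  have "co 0 \<delta> = 1"
  proof -
    have "co 0 \<delta> = (\<Sum>i\<le>n. real (m i) * co 0 (\<alpha> i))"
      unfolding \<delta>_def using co(1) by (simp add: linear_sum linear_scale)
    also have "\<dots> = (\<Sum>i\<le>n. if i = 0 then 1 else 0)"
      by (intro sum.cong) (auto simp: co\<alpha> m_def)
    finally have "co 0 \<delta> = (\<Sum>i\<le>n. if i = 0 then 1 else 0)" .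
    then show ?thesis by simp
  qed
  have \<delta>_a: "\<delta> \<notin> span {a}"
    using \<open>co 0 \<delta> = 1\<close> co_a [of 0] co(1) by (auto simp: span_singleton linear_scale)
  have rad_span: "radical B \<subseteq> span {\<delta>, a}"
  proof (rule spanning_if_card_eq_dim)
    show "independent {\<delta>, a}" using \<delta>_a a0 by (intro independent_insertI) (auto simp: independent_empty)
    show "card {\<delta>, a} = dim (radical B)" using \<delta>_a dim_rad by (auto simp: span_base card_insert_if)
  qed (use a_rad \<delta>_rad dim_rad in \<open>auto simp: radical_def\<close>)
  have radical: "\<exists>x y. v = x *\<^sub>R a + y *\<^sub>R \<delta>" if "\<And>w. B v w = 0" for v
  proof -
    have "v \<in> span {\<delta>, a}" using rad_span that by (auto simp: radical_def)
    then obtain y x where "v - y *\<^sub>R \<delta> = x *\<^sub>R a" by (auto simp: span_insert span_singleton)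
    then show ?thesis by (metis diff_add_cancel)
  qed
  have coords: "\<exists>k :: nat \<Rightarrow> nat. ((\<forall>i\<le>n. co i r = k i) \<or> (\<forall>i\<le>n. co i r = - real (k i))) \<and> coa r \<in> \<int>"
    if r: "r \<in> \<Phi>" for r
  proof -
    obtain k :: "nat \<Rightarrow> nat" where
      "p r = (\<Sum>i\<le>n. real (k i) *\<^sub>R p (\<alpha> i)) \<or> p r = - (\<Sum>i\<le>n. real (k i) *\<^sub>R p (\<alpha> i))"
      using simple r unfolding simple_system_def atLeast0AtMost by (auto simp: image_iff)
    then obtain e :: real where e: "e = 1 \<or> e = - 1" "p r = e *\<^sub>R (\<Sum>i\<le>n. real (k i) *\<^sub>R p (\<alpha> i))"
      by (metis scaleR_minus1_left scaleR_one)
    define v where "v = (\<Sum>i\<le>n. real (k i) *\<^sub>R \<alpha> i)"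
    have "p (r - e *\<^sub>R v) = 0"
      using e p(1) by (simp add: linear_diff linear_scale v_def p_sum)
    then have inU: "r - e *\<^sub>R v \<in> U" using p(2) by auto
    then obtain x where x: "r - e *\<^sub>R v = x *\<^sub>R a" using U_a by blast
    then have r_eq: "r = e *\<^sub>R v + x *\<^sub>R a" by (metis add.commute diff_add_cancel)
    have "v \<in> group_closure \<Phi>"
      unfolding v_def
      by (intro group_closure_nat_sum group_closure.base insertI2 subsetD [OF \<alpha>] imageI) auto
    then have "e *\<^sub>R v \<in> group_closure \<Phi>" using e by auto
    \<comment> \<open>The difference lies both in the root lattice and in $U$, hence is an integral
      multiple of \<open>a\<close>.\<close>
    then have "r - e *\<^sub>R v \<in> group_closure {a}"
      using r inU LU(2) by (blast intro: group_closure.intros)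
    then have "\<exists>z::int. coa (r - e *\<^sub>R v) = of_int z * 1"
      by (rule group_closure_functional [OF coa(1)]) (use coaa in \<open>auto intro: exI [of _ 1]\<close>)
    then have "x \<in> \<int>" unfolding x using coa(1) coaa by (auto simp: linear_scale)
    moreover have "coa v = 0" unfolding v_def using coa(1) by (simp add: linear_sum linear_scale coa\<alpha>)
    ultimately have "coa r \<in> \<int>" using coa(1) coaa by (simp add: r_eq linear_add linear_scale)
    moreover have "co i r = e * real (k i)" if "i \<le> n" for i
    proof -
      have "co i v = (\<Sum>j\<le>n. real (k j) * co i (\<alpha> j))"
        unfolding v_def using co(1) by (simp add: linear_sum linear_scale)
      also have "\<dots> = (\<Sum>j\<le>n. if j = i then real (k j) else 0)"
        using that by (intro sum.cong) (auto simp: co\<alpha>)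
      finally have "co i v = (\<Sum>j\<le>n. if j = i then real (k j) else 0)" .
      then have "co i v = real (k i)" using that by simp
      then show ?thesis using co(1) co_a that by (simp add: r_eq linear_add linear_scale)
    qed
    ultimately show ?thesis using e(1) by (intro exI [of _ k]) auto
  qed
  \<comment> \<open>Preimages of a simple system of the finite root system form a basis of $V$
    together with \<open>a\<close> and \<delta>, so the dimension determines the rank.\<close>
  have rank: "n = type_rank Y" if Y: "fin_type B \<Phi> Y" for Y
  proof -
    obtain q :: "'v \<Rightarrow> 'v" and r :: "nat \<Rightarrow> 'v" where q: "linear q" "{v. q v = 0} = radical B"
      and r: "inj_on (q \<circ> r) {..<type_rank Y}" "independent (q ` r ` {..<type_rank Y})"
      and gen: "\<And>\<psi>. \<psi> \<in> q ` \<Phi> \<Longrightarrow> \<exists>k :: nat \<Rightarrow> nat.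
        \<psi> = (\<Sum>i\<in>{..<type_rank Y}. real (k i) *\<^sub>R (q \<circ> r) i) \<or>
        \<psi> = - (\<Sum>i\<in>{..<type_rank Y}. real (k i) *\<^sub>R (q \<circ> r) i)"
      using Y unfolding fin_type_def quotient_map_of_def simple_system_def
      by (fastforce simp: image_comp)
    define S where "S = r ` {..<type_rank Y}"
    have injS: "inj_on q S" "inj_on r {..<type_rank Y}"
      using r(1) by (auto simp: S_def intro: inj_on_imageI inj_on_imageI2)
    have indS: "independent S" using independent_preimage q(1) r(2) injS by (auto simp: S_def)
    have q_inj: "inj_on q (span S)"
      using linear_inj_on_span_independent_image [OF q(1)] r(2) injS(1) by (simp add: S_def)
    have span0: "v = 0" if "v \<in> span S" "v \<in> radical B" for v
      using inj_onD [OF q_inj, of v 0] that q linear_0 [OF q(1)] by (auto simp: span_zero)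
    have "a \<in> radical B" using a_rad by (simp add: radical_def)
    have aS: "a \<notin> span S" using span0 [of a] a0 \<open>a \<in> radical B\<close> by blast
    have \<delta>S: "\<delta> \<notin> span (insert a S)"
    proof
      assume "\<delta> \<in> span (insert a S)"
      then obtain x where "\<delta> - x *\<^sub>R a \<in> span S" by (auto simp: span_insert)
      moreover have "\<delta> - x *\<^sub>R a \<in> radical B" using a_rad \<delta>_rad by (simp add: radical_def)
      ultimately have "\<delta> - x *\<^sub>R a = 0" using span0 by blast
      then show False using \<delta>_a by (auto simp: span_singleton)
    qed
    define Z where "Z = insert \<delta> (insert a S)"
    have indZ: "independent Z" unfolding Z_def using aS \<delta>S indS by (intro independent_insertI)
    have cardZ: "card Z = type_rank Y + 2"
      unfolding Z_def using aS \<delta>S injS(2)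
      by (auto simp: card_insert_if S_def card_image span_base)
    have "v \<in> span Z" for v
    proof -
      have "q ` \<Phi> \<subseteq> span (q ` S)"
      proof
        fix \<psi> assume "\<psi> \<in> q ` \<Phi>"
        from gen [OF this] obtain k :: "nat \<Rightarrow> nat" where
          "\<psi> = (\<Sum>i\<in>{..<type_rank Y}. real (k i) *\<^sub>R (q \<circ> r) i) \<or>
           \<psi> = - (\<Sum>i\<in>{..<type_rank Y}. real (k i) *\<^sub>R (q \<circ> r) i)" by blast
        moreover have "(\<Sum>i\<in>{..<type_rank Y}. real (k i) *\<^sub>R (q \<circ> r) i) \<in> span (q ` S)"
          by (intro span_sum span_scale span_base) (auto simp: S_def)
        ultimately show "\<psi> \<in> span (q ` S)" by (metis span_neg)
      qed
      then have "span (q ` \<Phi>) \<subseteq> span (q ` S)" by (metis span_mono span_span)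
      then have "q v \<in> q ` span S"
        unfolding linear_span_image [OF q(1)] span_\<Phi> by blast
      then obtain w where w: "w \<in> span S" "q v = q w" by auto
      then have "q (v - w) = 0" using q(1) by (simp add: linear_diff)
      then have "v - w \<in> radical B" unfolding q(2) [symmetric] by blast
      then have "v - w \<in> span Z"
        using rad_span span_mono [of "{\<delta>, a}" Z] by (auto simp: Z_def)
      moreover have "w \<in> span Z" using w span_mono [of S Z] by (auto simp: Z_def)
      ultimately show ?thesis by (metis diff_add_cancel span_add)
    qed
    then have "dim (UNIV :: 'v set) = type_rank Y + 2"
      using indZ cardZ by (intro dim_unique [of Z]) auto
    then show ?thesis using dim_UNIV by simp
  qed
  obtain Y where Y: "fin_type B \<Phi> Y" using tub by (auto simp: tubular_def)
  have n2: "n \<ge> 2" using rank [OF Y] by (cases Y) auto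
  have "elliptic_basis B \<Phi> n t \<alpha> a co coa m"
  proof
    show "m i \<le> m t" if "i \<le> n" for i
    proof (cases "i = 0")
      case True
      then show ?thesis using t(1) m0_pos [OF t(1)] by (auto simp: m_def)
    next
      case False
      then have "m0 i \<le> m0 t" using that t(2) by (auto intro: Max_ge)
      then show ?thesis using False t(1) by (auto simp: m_def)
    qed
    show "m i > 0" if "i \<le> n" for i using that m0_pos [of i] by (auto simp: m_def)
    show "\<exists>\<eta>\<in>\<Phi>. B r \<eta> = 1 \<or> B r \<eta> = - 1" if "r \<in> \<Phi>" for r
      using exists_unit_pairing ers irr Y that by blast
    show "B (\<Sum>i\<le>n. real (m i) *\<^sub>R \<alpha> i) v = 0" for v using \<delta>_rad by (simp add: \<delta>_def)
    show "\<exists>x y. v = x *\<^sub>R a + y *\<^sub>R (\<Sum>i\<le>n. real (m i) *\<^sub>R \<alpha> i)" if "\<And>w. B v w = 0" for v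
      using radical [OF that] by (simp add: \<delta>_def)
    show "v = (\<Sum>i\<le>n. co i v *\<^sub>R \<alpha> i) + coa v *\<^sub>R a" for v by (rule expansion)
    show "\<exists>k :: nat \<Rightarrow> nat. (\<forall>i\<le>n. co i r = k i) \<or> (\<forall>i\<le>n. co i r = - real (k i))" if "r \<in> \<Phi>" for r
      using coords [OF that] by blast
    show "coa r \<in> \<int>" if "r \<in> \<Phi>" for r using coords [OF that] by blast
    show "m 0 = 1" by (simp add: m_def)
    show "1 \<le> t" "t \<le> n" using t(1) by auto
    show "\<alpha> i \<in> \<Phi>" if "i \<le> n" for i using \<alpha> that by auto
    show "a \<in> group_closure \<Phi>" by (rule aLU(1))
  qed (simp_all add: norm refl Ints linear_add [OF co(1)] linear_scale [OF co(1)]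
      linear_add [OF coa(1)] linear_scale [OF coa(1)] co\<alpha> co_a coa\<alpha> coaa a_rad n2)
  then show ?thesis using \<alpha>' rank by blast
qed

lemma (in elliptic_basis) E_type_mark:
  assumes "fin_type B \<Phi> X" "X \<noteq> D4"
  shows "m t \<ge> 3"
proof -
  obtain r where r: "r ` {..<type_rank X} \<subseteq> \<Phi>"
    "\<And>i j. i < type_rank X \<Longrightarrow> j < type_rank X \<Longrightarrow> B (r i) (r j) = cartan_entry X i j"
    using assms(1) by (auto simp: fin_type_def)
  \<comment> \<open>The chain 0, ..., 4 and the vertex attached to 2, which carries the last index,
    form a diagram \<open>E6\<close>.\<close>
  define f where "f = (\<lambda>i::nat. if i = 5 then type_rank X - 1 else i)"
  have f: "f i < type_rank X" if "i < 6" for i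
    using assms(2) that by (cases X) (auto simp: f_def)
  have "\<forall>i<6. \<forall>j<6. cartan_entry X (f i) (f j) = cartan_entry E6 i j"
    using assms(2) by (cases X) (simp_all add: f_def cartan_entry_def numeral_eq_Suc All_less_Suc)
  then have "E6_family (r \<circ> f)"
    using r f by (auto simp: E6_family_def)
  then show ?thesis by (rule E6_family_mark)
qed

theorem theorem1p3:
  fixes B :: "'v::real_vector \<Rightarrow> 'v \<Rightarrow> real"
    and \<Phi> :: "'v set"
    and n t :: nat
    and \<alpha> :: "nat \<Rightarrow> 'v"
    and \<alpha>' :: 'v
    and c :: "'v \<Rightarrow> 'v"
  assumes "tubular B \<Phi>"
    and "elliptic_root_basis B \<Phi> n \<alpha> t \<alpha>'"
    and "coxeter_transformation B n \<alpha> t \<alpha>' c"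
  defines "E \<equiv> Red_gen B \<Phi> (n + 2) c"
  shows "(\<not> fin_type B \<Phi> D4 \<longrightarrow>
            transitive_action (braid_group (n + 2)) E (hurwitz_action perm_group E)) \<and>
         (fin_type B \<Phi> D4 \<longrightarrow>
            group_action (braid_group (n + 2)) E (hurwitz_action perm_group E) \<and>
            card (orbits (braid_group (n + 2)) E (hurwitz_action perm_group E)) = 2)"
proof -
  obtain a co coa m where loc: "elliptic_basis B \<Phi> n t \<alpha> a co coa m" and \<alpha>': "\<alpha>' = \<alpha> t + a"
    and rank: "\<And>X. fin_type B \<Phi> X \<Longrightarrow> n = type_rank X"
    using elliptic_basis_exists [OF assms(1,2)] by blast
  interpret elliptic_basis B \<Phi> n t \<alpha> a co coa m by (rule loc)
  obtain "is" where "is": "distinct is" "set is = {..n} - {t}"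
    and c: "c = list_prod perm_group (map (\<lambda>i. reflection B (\<alpha> i)) is @ [reflection B (\<alpha> t), reflection B \<alpha>'])"
    using assms(3) by (auto simp: coxeter_transformation_def atLeast0AtMost)
  have "norm2 (map \<alpha> is @ tail 1)" using "is"(2) by (auto simp: tail_def)
  from list_prod_rp [OF this] have c_rp: "c = rp (map \<alpha> is @ tail 1)"
    unfolding c \<alpha>' by (simp add: tail_def comp_def)
  obtain X where X: "fin_type B \<Phi> X" using assms(1) by (auto simp: tubular_def)
  note E = E_def [THEN meta_eq_to_obj_eq]
  show ?thesis
  proof (intro conjI impI)
    assume "\<not> fin_type B \<Phi> D4"
    then have "m t \<ge> 3" using E_type_mark X by metis
    then show "transitive_action (braid_group (n + 2)) E (hurwitz_action perm_group E)"
      by (rule Hurwitz_transitive [OF "is" c_rp E])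
  next
    assume D4: "fin_type B \<Phi> D4"
    show "group_action (braid_group (n + 2)) E (hurwitz_action perm_group E)"
      by (rule action [OF "is" c_rp E])
    have "m t \<le> 2" using rank [OF D4] by (intro rank_4_mark) simp
    then show "card (orbits (braid_group (n + 2)) E (hurwitz_action perm_group E)) = 2"
      by (rule Hurwitz_two_orbits [OF "is" c_rp E])
  qed
qed

end
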